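(* Let $k\ge 2$. The conditional test based on the test statistic $$IL=\int_{-\infty}^{\infty} \exp\Big\{\tfrac12\big[\mathrm{vec}(R_0)'\Sigma_0^{-1/2}N_{\Sigma_0^{-1/2}(a_\Delta\otimes I_k)}\Sigma_0^{-1/2}\mathrm{vec}(R_0)-T'T\big]\Big\}\,\big|(a_\Delta'\otimes I_k)\Sigma_0^{-1}(a_\Delta\otimes I_k)\big|^{-1/2}\,|\Delta|^{k-2}\,d\Delta$$ is invariant (to the group $\mathcal G_L(k)\times\mathcal G_T(2)$ described in the context) and is the limit of a sequence of weighted average power (WAP) tests, i.e. of tests that reject the null when $f_{w}(r_0,\Sigma_0)/f_S(s)>\kappa(t,\Sigma_0)$.
   Context: Model: $R_0=[R_1:R_2]$ is a random $k\times 2$ matrix with $\mathrm{vec}(R_0)\sim N(a_\Delta\otimes\mu,\Sigma_0)$, where $a_\Delta=(\Delta,1)'$, $\Delta\in\mathbb R$ and $\mu\in\mathbb R^k$ are unknown, and the $2k\times 2k$ positive definite matrix $\Sigma_0$ is known but not fixed (it is treated as part of the data and changes with data transformations). The null hypothesis is $H_0:\Delta=0$, against $\Delta\ne0$. Notation: partition $\Sigma_0$ into $k\times k$ blocks $\Sigma_{ij}$ and $\Sigma_0^{-1}$ into $k\times k$ blocks $\Sigma^{ij}$, $i,j=1,2$. Define $S=\Sigma_{11}^{-1/2}R_1$ and $T=(\Sigma^{22})^{-1/2}[\Sigma^{21}:\Sigma^{22}]\,\mathrm{vec}(R_0)$. Given $\Sigma_0$, $(S,T)$ is a one-to-one linear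 transformation of $R_0$; $S$ and $T$ are independent, and $S\sim N(0,I_k)$ under $H_0$. Lower-case $r_0,s,t$ denote realizations of $R_0,S,T$. For a matrix $A$ of full column rank, $N_A=A(A'A)^{-1}A'$; $|\cdot|$ of a square matrix denotes its determinant. Conditional test: the conditional test (at level $\alpha$) based on a statistic $\psi(S,T,\Sigma_0)$ rejects $H_0$ when $\psi(s,t,\Sigma_0)>\kappa_\psi(t,\Sigma_0)$, where $\kappa_\psi(t,\Sigma_0)$ is the $1-\alpha$ quantile of the null distribution of $\psi(S,t,\Sigma_0)$. Invariance: $\mathcal G_L(k)$ is the group of invertible $k\times k$ real matrices and $\mathcal G_T(2)$ the group of invertible lower triangular $2\times 2$ real matrices; $g=(g_1,g_2)\in\mathcal G_L(k)\times\mathcal G_T(2)$ acts on the data by $g\circ(R_0,\Sigma_0)=(g_1R_0g_2',(g_2\otimes g_1)\Sigma_0(g_2'\otimes g_1'))$. A test is invariant if it is the same whether computed from the original data or from the transformed data, for every $g$. WAP tests: $f_R(r_0;\Delta,\mu,\Sigma_0)$ is the $N(a_\Delta\otimes\mu,\Sigma_0)$ density of $\mathrm{vec}(R_0)$; for a measure $w$ on the space of $(\Delta,\mu)$, $f_w(r_0,\Sigma_0)=\int f_R(r_0;\Delta,\mu,\Sigma_0)\,dw(\Delta,\mu)$; $f_S(s)=(2\pi)^{-k/2}e^{-s's/2}$ is the density of $S$ under the null. The WAP test with weight $w$ maximizes the weighted average power $\int\phi(r_0,\Sigma_0)f_w(r_0,\Sigma_0)\,dr_0$ among tests $0\le\phi\le1$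 whose null rejection probability equals $\alpha$ for all $\mu$; it rejects when $f_w(r_0,\Sigma_0)/f_S(s)>\kappa(t,\Sigma_0)$, with $\kappa(t,\Sigma_0)$ the null $1-\alpha$ quantile of the left-hand side conditional on $T=t$. *)

theory Defs
  imports "HOL-Probability.Probability"
begin

section \<open>Matrices\<close>

text \<open>
  The coordinates of the space of dimension \<open>2k\<close> are indexed by pairs \<open>(j, i)\<close>, where \<open>j\<close> is
  the column of the \<open>k \<times> 2\<close> matrix and \<open>i\<close> its row. This is the ordering of \<open>vec\<close> (stacked
  columns), and it turns the Kronecker product into a componentwise product. The index type \<open>2\<close>
  has the two elements \<open>1\<close> and \<open>2\<close>.
\<close>

definition vec_mat :: "'a ^ 'n ^ 'm \<Rightarrow> 'a ^ ('n \<times> 'm)" where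
  "vec_mat R = (\<chi> p. R $ snd p $ fst p)"

definition kron :: "real ^ 'n ^ 'm \<Rightarrow> real ^ 'q ^ 'p \<Rightarrow> real ^ ('n \<times> 'q) ^ ('m \<times> 'p)" where
  "kron A B = (\<chi> p q. A $ fst p $ fst q * B $ snd p $ snd q)"

definition kron_vec :: "real ^ 'm \<Rightarrow> real ^ 'p \<Rightarrow> real ^ ('m \<times> 'p)" where
  "kron_vec a b = (\<chi> p. a $ fst p * b $ snd p)"

text \<open>The product \<open>a \<otimes> B\<close> of a column vector and a matrix, so that its columns are indexed as
  those of \<open>B\<close>.\<close>

definition kron_col :: "real ^ 'm \<Rightarrow> real ^ 'q ^ 'p \<Rightarrow> real ^ 'q ^ ('m \<times> 'p)" where
  "kron_col a B = (\<chi> p q. a $ fst p * B $ snd p $ q)"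

definition pos_def :: "real ^ 'n ^ 'n \<Rightarrow> bool" where
  "pos_def A \<longleftrightarrow> transpose A = A \<and> (\<forall>x. x \<noteq> 0 \<longrightarrow> 0 < x \<bullet> (A *v x))"

text \<open>The positive definite square root; it is unique, so that the choice operator makes no
  arbitrary choice when \<open>A\<close> is positive definite.\<close>

definition sqrt_mat :: "real ^ 'n ^ 'n \<Rightarrow> real ^ 'n ^ 'n" where
  "sqrt_mat A = (SOME B. pos_def B \<and> B ** B = A)"

definition inv_sqrt_mat :: "real ^ 'n ^ 'n \<Rightarrow> real ^ 'n ^ 'n" where
  "inv_sqrt_mat A = matrix_inv (sqrt_mat A)"

definition proj_mat :: "real ^ 'n ^ 'm \<Rightarrow> real ^ 'm ^ 'm" where
  "proj_mat A = A ** matrix_inv (transpose A ** A) ** transpose A"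

definition block :: "real ^ (2 \<times> 'k) ^ (2 \<times> 'k) \<Rightarrow> 2 \<Rightarrow> 2 \<Rightarrow> real ^ 'k ^ 'k" where
  "block M i j = (\<chi> p q. M $ (i, p) $ (j, q))"

definition block_row :: "real ^ (2 \<times> 'k) ^ (2 \<times> 'k) \<Rightarrow> 2 \<Rightarrow> real ^ (2 \<times> 'k) ^ 'k" where
  "block_row M i = (\<chi> p. M $ (i, p))"

lemma block_row_nth: "block_row M i $ p $ (j, q) = block M i j $ p $ q"
  by (simp add: block_row_def block_def)

section \<open>The model\<close>

definition a_vec :: "real \<Rightarrow> real ^ 2" where
  "a_vec \<Delta> = vector [\<Delta>, 1]"

definition S_stat :: "real ^ (2 \<times> 'k) ^ (2 \<times> 'k) \<Rightarrow> real ^ 2 ^ 'k \<Rightarrow> real ^ 'k" where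
  "S_stat \<Sigma> R = inv_sqrt_mat (block \<Sigma> 1 1) *v column 1 R"

definition T_stat :: "real ^ (2 \<times> 'k) ^ (2 \<times> 'k) \<Rightarrow> real ^ 2 ^ 'k \<Rightarrow> real ^ 'k" where
  "T_stat \<Sigma> R =
     inv_sqrt_mat (block (matrix_inv \<Sigma>) 2 2) *v (block_row (matrix_inv \<Sigma>) 2 *v vec_mat R)"

text \<open>The realization of \<open>R\<^sub>0\<close> that corresponds to \<open>(S, T) = (s, t)\<close>.\<close>

definition data_of :: "real ^ (2 \<times> 'k) ^ (2 \<times> 'k) \<Rightarrow> real ^ 'k \<Rightarrow> real ^ 'k \<Rightarrow> real ^ 2 ^ 'k" where
  "data_of \<Sigma> s t = inv (\<lambda>R. (S_stat \<Sigma> R, T_stat \<Sigma> R)) (s, t)"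

definition f_R :: "real ^ 2 ^ 'k \<Rightarrow> real \<Rightarrow> real ^ 'k \<Rightarrow> real ^ (2 \<times> 'k) ^ (2 \<times> 'k) \<Rightarrow> real" where
  "f_R R \<Delta> \<mu> \<Sigma> =
     (let d = vec_mat R - kron_vec (a_vec \<Delta>) \<mu> in
      (2 * pi) powr (- real CARD(2 \<times> 'k) / 2) * det \<Sigma> powr (- 1 / 2) *
      exp (- (d \<bullet> (matrix_inv \<Sigma> *v d)) / 2))"

definition f_S :: "real ^ 'k \<Rightarrow> real" where
  "f_S s = (2 * pi) powr (- real CARD('k) / 2) * exp (- (s \<bullet> s) / 2)"

definition null_S :: "(real ^ 'k) measure" where
  "null_S = density lborel (\<lambda>s. ennreal (f_S s))"

section \<open>Tests\<close>

definition quantile :: "real \<Rightarrow> 'a measure \<Rightarrow> ('a \<Rightarrow> real) \<Rightarrow> real" where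
  "quantile p M X = Inf {x. p \<le> measure M {\<omega> \<in> space M. X \<omega> \<le> x}}"

type_synonym 'k statistic = "real ^ 2 ^ 'k \<Rightarrow> real ^ (2 \<times> 'k) ^ (2 \<times> 'k) \<Rightarrow> real"

text \<open>Statistics and tests are functions of the data \<open>(R\<^sub>0, \<Sigma>\<^sub>0)\<close>. As \<open>(S, T)\<close> determines \<open>R\<^sub>0\<close>, a
  statistic \<open>\<psi>\<close> evaluated at \<open>(s, t, \<Sigma>\<^sub>0)\<close> is \<open>\<psi> (data_of \<Sigma>\<^sub>0 s t) \<Sigma>\<^sub>0\<close>. The value of a test is the
  probability (0 or 1) with which it rejects.\<close>

definition critical_value :: "real \<Rightarrow> ('k::finite) statistic \<Rightarrow> real ^ 'k \<Rightarrow>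
    real ^ (2 \<times> 'k) ^ (2 \<times> 'k) \<Rightarrow> real" where
  "critical_value \<alpha> \<psi> t \<Sigma> = quantile (1 - \<alpha>) null_S (\<lambda>s. \<psi> (data_of \<Sigma> s t) \<Sigma>)"

definition conditional_test :: "real \<Rightarrow> ('k::finite) statistic \<Rightarrow> 'k statistic" where
  "conditional_test \<alpha> \<psi> R \<Sigma> = of_bool (\<psi> R \<Sigma> > critical_value \<alpha> \<psi> (T_stat \<Sigma> R) \<Sigma>)"

definition invariant_test :: "('k::finite) statistic \<Rightarrow> bool" where
  "invariant_test \<phi> \<longleftrightarrow>
     (\<forall>R \<Sigma> (g1 :: real ^ 'k ^ 'k) (g2 :: real ^ 2 ^ 2).
        pos_def \<Sigma> \<longrightarrow> invertible g1 \<longrightarrow> invertible g2 \<longrightarrow> g2 $ 1 $ 2 = 0 \<longrightarrow>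
        \<phi> (g1 ** R ** transpose g2)
          (kron g2 g1 ** \<Sigma> ** kron (transpose g2) (transpose g1)) = \<phi> R \<Sigma>)"

definition weight :: "(real \<times> (real ^ 'k)) measure \<Rightarrow> bool" where
  "weight w \<longleftrightarrow> prob_space w \<and> sets w = sets borel"

definition f_w :: "(real \<times> (real ^ 'k)) measure \<Rightarrow> ('k::finite) statistic" where
  "f_w w R \<Sigma> = (\<integral>(\<Delta>, \<mu>). f_R R \<Delta> \<mu> \<Sigma> \<partial>w)"

text \<open>As \<open>S\<close> and \<open>T\<close> are independent, the null distribution of the statistic conditional on
  \<open>T = t\<close> is its distribution with \<open>t\<close> held fixed; a WAP test is thus a conditional test.\<close>

definition WAP_test :: "real \<Rightarrow> (real \<times> (real ^ 'k)) measure \<Rightarrow> ('k::finite) statistic" where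
  "WAP_test \<alpha> w = conditional_test \<alpha> (\<lambda>R \<Sigma>. f_w w R \<Sigma> / f_S (S_stat \<Sigma> R))"

section \<open>The integrated likelihood statistic\<close>

definition IL :: "('k::finite) statistic" where
  "IL R \<Sigma> =
     (\<integral>\<Delta>.
        (let v = vec_mat R;
             A = kron_col (a_vec \<Delta>) (mat 1 :: real ^ 'k ^ 'k);
             H = inv_sqrt_mat \<Sigma>;
             T = T_stat \<Sigma> R
         in exp ((v \<bullet> ((H ** proj_mat (H ** A) ** H) *v v) - T \<bullet> T) / 2) *
            det (transpose A ** matrix_inv \<Sigma> ** A) powr (- 1 / 2) *
            \<bar>\<Delta>\<bar> ^ (CARD('k) - 2))
      \<partial>lborel)"

end

theory Submission
  imports Defs
begin

text \<open>
  In the coordinate \<open>u = 1 / \<Delta>\<close> the statistic \<open>IL\<close> is the Lebesgue integral over \<open>u\<close> of a kernel without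
  weight. The group acts on the direction \<open>(1, u)\<close>, hence on \<open>u\<close> by an affine map, so that \<open>IL\<close> is
  multiplied by a constant, while \<open>S\<close> and \<open>T\<close> are rotated; the null distribution of \<open>S\<close> is rotation
  invariant, so critical values are multiplied by the same constant.

  Completing the square, the kernel is a Gaussian integral over \<open>\<mu>\<close>. Thus \<open>IL\<close> is a limit of multiples of
  weighted likelihood ratios for uniform weights on growing balls of \<open>(u, \<mu>)\<close>. For fixed \<open>t\<close>, \<open>IL\<close> is
  continuous and strictly convex in \<open>s\<close>: its level sets are boundaries of convex sets, hence null, and its
  range is an interval. Its null distribution therefore has a continuous distribution function that
  increases strictly up to level one, so the quantiles converge, and \<open>IL\<close> differs from its critical
  value almost everywhere.
\<close>

section \<open>Positive definite matrices\<close>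

text \<open>The weight in \<open>IL\<close> is a Jacobian. The mean with direction (\<Delta>, 1) and
  vector m is also the mean with direction (1, u) and vector \<mu>, where u = 1 / \<Delta> and m = u
  \<mu>, and du d\<mu> = |\<Delta>|^(k-2) d\<Delta> dm. So \<open>IL\<close> belongs to the flat
  weight on (u, \<mu>). That weight has infinite mass, whereas \<open>weight\<close> asks for a
  probability measure; hence the truncation to balls. Their volumes diverge, but this is harmless: a
  statistic and its quantiles scale alike.

  The assumption k >= 2 acts through the tails: the kernel is at most a multiple of (1 +
  u^2)^(-k/2), which is then integrable, so the Bochner integrals are not default values.

  Integrating \<mu> out also leaves a factor independent of u. It is exp(-S'S/2), because vec(R)'
  \<Sigma>^(-1) vec(R) = S'S + T'T, and \<open>f_S\<close> cancels it.

  Convergence of the tests may fail where \<open>IL\<close> ties with its critical value. Ties are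
  null in s for each t; passing to a null set of R by Fubini needs a measurable tie set, which comes
  from continuity of the critical value in t.\<close>

text \<open>Induction on the dimension: a maximiser of the Rayleigh quotient on the unit sphere of
  \<open>V\<close> is an eigenvector, and by self-adjointness its orthogonal complement in
  \<open>V\<close> is again invariant. The basis serves to construct matrix square roots.\<close>

lemma self_adjoint_eigenbasis:
  fixes f :: "'a::euclidean_space \<Rightarrow> 'a"
  assumes lin: "linear f" and sa: "\<And>x y. f x \<bullet> y = x \<bullet> f y"
    and "subspace V" and "f ` V \<subseteq> V"
  shows "\<exists>E. finite E \<and> E \<subseteq> V \<and> pairwise orthogonal E \<and> (\<forall>e\<in>E. norm e = 1) \<and>
           V \<subseteq> span E \<and> (\<forall>e\<in>E. f e = (e \<bullet> f e) *\<^sub>R e)"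
  using assms(3,4)
proof (induction "dim V" arbitrary: V rule: less_induct)
  case (less V)
  show ?case
  proof (cases "V \<subseteq> {0}")
    case True
    then show ?thesis by (intro exI[of _ "{}"]) auto
  next
    case False
    then obtain x where x: "x \<in> V" "x \<noteq> 0" by auto
    let ?K = "sphere 0 1 \<inter> V"
    have "(1 / norm x) *\<^sub>R x \<in> ?K"
      using x less.prems(1) by (auto simp: subspace_scale)
    then have K1: "?K \<noteq> {}" by blast
    have K2: "compact ?K"
      by (intro compact_Int_closed compact_sphere closed_subspace less.prems)
    have K3: "continuous_on ?K (\<lambda>x. x \<bullet> f x)"
      using lin by (intro continuous_intros linear_continuous_on) (simp add: linear_linear)
    from continuous_attains_sup[OF K2 K1 K3]
    obtain e where e: "e \<in> ?K" and emax: "\<And>y. y \<in> ?K \<Longrightarrow> y \<bullet> f y \<le> e \<bullet> f e"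
      by blast
    define c where "c = e \<bullet> f e"
    have en: "norm e = 1" and eV: "e \<in> V" and ee: "e \<bullet> e = 1"
      using e by (auto simp: norm_eq_1)
    have le: "y \<bullet> f y \<le> c * (y \<bullet> y)" if "y \<in> V" for y
    proof (cases "y = 0")
      case True
      then show ?thesis by simp
    next
      case False
      then have "(1 / norm y) *\<^sub>R y \<in> ?K"
        using that less.prems(1) by (auto simp: subspace_scale)
      from emax[OF this] have "(1 / norm y) * ((1 / norm y) * (y \<bullet> f y)) \<le> c"
        by (simp add: linear_scale[OF lin] c_def)
      with False show ?thesis
        by (simp add: field_simps dot_square_norm power2_eq_square)
    qed
    \<comment> \<open>First-order optimality of \<open>e\<close>: moving to
      \<open>e + t *\<^sub>R w\<close> must not increase the quotient, so the term linear in
      \<open>t\<close> vanishes.\<close>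
    have orth: "w \<bullet> f e = 0" if w: "w \<in> V" "w \<bullet> e = 0" for w
    proof -
      define b m where "b = w \<bullet> f e" and "m = c * (w \<bullet> w) - w \<bullet> f w"
      have fw: "e \<bullet> f w = b"
        using sa[of e w] by (simp add: b_def inner_commute)
      have *: "2 * t * b \<le> t\<^sup>2 * m" for t
      proof -
        have "e + t *\<^sub>R w \<in> V"
          using less.prems(1) eV w by (simp add: subspace_add subspace_scale)
        from le[OF this] have "c + 2 * t * b + t\<^sup>2 * (w \<bullet> f w) \<le> c * (1 + t\<^sup>2 * (w \<bullet> w))"
          using w(2) ee fw
          by (simp add: linear_add[OF lin] linear_scale[OF lin] inner_add_left inner_add_right
              inner_commute[of e w] c_def[symmetric] b_def[symmetric] power2_eq_square algebra_simps)
        then show ?thesis by (simp add: m_def algebra_simps)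
      qed
      have mp: "0 \<le> m" using le[OF w(1)] by (simp add: m_def)
      \<comment> \<open>A step this short lets the linear term dominate; the \<open>+ 1\<close>
        keeps the denominator positive when \<open>m = 0\<close>.\<close>
      have "2 * (b / (m + 1)) * b \<le> (b / (m + 1))\<^sup>2 * m" by (rule *)
      with mp have "2 * b\<^sup>2 * (m + 1) \<le> b\<^sup>2 * m"
        by (simp add: divide_simps power2_eq_square split: if_splits)
      then have "b\<^sup>2 * (m + 2) \<le> 0" by (simp add: algebra_simps)
      with mp have "b\<^sup>2 \<le> 0" by (simp add: mult_le_0_iff)
      then show ?thesis by (simp add: b_def)
    qed
    have fe: "f e = c *\<^sub>R e"
    proof -
      let ?w = "f e - c *\<^sub>R e"
      have "?w \<in> V"
        using eV less.prems by (auto intro!: subspace_diff subspace_scale)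
      moreover have we: "?w \<bullet> e = 0"
        using ee by (simp add: inner_diff_left inner_diff_right c_def inner_commute)
      ultimately have "?w \<bullet> f e = 0" by (rule orth)
      then have "?w \<bullet> ?w = 0"
        using we by (simp add: inner_diff_right)
      then show ?thesis by simp
    qed
    define W where "W = V \<inter> {x. e \<bullet> x = 0}"
    have sW: "subspace W"
      unfolding W_def by (intro subspace_inter less.prems(1) subspace_hyperplane)
    have "e \<notin> W" using ee by (simp add: W_def)
    then have "W \<subset> V" using eV unfolding W_def by blast
    moreover have "span W = W" "span V = V"
      using sW less.prems(1) by (simp_all add: span_eq_iff)
    ultimately have "dim W < dim V" by (metis dim_psubset)
    moreover have "f ` W \<subseteq> W"
      using less.prems(2) fe by (auto simp: W_def sa[symmetric])
    ultimately obtain E where E: "finite E" "E \<subseteq> W" "pairwise orthogonal E"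
        "\<forall>e\<in>E. norm e = 1" "W \<subseteq> span E" "\<forall>e\<in>E. f e = (e \<bullet> f e) *\<^sub>R e"
      using less.hyps[of W] sW by blast
    have "V \<subseteq> span (insert e E)"
    proof
      fix x assume "x \<in> V"
      then have "x - (e \<bullet> x) *\<^sub>R e \<in> W"
        using less.prems(1) eV ee by (auto simp: W_def inner_diff_right intro!: subspace_diff subspace_scale)
      then have "x - (e \<bullet> x) *\<^sub>R e \<in> span (insert e E)"
        using E(5) span_mono[of E "insert e E"] by blast
      moreover have "(e \<bullet> x) *\<^sub>R e \<in> span (insert e E)"
        by (simp add: span_base span_scale)
      ultimately show "x \<in> span (insert e E)"
        by (metis diff_add_cancel span_add)
    qed
    moreover have "pairwise orthogonal (insert e E)"
      using E(2,3) by (auto simp: pairwise_insert orthogonal_def W_def inner_commute)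
    moreover have "insert e E \<subseteq> V"
      using E(2) eV by (auto simp: W_def)
    moreover have "\<forall>y\<in>insert e E. f y = (y \<bullet> f y) *\<^sub>R y"
      using E(6) fe by (auto simp: c_def)
    ultimately show ?thesis
      using E(1,4) en by (intro exI[of _ "insert e E"]) auto
  qed
qed

lemma pos_def_sym: "pos_def A \<Longrightarrow> transpose A = A"
  and pos_def_pos: "pos_def A \<Longrightarrow> x \<noteq> 0 \<Longrightarrow> 0 < x \<bullet> (A *v x)"
  by (auto simp: pos_def_def)

lemma pos_def_nonneg: "pos_def A \<Longrightarrow> 0 \<le> x \<bullet> (A *v x)"
  by (cases "x = 0") (auto simp: pos_def_def less_imp_le)

lemma inner_matrix_vector: "x \<bullet> (A *v y) = (transpose A *v x) \<bullet> y" for A :: "real^'n^'m"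
  by (simp add: dot_lmul_matrix)

lemma pos_def_inner: "pos_def A \<Longrightarrow> x \<bullet> (A *v y) = (A *v x) \<bullet> y"
  by (metis inner_matrix_vector pos_def_sym)

lemma pos_def_invertible:
  assumes "pos_def A"
  shows "invertible A"
proof -
  have "x = 0" if "A *v x = 0" for x
    using pos_def_pos[OF assms, of x] that by auto
  then show ?thesis
    by (metis invertible_left_inverse matrix_left_invertible_ker)
qed

lemma
  fixes A :: "real^'n^'n"
  assumes "invertible A"
  shows matrix_inv_right: "A ** matrix_inv A = mat 1"
    and matrix_inv_left: "matrix_inv A ** A = mat 1"
  using assms by (auto simp: invertible_def matrix_inv_def dest!: someI_ex)

lemma matrix_inv_eqI: "A ** B = mat 1 \<Longrightarrow> matrix_inv A = B" for A B :: "real^'n^'n"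
  by (metis invertible_def matrix_inv_left matrix_left_right_inverse matrix_mul_assoc
      matrix_mul_lid matrix_mul_rid)

lemma symmetric_matrix_inv:
  fixes A :: "real^'n^'n"
  assumes "invertible A" "transpose A = A"
  shows "transpose (matrix_inv A) = matrix_inv A"
proof -
  have "transpose (matrix_inv A ** A) = mat 1"
    by (simp add: matrix_inv_left assms transpose_mat)
  then have "A ** transpose (matrix_inv A) = mat 1"
    by (simp add: matrix_transpose_mul assms)
  then show ?thesis by (metis matrix_inv_eqI)
qed

lemma pos_def_matrix_inv:
  assumes "pos_def A"
  shows "pos_def (matrix_inv A)"
proof -
  note inv = pos_def_invertible[OF assms]
  have "0 < x \<bullet> (matrix_inv A *v x)" if "x \<noteq> 0" for x
  proof -
    let ?y = "matrix_inv A *v x"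
    have y: "A *v ?y = x"
      by (simp add: matrix_vector_mul_assoc matrix_inv_right inv)
    with that have "?y \<noteq> 0" by auto
    from pos_def_pos[OF assms this] show ?thesis
      by (simp add: y inner_commute)
  qed
  then show ?thesis
    by (simp add: pos_def_def symmetric_matrix_inv inv pos_def_sym[OF assms])
qed

lemma pos_def_congruence:
  fixes A :: "real^'n^'n" and B :: "real^'m^'n"
  assumes "pos_def A" and "\<And>x. B *v x = 0 \<Longrightarrow> x = 0"
  shows "pos_def (transpose B ** A ** B)"
  unfolding pos_def_def
proof (intro conjI allI impI)
  show "transpose (transpose B ** A ** B) = transpose B ** A ** B"
    by (simp add: matrix_transpose_mul pos_def_sym[OF assms(1)] matrix_mul_assoc)
  fix x :: "real^'m" assume "x \<noteq> 0"
  then have "B *v x \<noteq> 0" using assms(2) by auto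
  moreover have "x \<bullet> ((transpose B ** A ** B) *v x) = (A *v (B *v x)) \<bullet> (B *v x)"
    by (subst inner_commute) (simp add: matrix_vector_mul_assoc[symmetric] dot_lmul_matrix)
  ultimately show "0 < x \<bullet> ((transpose B ** A ** B) *v x)"
    using pos_def_pos[OF assms(1)] by (simp add: inner_commute)
qed

text \<open>The spectral square root: \<open>g\<close> keeps the eigenvectors of \<open>A\<close>
  and takes the root \<open>l e\<close> of each eigenvalue. It is definite because a nonzero vector
  cannot be orthogonal to all of the spanning set \<open>E\<close>. Existence is what gives the
  choice in \<open>sqrt_mat\<close> its properties.\<close>

lemma pos_def_sqrt_exists:
  fixes A :: "real^'n^'n"
  assumes "pos_def A"
  shows "\<exists>B. pos_def B \<and> B ** B = A"
proof -
  let ?f = "(*v) A"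
  have "?f x \<bullet> y = x \<bullet> ?f y" for x y
    by (simp add: pos_def_inner[OF assms])
  then obtain E where E: "finite E" "pairwise orthogonal E" "\<forall>e\<in>E. norm e = 1"
      "UNIV \<subseteq> span E" "\<forall>e\<in>E. A *v e = (e \<bullet> (A *v e)) *\<^sub>R e"
    using self_adjoint_eigenbasis[of ?f UNIV] by auto
  define l where "l e = sqrt (e \<bullet> (A *v e))" for e
  have lpos: "0 < l e" if "e \<in> E" for e
    using that E(3) pos_def_pos[OF assms, of e] by (force simp: l_def)
  have ll: "l e * l e = e \<bullet> (A *v e)" for e
    by (simp add: l_def pos_def_nonneg[OF assms])
  define g where "g x = (\<Sum>e\<in>E. (l e * (e \<bullet> x)) *\<^sub>R e)" for x
  have lin: "linear g"
    unfolding g_def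
    by (intro linear_compose_sum ballI linearI)
      (simp_all add: inner_add_right algebra_simps)
  have sum_ee: "(\<Sum>d\<in>E. h d * (d \<bullet> e)) = h e" if "e \<in> E" for e and h :: "_ \<Rightarrow> real"
  proof -
    have "(\<Sum>d\<in>E. h d * (d \<bullet> e)) = (\<Sum>d\<in>E. if d = e then h e else 0)"
      using that E(2,3)
      by (intro sum.cong refl) (auto simp: pairwise_def orthogonal_def norm_eq_1)
    then show ?thesis using that E(1) by simp
  qed
  have ge: "g e = l e *\<^sub>R e" if "e \<in> E" for e
  proof -
    have "g e = (\<Sum>d\<in>E. if d = e then l e *\<^sub>R e else 0)"
      unfolding g_def using that E(2,3)
      by (intro sum.cong refl) (auto simp: pairwise_def orthogonal_def norm_eq_1)
    then show ?thesis using that E(1) by simp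
  qed
  let ?B = "matrix g"
  have Bg: "?B *v x = g x" for x
    using lin by (simp add: matrix_works)
  have "(?B ** ?B) *v x = A *v x" for x
  proof (rule linear_eq_on_span[of "(*v) (?B ** ?B)" "(*v) A" E])
    fix e assume e: "e \<in> E"
    show "(?B ** ?B) *v e = A *v e"
      using e E(5)
      by (simp add: matrix_vector_mul_assoc[symmetric] Bg ge linear_scale[OF lin] ll)
  qed (use E(4) in auto)
  then have "?B ** ?B = A"
    by (simp add: matrix_eq)
  moreover have "pos_def ?B"
    unfolding pos_def_def
  proof (intro conjI allI impI)
    have "x \<bullet> g y = g x \<bullet> y" for x y
      by (simp add: g_def inner_sum_left inner_sum_right inner_commute mult.assoc mult.commute mult.left_commute)
    then have "(transpose ?B *v x) \<bullet> y = (?B *v x) \<bullet> y" for x y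
      by (metis Bg inner_matrix_vector)
    then have "transpose ?B *v x = ?B *v x" for x
      by (metis vector_eq_rdot)
    then show "transpose ?B = ?B" by (simp add: matrix_eq)
    fix x :: "real^'n" assume "x \<noteq> 0"
    have "\<exists>e\<in>E. e \<bullet> x \<noteq> 0"
    proof (rule ccontr)
      assume "\<not> ?thesis"
      then have "orthogonal x y" if "y \<in> span E" for y
        using orthogonal_to_span[OF that, of x] by (auto simp: orthogonal_def inner_commute)
      moreover have "x \<in> span E" using E(4) by blast
      ultimately have "x \<bullet> x = 0" by (auto simp: orthogonal_def)
      with \<open>x \<noteq> 0\<close> show False by simp
    qed
    then obtain d where d: "d \<in> E" "d \<bullet> x \<noteq> 0" by blast
    have "x \<bullet> g x = (\<Sum>e\<in>E. l e * (e \<bullet> x)\<^sup>2)"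
      by (simp add: g_def inner_sum_right power2_eq_square inner_commute mult.assoc)
    also have "\<dots> > 0"
      using E(1) d lpos by (intro sum_pos2[of _ d]) (auto simp: less_imp_le)
    finally show "0 < x \<bullet> (?B *v x)" by (simp add: Bg)
  qed
  ultimately show ?thesis by blast
qed

lemma
  assumes "pos_def A"
  shows pos_def_sqrt_mat: "pos_def (sqrt_mat A)"
    and sqrt_mat_square: "sqrt_mat A ** sqrt_mat A = A"
  using someI_ex[OF pos_def_sqrt_exists[OF assms]] by (auto simp: sqrt_mat_def)

lemma pos_def_inv_sqrt_mat: "pos_def A \<Longrightarrow> pos_def (inv_sqrt_mat A)"
  by (simp add: inv_sqrt_mat_def pos_def_matrix_inv pos_def_sqrt_mat)

lemma inv_sqrt_mat_square:
  assumes "pos_def A"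
  shows "inv_sqrt_mat A ** inv_sqrt_mat A = matrix_inv A"
proof -
  let ?B = "sqrt_mat A"
  have i: "invertible ?B" by (simp add: pos_def_invertible pos_def_sqrt_mat assms)
  have "A ** (matrix_inv ?B ** matrix_inv ?B) = ?B ** (?B ** matrix_inv ?B) ** matrix_inv ?B"
    by (simp add: matrix_mul_assoc sqrt_mat_square assms)
  also have "\<dots> = mat 1" by (simp add: matrix_inv_right i)
  finally show ?thesis by (simp add: inv_sqrt_mat_def matrix_inv_eqI)
qed

lemma inv_sqrt_mat_conj:
  assumes "pos_def A"
  shows "inv_sqrt_mat A ** (A ** inv_sqrt_mat A) = mat 1"
proof -
  let ?B = "sqrt_mat A"
  have i: "invertible ?B" by (simp add: pos_def_invertible pos_def_sqrt_mat assms)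
  have "matrix_inv ?B ** (A ** matrix_inv ?B) = (matrix_inv ?B ** ?B) ** (?B ** matrix_inv ?B)"
    by (metis assms matrix_mul_assoc sqrt_mat_square)
  then show ?thesis by (simp add: inv_sqrt_mat_def matrix_inv_right matrix_inv_left i)
qed

lemma pos_def_det:
  assumes "pos_def A"
  shows "0 < det A"
proof -
  have "det A = (det (sqrt_mat A))\<^sup>2"
    by (metis assms det_mul power2_eq_square sqrt_mat_square)
  moreover have "det (sqrt_mat A) \<noteq> 0"
    using assms invertible_det_nz pos_def_invertible pos_def_sqrt_mat by blast
  ultimately show ?thesis by simp
qed

section \<open>Lebesgue measure under linear maps\<close>

lemma Basis_vec_axis: "(Basis :: (real^'n) set) = range (\<lambda>i. axis i 1)"
  by (auto simp: Basis_vec_def)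

lemma inj_axis_1: "inj (\<lambda>i. axis i (1::real))"
  by (auto simp: inj_on_def axis_eq_axis)

lemma prod_Basis_vec: "(\<Prod>b\<in>Basis. h (b::real^'n)) = (\<Prod>i\<in>UNIV. h (axis i 1))"
  by (simp add: Basis_vec_axis prod.reindex[OF inj_axis_1])

lemma borel_measurable_linear:
  fixes f :: "'a::euclidean_space \<Rightarrow> 'b::euclidean_space"
  shows "linear f \<Longrightarrow> f \<in> borel_measurable borel"
  by (intro borel_measurable_continuous_onI linear_continuous_on) (simp add: linear_linear)

text \<open>The library states the linear change of variables for well-ordered index types only. Here the
  index type is merely finite, so it is derived from its elementary factors.\<close>

lemma distr_lborel_shear:
  fixes a b :: "'a::euclidean_space"
  assumes ab: "a \<in> Basis" "b \<in> Basis" "a \<noteq> b"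
  shows "distr lborel borel (\<lambda>x. x + (x \<bullet> b) *\<^sub>R a) = lborel"
proof (rule measure_eqI)
  let ?g = "\<lambda>x. x + (x \<bullet> b) *\<^sub>R a"
  let ?S = "\<lambda>f. (\<Sum>c\<in>Basis. f c *\<^sub>R c) :: 'a"
  interpret product_sigma_finite "\<lambda>_::'a. lborel :: real measure" by standard
  have lin: "linear ?g"
    by (intro linearI) (simp_all add: inner_add_left algebra_simps)
  have [measurable]: "?g \<in> borel_measurable borel"
    by (rule borel_measurable_linear[OF lin])
  fix X assume "X \<in> sets (distr lborel borel ?g)"
  then have [measurable]: "X \<in> sets borel" by simp
  define F where "F = (\<lambda>x. indicator X x :: ennreal)"
  have [measurable]: "F \<in> borel_measurable borel" by (simp add: F_def)
  have Pi: "(\<integral>\<^sup>+x. h x \<partial>lborel) =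
      (\<integral>\<^sup>+y. (\<integral>\<^sup>+r. h (?S (y(a := r))) \<partial>lborel) \<partial>(\<Pi>\<^sub>M i\<in>Basis - {a}. lborel))"
    if [measurable]: "h \<in> borel_measurable borel" for h :: "'a \<Rightarrow> ennreal"
  proof -
    have I: "insert a (Basis - {a}) = Basis" using ab by auto
    have "(\<integral>\<^sup>+x. h x \<partial>lborel) = (\<integral>\<^sup>+y. h (?S y) \<partial>(\<Pi>\<^sub>M i\<in>Basis. lborel))"
      by (subst lborel_eq) (simp add: nn_integral_distr)
    also have "\<dots> = (\<integral>\<^sup>+y. h (?S y) \<partial>(\<Pi>\<^sub>M i\<in>insert a (Basis - {a}). lborel))"
      by (simp only: I)
    also have "\<dots> = (\<integral>\<^sup>+y. (\<integral>\<^sup>+r. h (?S (y(a := r))) \<partial>lborel) \<partial>(\<Pi>\<^sub>M i\<in>Basis - {a}. lborel))"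
      by (rule product_nn_integral_insert) (use I in auto)
    finally show ?thesis .
  qed
  \<comment> \<open>With the other coordinates fixed, the shear merely translates coordinate
    \<open>a\<close> by \<open>y b\<close>. The shape \<open>y b + 1 * r\<close> is the one of the
    affine substitution rule used below.\<close>
  have g: "?g (?S (y(a := r))) = ?S (y(a := y b + 1 * r))" for y r
  proof (rule euclidean_eqI)
    fix c :: 'a assume c: "c \<in> Basis"
    have S: "?S z \<bullet> d = z d" if "d \<in> Basis" for z d
      using that by (simp add: inner_sum_left inner_Basis if_distrib cong: if_cong)
    show "?g (?S (y(a := r))) \<bullet> c = ?S (y(a := y b + 1 * r)) \<bullet> c"
      using ab c S by (auto simp: inner_add_left inner_Basis)
  qed
  have "emeasure (distr lborel borel ?g) X = (\<integral>\<^sup>+x. F (?g x) \<partial>lborel)"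
    by (simp add: F_def nn_integral_distr flip: nn_integral_indicator)
  also have "\<dots> = (\<integral>\<^sup>+y. (\<integral>\<^sup>+r. F (?S (y(a := y b + 1 * r))) \<partial>lborel) \<partial>(\<Pi>\<^sub>M i\<in>Basis - {a}. lborel))"
    by (subst Pi, measurable) (simp only: g)
  also have "\<dots> = (\<integral>\<^sup>+y. (\<integral>\<^sup>+r. F (?S (y(a := r))) \<partial>lborel) \<partial>(\<Pi>\<^sub>M i\<in>Basis - {a}. lborel))"
  proof (rule nn_integral_cong)
    fix y
    have "(\<lambda>r. ?S (y(a := r))) \<in> borel_measurable borel"
      by (intro borel_measurable_sum borel_measurable_scaleR borel_measurable_const)
        (simp add: fun_upd_def)
    then have "(\<lambda>r. F (?S (y(a := r)))) \<in> borel_measurable borel" by measurable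
    from nn_integral_real_affine[OF this, of 1 "y b"]
    show "(\<integral>\<^sup>+r. F (?S (y(a := y b + 1 * r))) \<partial>lborel) = (\<integral>\<^sup>+r. F (?S (y(a := r))) \<partial>lborel)"
      by simp
  qed
  also have "\<dots> = emeasure lborel X"
    by (subst Pi[symmetric]) (simp_all add: F_def)
  finally show "emeasure (distr lborel borel ?g) X = emeasure lborel X" .
qed simp

lemma distr_lborel_permute:
  fixes p :: "'n::finite \<Rightarrow> 'n"
  assumes p: "p permutes UNIV"
  shows "distr lborel borel (\<lambda>x::real^'n. \<chi> i. x $ p i) = lborel"
proof (rule lborel_eqI[symmetric])
  let ?g = "\<lambda>x::real^'n. \<chi> i. x $ p i" and ?h = "\<lambda>x::real^'n. \<chi> i. x $ inv p i"
  have lin: "linear ?g" by (intro linearI) (simp_all add: vec_eq_iff)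
  have [measurable]: "?g \<in> borel_measurable borel"
    by (rule borel_measurable_linear[OF lin])
  fix l u :: "real^'n" assume le: "\<And>b. b \<in> Basis \<Longrightarrow> l \<bullet> b \<le> u \<bullet> b"
  have "?g -` box l u = box (?h l) (?h u)"
  proof -
    have "(\<forall>i. l $ i < x $ p i \<and> x $ p i < u $ i) \<longleftrightarrow>
          (\<forall>i. l $ inv p i < x $ i \<and> x $ i < u $ inv p i)" for x :: "real^'n"
      using permutes_inverses[OF p] by metis
    then show ?thesis by (auto simp: mem_box_cart)
  qed
  moreover have "\<forall>b\<in>Basis. ?h l \<bullet> b \<le> ?h u \<bullet> b"
    using le[of "axis _ 1"] by (auto simp: Basis_vec_axis inner_axis)
  ultimately have "emeasure (distr lborel borel ?g) (box l u) = (\<Prod>b\<in>Basis. (?h u - ?h l) \<bullet> b)"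
    by (simp add: emeasure_distr emeasure_lborel_box_eq)
  also have "\<dots> = (\<Prod>i\<in>UNIV. (\<lambda>i. (u - l) $ i) (inv p i))"
    by (simp add: prod_Basis_vec inner_axis)
  also have "\<dots> = (\<Prod>i\<in>UNIV. (u - l) $ i)"
    using prod.permute[OF permutes_inv[OF p], of "\<lambda>i. (u - l) $ i"] by (simp add: o_def)
  also have "\<dots> = (\<Prod>b\<in>Basis. (u - l) \<bullet> b)"
    by (simp add: prod_Basis_vec inner_axis)
  finally show "emeasure (distr lborel borel ?g) (box l u) = (\<Prod>b\<in>Basis. (u - l) \<bullet> b)" .
qed simp

text \<open>Induction over elementary linear maps. Nonvanishing of the determinant is part of the
  induction predicate, since for a composition it passes to both factors. The determinant multiplies
  the left side, which avoids division in \<open>ennreal\<close>.\<close>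

lemma nn_integral_lborel_linear_aux:
  fixes f :: "real^'n \<Rightarrow> real^'n"
  assumes "linear f"
  shows "det (matrix f) \<noteq> 0 \<longrightarrow> (\<forall>h\<in>borel_measurable borel.
     ennreal \<bar>det (matrix f)\<bar> * (\<integral>\<^sup>+x. h (f x) \<partial>lborel) = (\<integral>\<^sup>+x. h x \<partial>lborel))"
    (is "?P f")
proof (rule induct_linear_elementary[OF assms])
  fix f g :: "real^'n \<Rightarrow> real^'n"
  assume fg: "linear f" "linear g" "?P f" "?P g"
  have m: "matrix (f \<circ> g) = matrix f ** matrix g"
    by (rule matrix_compose[OF fg(2,1)])
  show "?P (f \<circ> g)"
  proof (intro impI ballI)
    fix h :: "real^'n \<Rightarrow> ennreal"
    assume d: "det (matrix (f \<circ> g)) \<noteq> 0" and h[measurable]: "h \<in> borel_measurable borel"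
    note [measurable] = borel_measurable_linear[OF fg(1)] borel_measurable_linear[OF fg(2)]
    have "ennreal \<bar>det (matrix g)\<bar> * (\<integral>\<^sup>+x. h (f (g x)) \<partial>lborel) = (\<integral>\<^sup>+x. h (f x) \<partial>lborel)"
      using fg(4) d by (auto simp: m det_mul)
    moreover have "ennreal \<bar>det (matrix f)\<bar> * (\<integral>\<^sup>+x. h (f x) \<partial>lborel) = (\<integral>\<^sup>+x. h x \<partial>lborel)"
      using fg(3) d h by (auto simp: m det_mul)
    ultimately show "ennreal \<bar>det (matrix (f \<circ> g))\<bar> * (\<integral>\<^sup>+x. h ((f \<circ> g) x) \<partial>lborel) = (\<integral>\<^sup>+x. h x \<partial>lborel)"
      by (simp add: m det_mul abs_mult ennreal_mult mult.assoc)
  qed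
next
  \<comment> \<open>A map with a vanishing coordinate is not injective, so its determinant is 0 and
    the implication is vacuous.\<close>
  fix f :: "real^'n \<Rightarrow> real^'n" and i assume f: "linear f" "\<And>x. f x $ i = 0"
  then have "\<not> inj f"
    by (metis (full_types) linear_injective_imp_surjective one_neq_zero surjE vec_component)
  then show "?P f"
    using det_nz_iff_inj[OF f(1)] by blast
next
  fix c :: "'n \<Rightarrow> real"
  let ?f = "\<lambda>x::real^'n. \<chi> i. c i * x $ i"
  let ?v = "(\<chi> i. c i) :: real^'n"
  have lin: "linear ?f"
    by (intro linearI) (simp_all add: vec_eq_iff algebra_simps)
  have det: "det (matrix ?f) = (\<Prod>i\<in>UNIV. c i)"
    by (subst det_diagonal) (auto simp: matrix_def axis_def)
  show "?P ?f"
  proof (intro impI ballI)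
    fix h :: "real^'n \<Rightarrow> ennreal"
    assume d: "det (matrix ?f) \<noteq> 0" and [measurable]: "h \<in> borel_measurable borel"
    note [measurable] = borel_measurable_linear[OF lin]
    have c0: "?v \<bullet> b \<noteq> 0" if "b \<in> Basis" for b
      using that d by (auto simp: det Basis_vec_axis inner_axis)
    have T: "(\<Sum>j\<in>Basis. ((?v \<bullet> j) * (x \<bullet> j)) *\<^sub>R j) = ?f x" for x
      by (rule euclidean_eqI)
        (auto simp: inner_sum_left inner_Basis if_distrib Basis_vec_axis[symmetric] cong: if_cong,
         auto simp: Basis_vec_axis inner_axis)
    have "lborel = density (distr lborel borel ?f) (\<lambda>_. ennreal (\<Prod>j\<in>Basis. \<bar>?v \<bullet> j\<bar>))"
      using lborel_affine_euclidean[of "\<lambda>j. ?v \<bullet> j" 0] c0 by (simp add: T)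
    also have "(\<Prod>j\<in>Basis. \<bar>?v \<bullet> j\<bar>) = \<bar>det (matrix ?f)\<bar>"
      by (simp add: det prod_Basis_vec inner_axis abs_prod)
    finally have *: "lborel = density (distr lborel borel ?f) (\<lambda>_. ennreal \<bar>det (matrix ?f)\<bar>)" .
    show "ennreal \<bar>det (matrix ?f)\<bar> * (\<integral>\<^sup>+x. h (?f x) \<partial>lborel) = (\<integral>\<^sup>+x. h x \<partial>lborel)"
      by (subst (2) *) (simp add: nn_integral_density nn_integral_distr nn_integral_cmult)
  qed
next
  fix m n :: 'n assume "m \<noteq> n"
  let ?p = "Transposition.transpose m n"
  let ?f = "\<lambda>x::real^'n. \<chi> i. x $ ?p i"
  have p: "?p permutes UNIV" by (simp add: permutes_swap_id)
  have lin: "linear ?f"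
    by (intro linearI) (simp_all add: vec_eq_iff)
  note [measurable] = borel_measurable_linear[OF lin]
  have "matrix ?f = (\<chi> i. mat 1 $ ?p i)"
    by (auto simp: matrix_def vec_eq_iff axis_def mat_def)
  then have "det (matrix ?f) = of_int (sign ?p) * det (mat 1 :: real^'n^'n)"
    by (simp add: det_permute_rows[OF p])
  then have "\<bar>det (matrix ?f)\<bar> = 1"
    by (simp add: abs_mult sign_def)
  moreover have "(\<integral>\<^sup>+x. h (?f x) \<partial>lborel) = (\<integral>\<^sup>+x. h x \<partial>lborel)"
    if [measurable]: "h \<in> borel_measurable borel" for h
    by (subst (2) distr_lborel_permute[OF p, symmetric]) (simp add: nn_integral_distr)
  ultimately show "?P ?f" by simp
next
  fix m n :: 'n assume mn: "m \<noteq> n"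
  let ?f = "\<lambda>x::real^'n. \<chi> i. if i = m then x$m + x$n else x$i"
  have f: "?f = (\<lambda>x. x + (x \<bullet> axis n 1) *\<^sub>R axis m 1)"
    by (simp add: fun_eq_iff vec_eq_iff inner_axis) (simp add: axis_def)
  have lin: "linear ?f"
    by (intro linearI) (simp_all add: vec_eq_iff algebra_simps)
  note [measurable] = borel_measurable_linear[OF lin]
  have "matrix ?f = (\<chi> k. if k = m then row m (mat 1) + 1 *s row n (mat 1) else row k (mat 1))"
    by (auto simp: matrix_def vec_eq_iff axis_def mat_def row_def)
  then have "det (matrix ?f) = 1"
    by (simp add: det_row_operation[OF mn] del: vector_scalar_mult_def)
  moreover have "(\<integral>\<^sup>+x. h (?f x) \<partial>lborel) = (\<integral>\<^sup>+x. h x \<partial>lborel)"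
    if [measurable]: "h \<in> borel_measurable borel" for h
  proof -
    have "distr lborel borel ?f = lborel"
      unfolding f by (rule distr_lborel_shear) (use mn in \<open>auto simp: axis_eq_axis\<close>)
    then have "(\<integral>\<^sup>+x. h x \<partial>lborel) = (\<integral>\<^sup>+x. h x \<partial>distr lborel borel ?f)" by simp
    then show ?thesis by (simp add: nn_integral_distr)
  qed
  ultimately show "?P ?f" by simp
qed

lemma nn_integral_lborel_matrix:
  fixes A :: "real^'n^'n"
  assumes "det A \<noteq> 0" and "h \<in> borel_measurable borel"
  shows "ennreal \<bar>det A\<bar> * (\<integral>\<^sup>+x. h (A *v x) \<partial>lborel) = (\<integral>\<^sup>+x. h x \<partial>lborel)"
  using nn_integral_lborel_linear_aux[of "(*v) A"] assms by simp

section \<open>Gaussian integrals and quantiles\<close>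

lemma nn_integral_exp_square:
  "(\<integral>\<^sup>+(x::real). ennreal (exp (- x\<^sup>2 / 2)) \<partial>lborel) = ennreal (sqrt (2 * pi))"
proof -
  interpret prob_space "density lborel (normal_density 0 1)"
    by (rule prob_space_normal_density) simp
  have "1 = (\<integral>\<^sup>+x. ennreal (std_normal_density x) \<partial>lborel)"
    using emeasure_space_1 by (simp add: emeasure_density)
  then have "ennreal (sqrt (2 * pi)) = ennreal (sqrt (2 * pi)) * (\<integral>\<^sup>+x. ennreal (std_normal_density x) \<partial>lborel)"
    by simp
  also have "\<dots> = (\<integral>\<^sup>+x. ennreal (sqrt (2 * pi)) * ennreal (std_normal_density x) \<partial>lborel)"
    by (simp add: nn_integral_cmult)
  also have "\<dots> = (\<integral>\<^sup>+(x::real). ennreal (exp (- x\<^sup>2 / 2)) \<partial>lborel)"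
    by (intro nn_integral_cong) (simp add: std_normal_density_def flip: ennreal_mult)
  finally show ?thesis by simp
qed

lemma nn_integral_exp_inner:
  "(\<integral>\<^sup>+(x::'a::euclidean_space). ennreal (exp (- (x \<bullet> x) / 2)) \<partial>lborel) =
    ennreal ((2 * pi) powr (real DIM('a) / 2))"
proof -
  have "exp (- (x \<bullet> x) / 2) = (\<Prod>b\<in>Basis. exp (- (x \<bullet> b)\<^sup>2 / 2))" for x :: 'a
    by (simp add: exp_sum[symmetric] euclidean_inner[of x x] power2_eq_square sum_negf sum_divide_distrib)
  then have "(\<integral>\<^sup>+(x::'a). ennreal (exp (- (x \<bullet> x) / 2)) \<partial>lborel) =
      (\<integral>\<^sup>+(x::'a). (\<Prod>b\<in>Basis. ennreal (exp (- (x \<bullet> b)\<^sup>2 / 2))) \<partial>lborel)"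
    by (simp add: prod_ennreal)
  also have "\<dots> = (\<Prod>b\<in>(Basis::'a set). (\<integral>\<^sup>+(x::real). ennreal (exp (- x\<^sup>2 / 2)) \<partial>lborel))"
    by (rule nn_integral_lborel_prod) auto
  also have "\<dots> = ennreal (sqrt (2 * pi) ^ DIM('a))"
    by (simp add: nn_integral_exp_square[simplified] ennreal_power)
  also have "sqrt (2 * pi) ^ DIM('a) = (2 * pi) powr (real DIM('a) / 2)"
    by (simp add: powr_half_sqrt[symmetric] powr_powr powr_realpow[symmetric])
  finally show ?thesis .
qed

lemma nn_integral_lborel_diff:
  fixes c :: "'a::euclidean_space"
  assumes [measurable]: "h \<in> borel_measurable borel"
  shows "(\<integral>\<^sup>+x. h (x - c) \<partial>lborel) = (\<integral>\<^sup>+x. h x \<partial>lborel)"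
  by (subst (2) lborel_distr_plus[of "- c", symmetric]) (simp add: nn_integral_distr)

text \<open>Substitute \<open>B *v (x - c)\<close> with \<open>B\<close> the square root of
  \<open>D\<close>; its determinant is the root of \<open>det D\<close>. Read backwards, this writes
  \<open>det D powr (- 1 / 2)\<close> as an integral, which later allows determinants to be
  compared.\<close>

lemma nn_integral_gaussian:
  fixes D :: "real^'n^'n"
  assumes D: "pos_def D"
  shows "(\<integral>\<^sup>+x. ennreal (exp (- ((x - c) \<bullet> (D *v (x - c))) / 2)) \<partial>lborel) =
    ennreal ((2 * pi) powr (real CARD('n) / 2) * det D powr (- 1 / 2))"
proof -
  define B where "B = sqrt_mat D"
  have B: "pos_def B" and BB: "B ** B = D"
    using D by (simp_all add: B_def pos_def_sqrt_mat sqrt_mat_square)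
  let ?h = "\<lambda>y::real^'n. ennreal (exp (- (y \<bullet> y) / 2))"
  have dB: "0 < det B" by (rule pos_def_det[OF B])
  have dD: "det D = (det B)\<^sup>2" by (simp add: BB[symmetric] det_mul power2_eq_square)
  have "x \<bullet> (D *v x) = (B *v x) \<bullet> (B *v x)" for x
    by (simp add: BB[symmetric] matrix_vector_mul_assoc[symmetric] pos_def_inner[OF B])
  then have "(\<integral>\<^sup>+x. ennreal (exp (- ((x - c) \<bullet> (D *v (x - c))) / 2)) \<partial>lborel) =
      (\<integral>\<^sup>+x. ?h (B *v (x - c)) \<partial>lborel)"
    by simp
  also have "\<dots> = (\<integral>\<^sup>+x. ?h (B *v x) \<partial>lborel)"
  proof -
    note [measurable] = borel_measurable_linear[of "(*v) B", simplified]
    show ?thesis by (rule nn_integral_lborel_diff) measurable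
  qed
  also have "\<dots> = ennreal (1 / det B) * (ennreal \<bar>det B\<bar> * (\<integral>\<^sup>+x. ?h (B *v x) \<partial>lborel))"
    using dB by (simp add: mult.assoc[symmetric] flip: ennreal_mult)
  also have "\<dots> = ennreal (1 / det B) * ennreal ((2 * pi) powr (real CARD('n) / 2))"
    by (subst nn_integral_lborel_matrix) (use dB in \<open>simp_all add: nn_integral_exp_inner[simplified]\<close>)
  also have "\<dots> = ennreal ((2 * pi) powr (real CARD('n) / 2) * (1 / det B))"
    using dB by (simp add: mult.commute flip: ennreal_mult)
  also have "1 / det B = det D powr (- 1 / 2)"
    using dB by (simp add: dD powr_minus_divide powr_half_sqrt)
  finally show ?thesis .
qed

section \<open>Null distribution of \<open>S\<close>\<close>

lemma f_S_pos: "0 < f_S s"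
  by (simp add: f_S_def)

lemma borel_measurable_f_S [measurable]: "f_S \<in> borel_measurable borel"
  unfolding f_S_def by measurable

lemma space_null_S [simp]: "space null_S = UNIV"
  and sets_null_S [simp, measurable_cong]: "sets null_S = sets borel"
  by (simp_all add: null_S_def)

lemma prob_space_null_S: "prob_space (null_S :: (real^'k) measure)"
proof
  have "emeasure null_S (space null_S :: (real^'k) set) =
      (\<integral>\<^sup>+(s::real^'k). ennreal ((2 * pi) powr (- real CARD('k) / 2)) * ennreal (exp (- (s \<bullet> s) / 2)) \<partial>lborel)"
    by (simp add: null_S_def emeasure_density f_S_def ennreal_mult)
  also have "\<dots> = ennreal ((2 * pi) powr (- real CARD('k) / 2) * (2 * pi) powr (real CARD('k) / 2))"
    by (simp add: nn_integral_cmult nn_integral_exp_inner[simplified] ennreal_mult)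
  also have "\<dots> = 1" by (simp flip: powr_add)
  finally show "emeasure null_S (space null_S :: (real^'k) set) = 1" .
qed

lemma AE_null_S_iff: "(AE s in null_S. P s) \<longleftrightarrow> (AE s in lborel. P s)"
  unfolding null_S_def by (subst AE_density) (simp_all add: f_S_pos)

text \<open>The density depends on the norm only, and an orthogonal matrix has determinant 1 or
  -1.\<close>

lemma distr_null_S_orthogonal:
  fixes Q :: "real^'k^'k"
  assumes Q: "orthogonal_matrix Q"
  shows "distr null_S borel ((*v) Q) = null_S"
proof (rule measure_eqI)
  note [measurable] = borel_measurable_linear[of "(*v) Q", simplified]
  fix X assume "X \<in> sets (distr null_S borel ((*v) Q))"
  then have [measurable]: "X \<in> sets borel" by simp
  have d: "\<bar>det Q\<bar> = 1" using det_orthogonal_matrix[OF Q] by auto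
  have "f_S (Q *v s) = f_S s" for s
    using Q by (simp add: f_S_def dot_lmul_matrix[symmetric] orthogonal_matrix matrix_vector_mul_assoc
        flip: dot_matrix_vector_mul power2_norm_eq_inner)
      (metis orthogonal_transformation_def orthogonal_transformation_matrix Q norm_eq matrix_of_matrix_vector_mul matrix_vector_mul_linear)
  then have "emeasure (distr null_S borel ((*v) Q)) X =
      (\<integral>\<^sup>+s. ennreal (f_S (Q *v s)) * indicator X (Q *v s) \<partial>lborel)"
    by (simp add: emeasure_distr null_S_def emeasure_density indicator_def vimage_def)
  also have "\<dots> = ennreal \<bar>det Q\<bar> * (\<integral>\<^sup>+s. ennreal (f_S (Q *v s)) * indicator X (Q *v s) \<partial>lborel)"
    by (simp add: d)
  also have "\<dots> = (\<integral>\<^sup>+s. ennreal (f_S s) * indicator X s \<partial>lborel)"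
    by (rule nn_integral_lborel_matrix) (use d in auto)
  also have "\<dots> = emeasure null_S X"
    by (simp add: null_S_def emeasure_density)
  finally show "emeasure (distr null_S borel ((*v) Q)) X = emeasure null_S X" .
qed simp

section \<open>Quantiles and their convergence\<close>

text \<open>Quantile and distribution function form a Galois connection: right continuity makes the
  infimum attained, while \<open>p < 1\<close> and \<open>0 < p\<close> make the set nonempty and
  bounded below. Scaling and convergence of quantiles are read off from it.\<close>

lemma quantile_le_iff:
  assumes "prob_space M" and [measurable]: "X \<in> borel_measurable M" and p: "0 < p" "p < 1"
  shows "quantile p M X \<le> x \<longleftrightarrow> p \<le> measure M {\<omega> \<in> space M. X \<omega> \<le> x}"
proof -
  interpret prob_space M by fact
  interpret D: real_distribution "distr M borel X" by simp
  define F where "F = cdf (distr M borel X)"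
  have F: "measure M {\<omega> \<in> space M. X \<omega> \<le> x} = F x" for x
    by (simp add: F_def cdf_def measure_distr vimage_def Int_def conj_commute)
  have mono: "F x \<le> F y" if "x \<le> y" for x y
    using that by (simp add: F_def D.cdf_nondecreasing)
  let ?S = "{x. p \<le> F x}"
  have "eventually (\<lambda>x. p < F x) at_top"
    using order_tendstoD(1)[OF D.cdf_lim_at_top_prob p(2)] by (simp add: F_def)
  then have ne: "?S \<noteq> {}"
    by (auto simp: eventually_at_top_linorder intro: less_imp_le)
  have "eventually (\<lambda>x. F x < p) at_bot"
    using order_tendstoD(2)[OF D.cdf_lim_at_bot p(1)] by (simp add: F_def)
  then obtain b where b: "\<And>x. x \<le> b \<Longrightarrow> F x < p"
    by (auto simp: eventually_at_bot_linorder)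
  have bdd: "bdd_below ?S"
    by (rule bdd_belowI[of _ b]) (metis (mono_tags) b linorder_le_cases mem_Collect_eq not_le)
  have q: "quantile p M X = Inf ?S" by (simp add: quantile_def F)
  have "p \<le> F (Inf ?S)"
  proof -
    have "(F \<longlongrightarrow> F (Inf ?S)) (at_right (Inf ?S))"
      using D.cdf_is_right_cont by (simp add: F_def continuous_within)
    moreover have "p \<le> F y" if "Inf ?S < y" for y
    proof -
      have "\<exists>z\<in>?S. z < y"
        using that by (simp only: cInf_less_iff[OF ne bdd])
      then obtain z where "z \<in> ?S" "z < y" by (elim bexE)
      then show ?thesis using mono[of z y] by simp
    qed
    then have "eventually (\<lambda>y. p \<le> F y) (at_right (Inf ?S))"
      by (intro eventually_mono[OF eventually_at_right_less]) auto
    ultimately show ?thesis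
      by (rule tendsto_lowerbound) simp
  qed
  then show ?thesis
    unfolding q F using mono[of "Inf ?S" x] cInf_lower[OF _ bdd, of x] by auto
qed

text \<open>Two reals with the same upper bounds coincide. This handles both the factor produced by
  the group and the normalising factors of the WAP statistics.\<close>

lemma quantile_scale:
  assumes "prob_space M" and [measurable]: "X \<in> borel_measurable M" and p: "0 < p" "p < 1" and c: "0 < c"
  shows "quantile p M (\<lambda>\<omega>. c * X \<omega>) = c * quantile p M X"
proof -
  have "quantile p M (\<lambda>\<omega>. c * X \<omega>) \<le> x \<longleftrightarrow> c * quantile p M X \<le> x" for x
  proof -
    have "quantile p M (\<lambda>\<omega>. c * X \<omega>) \<le> x \<longleftrightarrow> p \<le> measure M {\<omega> \<in> space M. X \<omega> \<le> x / c}"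
      using c by (subst quantile_le_iff) (auto simp: assms pos_le_divide_eq mult.commute)
    also have "\<dots> \<longleftrightarrow> quantile p M X \<le> x / c"
      by (simp add: quantile_le_iff assms)
    finally show ?thesis using c by (simp add: pos_le_divide_eq mult.commute)
  qed
  then show ?thesis by (metis antisym order_refl)
qed

text \<open>By \<open>atomless\<close> the indicators of sublevel sets converge almost everywhere,
  so the distribution functions converge at every point. By \<open>incr\<close> the limit has no
  plateau at level \<open>p\<close> to the right of its quantile, along which the quantiles could
  wander.\<close>

lemma quantile_tendsto:
  assumes M: "prob_space M" and Xn[measurable]: "\<And>n. X n \<in> borel_measurable M"
    and X[measurable]: "Y \<in> borel_measurable M" and p: "0 < p" "p < 1"
    and lim: "\<And>\<omega>. \<omega> \<in> space M \<Longrightarrow> (\<lambda>n. X n \<omega>) \<longlonglongrightarrow> Y \<omega>"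
    and atomless: "\<And>x. AE \<omega> in M. Y \<omega> \<noteq> x"
    and incr: "\<And>x. quantile p M Y < x \<Longrightarrow> p < measure M {\<omega> \<in> space M. Y \<omega> \<le> x}"
  shows "(\<lambda>n. quantile p M (X n)) \<longlonglongrightarrow> quantile p M Y"
proof -
  interpret prob_space M by fact
  have conv: "(\<lambda>n. measure M {\<omega> \<in> space M. X n \<omega> \<le> x}) \<longlonglongrightarrow> measure M {\<omega> \<in> space M. Y \<omega> \<le> x}" for x
  proof -
    have "(\<lambda>n. \<integral>\<omega>. indicator {\<omega> \<in> space M. X n \<omega> \<le> x} \<omega> \<partial>M)
        \<longlonglongrightarrow> (\<integral>\<omega>. indicator {\<omega> \<in> space M. Y \<omega> \<le> x} \<omega> \<partial>M :: real)"
    proof (rule integral_dominated_convergence[where w="\<lambda>_. 1"])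
      show "AE \<omega> in M. (\<lambda>n. indicator {\<omega> \<in> space M. X n \<omega> \<le> x} \<omega> :: real)
          \<longlonglongrightarrow> indicator {\<omega> \<in> space M. Y \<omega> \<le> x} \<omega>"
        using atomless[of x] AE_space
      proof eventually_elim
        case (elim \<omega>)
        consider "Y \<omega> < x" | "Y \<omega> > x" using elim by linarith
        then have "eventually (\<lambda>n. (indicator {\<omega> \<in> space M. X n \<omega> \<le> x} \<omega> :: real) =
            indicator {\<omega> \<in> space M. Y \<omega> \<le> x} \<omega>) sequentially"
        proof cases
          case 1
          from order_tendstoD(2)[OF lim 1] elim show ?thesis
            using 1 by (auto elim!: eventually_mono simp: indicator_def)
        next
          case 2
          from order_tendstoD(1)[OF lim 2] elim show ?thesis
            using 2 by (auto elim!: eventually_mono simp: indicator_def)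
        qed
        then show ?case by (rule tendsto_eventually)
      qed
    qed (auto simp: indicator_def)
    then show ?thesis by simp
  qed
  show ?thesis
  proof (rule order_tendstoI)
    fix a assume "a < quantile p M Y"
    then have "measure M {\<omega> \<in> space M. Y \<omega> \<le> a} < p"
      using quantile_le_iff[OF M X p, of a] by simp
    from order_tendstoD(2)[OF conv this]
    show "eventually (\<lambda>n. a < quantile p M (X n)) sequentially"
      by eventually_elim (use quantile_le_iff[OF M Xn p] in \<open>simp add: not_le[symmetric]\<close>)
  next
    fix a assume "quantile p M Y < a"
    then obtain b where b: "quantile p M Y < b" "b < a" using dense by blast
    from order_tendstoD(1)[OF conv incr[OF b(1)]]
    have "eventually (\<lambda>n. quantile p M (X n) \<le> b) sequentially"
      by eventually_elim (simp add: quantile_le_iff[OF M Xn p])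
    then show "eventually (\<lambda>n. quantile p M (X n) < a) sequentially"
      by eventually_elim (use b in simp)
  qed
qed

lemma measure_null_S_open_pos:
  assumes "open U" "U \<noteq> {}"
  shows "0 < measure null_S (U :: (real^'k) set)"
proof (rule ccontr)
  interpret prob_space "null_S :: (real^'k) measure" by (rule prob_space_null_S)
  assume "\<not> ?thesis"
  then have "measure null_S U = 0" by (simp add: not_less measure_le_0_iff)
  then have "U \<in> null_sets null_S"
    using assms(1) by (simp add: null_sets_def emeasure_eq_measure)
  then have "AE s in null_S. s \<notin> U" by (rule AE_not_in)
  then have "AE s in lborel. s \<notin> U" by (simp add: AE_null_S_iff)
  then have "U \<in> null_sets lborel"
    using assms(1) by (subst AE_iff_null_sets) auto
  then have "negligible U"
    by (simp add: negligible_iff_null_sets null_sets_completionI)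
  then show False using assms open_not_negligible by blast
qed

lemma quantile_null_S_less:
  fixes X :: "real^'k \<Rightarrow> real"
  assumes cont: "continuous_on UNIV X" and p: "0 < p" "p < 1" and less: "quantile p null_S X < x"
  shows "p < measure null_S {s \<in> space null_S. X s \<le> x}"
proof -
  interpret prob_space "null_S :: (real^'k) measure" by (rule prob_space_null_S)
  have X[measurable]: "X \<in> borel_measurable null_S"
    using borel_measurable_continuous_onI[OF cont] by simp
  define q where "q = quantile p null_S X"
  have pq: "p \<le> prob {s. X s \<le> q}"
    using quantile_le_iff[OF prob_space_null_S X p, of q] by (simp add: q_def)
  let ?U = "X -` {q<..<x}"
  show ?thesis
  proof (cases "?U = {}")
    case False
    have "open ?U" using cont by (simp add: continuous_on_open_vimage)
    then have "0 < prob ?U" using False by (rule measure_null_S_open_pos)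
    then have "p < prob {s. X s \<le> q} + prob ?U" using pq by simp
    also have "\<dots> = prob ({s. X s \<le> q} \<union> ?U)"
      using X \<open>open ?U\<close> by (intro finite_measure_Union[symmetric]) auto
    also have "\<dots> \<le> prob {s. X s \<le> x}"
      using less by (intro finite_measure_mono) (auto simp: q_def)
    finally show ?thesis by simp
  next
    \<comment> \<open>No value lies between the quantile and \<open>x\<close>. Since the range of
      \<open>X\<close> is connected and meets the part up to \<open>q\<close>, it cannot reach
      beyond \<open>x\<close>, and the probability is 1.\<close>
    case True
    have "X s \<le> x" for s
    proof (rule ccontr)
      assume s: "\<not> X s \<le> x"
      have "{s. X s \<le> q} \<noteq> {}"
      proof
        assume "{s. X s \<le> q} = {}"
        then show False using pq p by simp
      qed
      then obtain s' where s': "X s' \<le> q" by blast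
      have "connected (range X)"
        using cont by (intro connected_continuous_image connected_UNIV)
      then have "{X s'..X s} \<subseteq> range X"
        by (rule connected_contains_Icc) auto
      moreover have "(q + x) / 2 \<in> {X s'..X s}"
        using s s' less by (simp add: q_def)
      ultimately obtain r where "X r = (q + x) / 2" by (metis imageE subsetD)
      then have "r \<in> ?U" using less by (simp add: q_def)
      with True show False by blast
    qed
    then show ?thesis using p prob_space by simp
  qed
qed

section \<open>Score and information of the Gaussian model\<close>

text \<open>For fixed \<open>a = a\<^sub>\<Delta>\<close>, the mean of \<open>vec R\<^sub>0\<close> is \<open>emb a *v \<mu>\<close>; with \<open>W = \<Sigma>\<^sub>0\<^sup>-\<^sup>1\<close>, \<open>info\<close> is the information
  matrix of \<open>\<mu>\<close>, \<open>score\<close> its score at \<open>\<mu> = 0\<close>, and \<open>quad\<close> the quadratic form in the exponent of \<open>IL\<close>. At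
  \<open>a = a_vec 0\<close> they are \<open>\<Sigma>\<^sup>2\<^sup>2\<close>, \<open>[\<Sigma>\<^sup>2\<^sup>1 : \<Sigma>\<^sup>2\<^sup>2] vec R\<^sub>0\<close> and \<open>T'T\<close>.\<close>

abbreviation emb :: "real^2 \<Rightarrow> real^'k^(2 \<times> ('k::finite))" where
  "emb a \<equiv> kron_col a (mat 1)"

definition info :: "real^(2 \<times> ('k::finite))^(2 \<times> 'k) \<Rightarrow> real^2 \<Rightarrow> real^'k^'k" where
  "info W a = transpose (emb a) ** W ** emb a"

definition score :: "real^(2 \<times> ('k::finite))^(2 \<times> 'k) \<Rightarrow> real^2 \<Rightarrow> real^(2 \<times> 'k) \<Rightarrow> real^'k" where
  "score W a v = transpose (emb a) *v (W *v v)"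

definition quad :: "real^(2 \<times> ('k::finite))^(2 \<times> 'k) \<Rightarrow> real^2 \<Rightarrow> real^(2 \<times> 'k) \<Rightarrow> real" where
  "quad W a v = score W a v \<bullet> (matrix_inv (info W a) *v score W a v)"

text \<open>The chart \<open>u = 1 / \<Delta>\<close> of the projective line of directions \<open>a\<^sub>\<Delta>\<close>: there the weight \<open>|\<Delta>|\<^sup>k\<^sup>-\<^sup>2\<close> is
  absorbed by the homogeneity of the determinant, and the lower triangular group acts by affine maps.\<close>

definition b_vec :: "real \<Rightarrow> real^2" where
  "b_vec u = vector [1, u]"

lemma emb_mult_vec: "emb a *v x = kron_vec a x"
proof -
  have "(\<Sum>j\<in>UNIV. a $ fst p * (if snd p = j then 1 else 0) * x $ j) = a $ fst p * x $ snd p" for p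
    by (subst sum.cong[OF refl, of _ _ "\<lambda>j. if snd p = j then a $ fst p * x $ snd p else 0"]) auto
  then show ?thesis
    by (auto simp: vec_eq_iff matrix_vector_mult_def kron_col_def kron_vec_def mat_def)
qed

lemma kron_vec_inner: "kron_vec a x \<bullet> kron_vec b y = (a \<bullet> b) * (x \<bullet> y)"
  unfolding inner_vec_def kron_vec_def
  by (simp add: UNIV_Times_UNIV[symmetric] sum.cartesian_product' sum_product mult_ac
      del: UNIV_Times_UNIV)

lemma kron_vec_eq_0_iff: "kron_vec a x = 0 \<longleftrightarrow> a = 0 \<or> x = 0"
  using kron_vec_inner[of a x a x] by (metis inner_eq_zero_iff mult_eq_0_iff)

lemma kron_vec_linear: "linear (kron_vec a)"
  by (intro linearI) (simp_all add: kron_vec_def vec_eq_iff algebra_simps)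

lemma transpose_emb_kron_vec: "transpose (emb a) *v kron_vec b x = (a \<bullet> b) *\<^sub>R x"
proof (rule vector_eq_ldot[THEN iffD1], rule allI)
  fix z
  show "z \<bullet> (transpose (emb a) *v kron_vec b x) = z \<bullet> ((a \<bullet> b) *\<^sub>R x)"
    unfolding inner_matrix_vector transpose_transpose emb_mult_vec kron_vec_inner by simp
qed

lemma emb_scaleR: "emb (c *\<^sub>R a) = c *\<^sub>R emb a"
  by (simp add: kron_col_def vec_eq_iff)

lemma b_vec_nz [simp]: "b_vec u \<noteq> 0" and a_vec_nz [simp]: "a_vec D \<noteq> 0"
  by (auto simp: b_vec_def a_vec_def vec_eq_iff forall_2 vector_2)

lemma pos_def_info:
  assumes "pos_def W" "a \<noteq> 0"
  shows "pos_def (info W a)"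
  unfolding info_def
  by (rule pos_def_congruence) (use assms in \<open>simp_all add: emb_mult_vec kron_vec_eq_0_iff\<close>)

lemma info_mult: "info W a *v x = transpose (emb a) *v (W *v kron_vec a x)"
  by (simp add: info_def emb_mult_vec matrix_vector_mul_assoc[symmetric] del: transpose_matrix_vector)

lemma score_linear: "linear (score W a)"
  unfolding score_def
  by (simp add: linear_compose[unfolded o_def, OF matrix_vector_mul_linear] del: transpose_matrix_vector)

lemma inner_info: "x \<bullet> (info W a *v y) = kron_vec a x \<bullet> (W *v kron_vec a y)"
  by (simp add: info_mult inner_matrix_vector transpose_transpose emb_mult_vec del: transpose_matrix_vector)

lemma inner_score: "x \<bullet> score W a v = kron_vec a x \<bullet> (W *v v)"
  by (simp add: score_def inner_matrix_vector transpose_transpose emb_mult_vec del: transpose_matrix_vector)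

text \<open>For a known direction \<open>a\<close>, \<open>c\<close> is the generalised least
  squares estimate of \<mu>, and \<open>quad\<close> is the explained part of the total
  \<open>v \<bullet> (W *v v)\<close>.\<close>

lemma complete_square:
  fixes W :: "real^(2 \<times> ('k::finite))^(2 \<times> 'k)" and v :: "real^(2 \<times> 'k)"
  assumes W: "pos_def W" and a: "a \<noteq> 0"
  defines "c \<equiv> matrix_inv (info W a) *v score W a v"
  shows "(v - kron_vec a x) \<bullet> (W *v (v - kron_vec a x)) =
    v \<bullet> (W *v v) - quad W a v + (x - c) \<bullet> (info W a *v (x - c))"
proof -
  let ?D = "info W a" and ?y = "score W a v"
  have D: "pos_def ?D" by (rule pos_def_info[OF W a])
  have Dc: "?D *v c = ?y"
    by (simp add: c_def matrix_vector_mul_assoc matrix_inv_right pos_def_invertible[OF D])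
  have cDx: "c \<bullet> (?D *v x) = x \<bullet> ?y"
    by (simp add: pos_def_inner[OF D] Dc inner_commute)
  have vWx: "v \<bullet> (W *v kron_vec a x) = x \<bullet> ?y"
    unfolding inner_score by (subst pos_def_inner[OF W]) (rule inner_commute)
  have "(x - c) \<bullet> (?D *v (x - c)) = x \<bullet> (?D *v x) - 2 * (x \<bullet> ?y) + quad W a v"
    by (simp add: matrix_vector_mult_diff_distrib inner_diff_left inner_diff_right Dc cDx quad_def
        flip: c_def) (simp add: inner_commute)
  moreover have "(v - kron_vec a x) \<bullet> (W *v (v - kron_vec a x)) =
      v \<bullet> (W *v v) - 2 * (x \<bullet> ?y) + x \<bullet> (?D *v x)"
    by (simp add: matrix_vector_mult_diff_distrib inner_diff_left inner_diff_right vWx inner_info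
        inner_score)
  ultimately show ?thesis by simp
qed

lemma quad_nonneg:
  assumes "pos_def W" "a \<noteq> 0"
  shows "0 \<le> quad W a v"
  unfolding quad_def by (intro pos_def_nonneg pos_def_matrix_inv pos_def_info assms)

text \<open>At the least squares estimate the last square vanishes, and the residual sum of squares
  that remains is nonnegative. This bounds the exponent of the kernel uniformly in the
  direction.\<close>

lemma quad_le:
  assumes "pos_def W" "a \<noteq> 0"
  shows "quad W a v \<le> v \<bullet> (W *v v)"
  using complete_square[OF assms, of v "matrix_inv (info W a) *v score W a v"]
    pos_def_nonneg[OF assms(1), of "v - kron_vec a (matrix_inv (info W a) *v score W a v)"] by simp

section \<open>Homogeneity in the direction\<close>

lemma scaleR_matrix_mul: "(c *\<^sub>R A) ** B = c *\<^sub>R (A ** B)"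
  and matrix_mul_scaleR: "A ** (c *\<^sub>R B) = c *\<^sub>R (A ** B)"
  for A :: "real^'n^'m" and B :: "real^'p^'n"
  by (simp_all add: matrix_matrix_mult_def vec_eq_iff sum_distrib_left mult_ac)

lemma transpose_scaleR: "transpose (c *\<^sub>R A) = c *\<^sub>R transpose A" for A :: "real^'n^'m"
  by (simp add: transpose_def vec_eq_iff)

lemma info_scaleR: "info W (c *\<^sub>R a) = c\<^sup>2 *\<^sub>R info W a"
  by (simp add: info_def emb_scaleR transpose_scaleR scaleR_matrix_mul matrix_mul_scaleR power2_eq_square)

lemma score_scaleR: "score W (c *\<^sub>R a) v = c *\<^sub>R score W a v"
  by (simp add: score_def emb_scaleR transpose_scaleR scaleR_matrix_vector_assoc[symmetric]
      del: transpose_matrix_vector)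

lemma matrix_inv_scaleR:
  fixes A :: "real^'n^'n"
  assumes "invertible A" "c \<noteq> 0"
  shows "matrix_inv (c *\<^sub>R A) = (1 / c) *\<^sub>R matrix_inv A"
  by (rule matrix_inv_eqI) (use assms in \<open>simp add: scaleR_matrix_mul matrix_mul_scaleR matrix_inv_right\<close>)

lemma quad_scaleR:
  assumes "pos_def W" "a \<noteq> 0" "c \<noteq> 0"
  shows "quad W (c *\<^sub>R a) v = quad W a v"
  using assms
  by (simp add: quad_def info_scaleR score_scaleR matrix_inv_scaleR pos_def_invertible pos_def_info
      linear_scale[OF matrix_vector_mul_linear] scaleR_matrix_vector_assoc[symmetric] power2_eq_square)

lemma det_scaleR: "det (c *\<^sub>R A) = c ^ CARD('n) * det A" for A :: "real^'n^'n"
proof -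
  have "c *\<^sub>R A = (\<chi> i. c *s A $ i)"
    by (simp add: vec_eq_iff vector_scalar_mult_def)
  then show ?thesis by (simp add: det_rows_mul)
qed

lemma det_info_scaleR: "det (info W (c *\<^sub>R a)) = c ^ (2 * CARD('k)) * det (info W a)"
  for W :: "real^(2 \<times> ('k::finite))^(2 \<times> 'k)"
  by (simp add: info_scaleR det_scaleR power_mult)

section \<open>The statistics in terms of score and information\<close>

lemma a_vec_0: "a_vec 0 = axis 2 1" and b_vec_0: "b_vec 0 = axis 1 1"
  by (simp_all add: a_vec_def b_vec_def axis_def vec_eq_iff forall_2 vector_2)

lemma sum_if_const: "(\<Sum>p\<in>A. if P then f p else 0) = (if P then sum f A else 0)"
  by simp

text \<open>\<open>a_vec 0\<close> and \<open>b_vec 0\<close> are unit vectors, so their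
  \<open>emb\<close> selects a block. For \<open>M = \<Sigma>\<close>, \<open>info\<close> is only
  notation for this congruence: it yields the variance of the first column, not an information
  matrix.\<close>

lemma block_eq_info: "block M 2 2 = info M (a_vec 0)" "block M 1 1 = info M (b_vec 0)"
proof -
  have *: "info M (axis j 1) = block M j j" for j
  proof -
    have "info M (axis j 1) *v x = block M j j *v x" for x
    proof (rule vector_eq_ldot[THEN iffD1], rule allI)
      fix z
      have "kron_vec (axis j 1) z \<bullet> (M *v kron_vec (axis j 1) x) = (\<Sum>i\<in>UNIV. \<Sum>p\<in>UNIV.
          (if i = j then z $ p * (\<Sum>i'\<in>UNIV. \<Sum>q\<in>UNIV. if i' = j then M $ (i, p) $ (j, q) * x $ q else 0) else 0))"
        unfolding inner_vec_def matrix_vector_mult_def kron_vec_def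
        by (simp add: UNIV_Times_UNIV[symmetric] sum.cartesian_product' axis_def
            if_distrib[of "\<lambda>x. x * _"] if_distrib[of "\<lambda>x. _ * x"] del: UNIV_Times_UNIV cong: if_cong)
      also have "\<dots> = z \<bullet> (block M j j *v x)"
        by (simp add: inner_vec_def matrix_vector_mult_def block_def sum_if_const cong: if_cong)
      finally show "z \<bullet> (info M (axis j 1) *v x) = z \<bullet> (block M j j *v x)"
        by (simp add: inner_info)
    qed
    then show ?thesis by (simp add: matrix_eq)
  qed
  show "block M 2 2 = info M (a_vec 0)" "block M 1 1 = info M (b_vec 0)"
    by (simp_all add: * a_vec_0 b_vec_0)
qed

lemma transpose_emb_axis:
  fixes x :: "real^(2 \<times> ('k::finite))"
  shows "transpose (emb (axis j 1)) *v x = (\<chi> p. x $ (j, p))"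
proof (rule vector_eq_ldot[THEN iffD1], rule allI)
  fix z :: "real^'k"
  have "z \<bullet> (transpose (emb (axis j 1)) *v x) = kron_vec (axis j 1) z \<bullet> x"
    by (simp add: inner_matrix_vector transpose_transpose emb_mult_vec del: transpose_matrix_vector)
  also have "\<dots> = (\<Sum>i\<in>UNIV. \<Sum>p\<in>UNIV. if i = j then z $ p * x $ (i, p) else 0)"
    unfolding inner_vec_def kron_vec_def
    by (simp add: UNIV_Times_UNIV[symmetric] sum.cartesian_product' axis_def
          if_distrib[of "\<lambda>x. x * _"] del: UNIV_Times_UNIV cong: if_cong)
  also have "\<dots> = z \<bullet> (\<chi> p. x $ (j, p))"
    by (simp add: inner_vec_def sum_if_const)
  finally show "z \<bullet> (transpose (emb (axis j 1)) *v x) = z \<bullet> (\<chi> p. x $ (j, p))" .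
qed

lemma block_row_eq_score:
  fixes W :: "real^(2 \<times> ('k::finite))^(2 \<times> 'k)"
  shows "block_row W 2 *v v = score W (a_vec 0) v"
  unfolding score_def a_vec_0 transpose_emb_axis
  by (simp add: block_row_def vec_eq_iff matrix_vector_mult_def)

lemma column_eq: "column 1 R = transpose (emb (b_vec 0)) *v vec_mat R"
  unfolding b_vec_0 transpose_emb_axis by (simp add: column_def vec_mat_def)

lemma S_stat_eq:
  "S_stat \<Sigma> R = inv_sqrt_mat (info \<Sigma> (b_vec 0)) *v (transpose (emb (b_vec 0)) *v vec_mat R)"
  by (simp add: S_stat_def block_eq_info column_eq del: transpose_matrix_vector)

lemma T_stat_eq:
  "T_stat \<Sigma> R = inv_sqrt_mat (info (matrix_inv \<Sigma>) (a_vec 0)) *v score (matrix_inv \<Sigma>) (a_vec 0) (vec_mat R)"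
  by (simp add: T_stat_def block_eq_info block_row_eq_score)

lemma inv_sqrt_mat_inner:
  assumes "pos_def A"
  shows "(inv_sqrt_mat A *v x) \<bullet> (inv_sqrt_mat A *v x) = x \<bullet> (matrix_inv A *v x)"
  by (simp add: inv_sqrt_mat_square[OF assms, symmetric] matrix_vector_mul_assoc[symmetric]
      pos_def_inner[OF pos_def_inv_sqrt_mat[OF assms]])

lemma T_stat_inner:
  assumes "pos_def \<Sigma>"
  shows "T_stat \<Sigma> R \<bullet> T_stat \<Sigma> R = quad (matrix_inv \<Sigma>) (a_vec 0) (vec_mat R)"
  unfolding T_stat_eq quad_def
  by (intro inv_sqrt_mat_inner pos_def_info pos_def_matrix_inv assms) simp

text \<open>As \<open>H\<close> is symmetric with square \<open>matrix_inv \<Sigma>\<close>, the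
  Gram matrix inside the projection is \<open>info\<close>, and the outer factors turn the vector
  into its score.\<close>

lemma proj_mat_quad:
  assumes "pos_def \<Sigma>"
  defines "H \<equiv> inv_sqrt_mat \<Sigma>"
  shows "v \<bullet> ((H ** proj_mat (H ** emb a) ** H) *v v) = quad (matrix_inv \<Sigma>) a v"
proof -
  let ?W = "matrix_inv \<Sigma>"
  have HH: "H ** H = ?W" and Hs: "transpose H = H"
    using assms by (simp_all add: H_def inv_sqrt_mat_square pos_def_sym pos_def_inv_sqrt_mat)
  have i: "transpose (H ** emb a) ** (H ** emb a) = info ?W a"
    by (simp add: info_def HH[symmetric] matrix_transpose_mul Hs matrix_mul_assoc)
  have "H ** proj_mat (H ** emb a) ** H = ?W ** emb a ** matrix_inv (info ?W a) ** transpose (emb a) ** ?W"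
    unfolding proj_mat_def i by (simp add: HH[symmetric] matrix_transpose_mul Hs matrix_mul_assoc)
  then have "(H ** proj_mat (H ** emb a) ** H) *v v = ?W *v kron_vec a (matrix_inv (info ?W a) *v score ?W a v)"
    by (simp add: score_def matrix_vector_mul_assoc[symmetric] emb_mult_vec del: transpose_matrix_vector)
  then show ?thesis
    by (simp add: quad_def inner_score[symmetric] pos_def_inner[OF pos_def_matrix_inv[OF assms(1)]] inner_commute)
      (metis assms(1) inner_commute inner_score pos_def_inner pos_def_matrix_inv)
qed

text \<open>Allowing every direction, not just \<open>a_vec \<Delta>\<close>, lets one function
  serve both charts and the images of directions under the group.\<close>

definition il_kernel :: "real^(2 \<times> ('k::finite))^(2 \<times> 'k) \<Rightarrow> real^(2 \<times> 'k) \<Rightarrow> real^2 \<Rightarrow> real" where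
  "il_kernel W v a = exp ((quad W a v - quad W (a_vec 0) v) / 2) * det (info W a) powr (- 1 / 2)"

lemma IL_eq_kernel:
  fixes R :: "real^2^'k"
  assumes "pos_def \<Sigma>"
  shows "IL R \<Sigma> = (\<integral>\<Delta>. il_kernel (matrix_inv \<Sigma>) (vec_mat R) (a_vec \<Delta>) * \<bar>\<Delta>\<bar> ^ (CARD('k) - 2) \<partial>lborel)"
  unfolding IL_def Let_def il_kernel_def
  by (simp add: proj_mat_quad[OF assms] T_stat_inner[OF assms] info_def)

text \<open>\<open>quad\<close> depends only on the line of \<open>a\<close>, and the determinant of
  the information is homogeneous of degree 2k; the power -1/2 leaves degree -k.\<close>

lemma il_kernel_scaleR:
  fixes W :: "real^(2 \<times> ('k::finite))^(2 \<times> 'k)"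
  assumes "pos_def W" "a \<noteq> 0" "c \<noteq> 0"
  shows "il_kernel W v (c *\<^sub>R a) = \<bar>c\<bar> powr (- real CARD('k)) * il_kernel W v a"
proof -
  have "0 < det (info W a)" by (intro pos_def_det pos_def_info assms)
  moreover have "c ^ (2 * CARD('k)) = \<bar>c\<bar> powr (2 * real CARD('k))"
    using assms(3) powr_realpow[of "\<bar>c\<bar>" "2 * CARD('k)"] by (simp add: power_even_abs)
  ultimately have "det (info W (c *\<^sub>R a)) powr (- 1 / 2) =
      \<bar>c\<bar> powr (- real CARD('k)) * det (info W a) powr (- 1 / 2)"
    by (simp add: det_info_scaleR powr_mult powr_powr)
  then show ?thesis using assms by (simp add: il_kernel_def quad_scaleR)
qed

section \<open>Data as a function of the statistics\<close>

definition unvec :: "real^(2 \<times> 'k) \<Rightarrow> real^2^'k" where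
  "unvec v = (\<chi> i j. v $ (j, i))"

lemma vec_mat_unvec [simp]: "vec_mat (unvec v) = v"
  and unvec_vec_mat [simp]: "unvec (vec_mat R) = R"
  by (simp_all add: unvec_def vec_mat_def vec_eq_iff)

lemma linear_unvec: "linear (unvec :: real^(2 \<times> 'k::finite) \<Rightarrow> _)"
  and linear_vec_mat: "linear (vec_mat :: real^2^'k::finite \<Rightarrow> _)"
  by (auto intro!: linearI simp: unvec_def vec_mat_def vec_eq_iff)

lemma emb_decomposition:
  fixes v :: "real^(2 \<times> 'k::finite)"
  shows "kron_vec (b_vec 0) (transpose (emb (b_vec 0)) *v v) +
         kron_vec (a_vec 0) (transpose (emb (a_vec 0)) *v v) = v"
proof -
  have "j = 1 \<or> j = 2" for j :: 2 by (rule exhaust_2)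
  then show ?thesis
    unfolding transpose_emb_axis a_vec_0 b_vec_0
    by (force simp: vec_eq_iff kron_vec_def axis_def)
qed

lemma inner_a_b [simp]: "a_vec 0 \<bullet> b_vec u = u" "b_vec 0 \<bullet> a_vec 0 = 0" "b_vec u \<bullet> b_vec 0 = 1"
    "a_vec 0 \<bullet> a_vec 0 = 1"
  by (simp_all add: a_vec_def b_vec_def inner_vec_def sum_2 vector_2)

text \<open>The inverse of R \<mapsto> (S, T) in vectorised form. The two summands lie in subspaces
  orthogonal with respect to \<open>matrix_inv \<Sigma>\<close>; \<open>T\<close> sees only the
  first and \<open>S\<close> only the second.\<close>

definition recon :: "real^(2 \<times> 'k)^(2 \<times> ('k::finite)) \<Rightarrow> real^'k \<Rightarrow> real^'k \<Rightarrow> real^(2 \<times> 'k)" where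
  "recon \<Sigma> s t = kron_vec (a_vec 0) (inv_sqrt_mat (info (matrix_inv \<Sigma>) (a_vec 0)) *v t) +
     \<Sigma> *v kron_vec (b_vec 0) (inv_sqrt_mat (info \<Sigma> (b_vec 0)) *v s)"

text \<open>Here \<open>s\<close> enters with the factor \<open>a \<bullet> b_vec 0\<close>: it is 0
  for \<open>a_vec 0\<close>, so that \<open>T\<close> is blind to \<open>s\<close>, and 1 for every
  \<open>b_vec u\<close>, so that these scores are injective in \<open>s\<close>.\<close>

lemma score_recon:
  assumes \<Sigma>: "pos_def \<Sigma>"
  shows "score (matrix_inv \<Sigma>) a (recon \<Sigma> s t) =
    score (matrix_inv \<Sigma>) a (kron_vec (a_vec 0) (inv_sqrt_mat (info (matrix_inv \<Sigma>) (a_vec 0)) *v t)) +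
    (a \<bullet> b_vec 0) *\<^sub>R (inv_sqrt_mat (info \<Sigma> (b_vec 0)) *v s)"
  unfolding recon_def linear_add[OF score_linear]
  by (simp add: score_def matrix_vector_mul_assoc matrix_inv_left pos_def_invertible[OF \<Sigma>]
      transpose_emb_kron_vec del: transpose_matrix_vector)

lemma
  assumes \<Sigma>: "pos_def \<Sigma>"
  shows S_stat_recon: "S_stat \<Sigma> (unvec (recon \<Sigma> s t)) = s"
    and T_stat_recon: "T_stat \<Sigma> (unvec (recon \<Sigma> s t)) = t"
proof -
  have i: "pos_def (info \<Sigma> (b_vec 0))" "pos_def (info (matrix_inv \<Sigma>) (a_vec 0))"
    by (simp_all add: pos_def_info pos_def_matrix_inv \<Sigma>)
  have "transpose (emb (b_vec 0)) *v recon \<Sigma> s t = info \<Sigma> (b_vec 0) *v (inv_sqrt_mat (info \<Sigma> (b_vec 0)) *v s)"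
    by (simp add: recon_def matrix_vector_right_distrib transpose_emb_kron_vec info_mult del: transpose_matrix_vector)
  then show "S_stat \<Sigma> (unvec (recon \<Sigma> s t)) = s"
    by (simp add: S_stat_eq matrix_vector_mul_assoc inv_sqrt_mat_conj[OF i(1)] matrix_mul_assoc[symmetric] del: transpose_matrix_vector)
  have "score (matrix_inv \<Sigma>) (a_vec 0) (recon \<Sigma> s t) =
      info (matrix_inv \<Sigma>) (a_vec 0) *v (inv_sqrt_mat (info (matrix_inv \<Sigma>) (a_vec 0)) *v t)"
    by (simp add: score_recon[OF \<Sigma>]) (simp add: score_def info_mult del: transpose_matrix_vector)
  then show "T_stat \<Sigma> (unvec (recon \<Sigma> s t)) = t"
    by (simp add: T_stat_eq matrix_vector_mul_assoc inv_sqrt_mat_conj[OF i(2)] matrix_mul_assoc[symmetric])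
qed

lemma inv_sqrt_mat_cancel:
  assumes "pos_def A" "inv_sqrt_mat A *v x = inv_sqrt_mat A *v y"
  shows "x = y"
proof -
  have "inv_sqrt_mat A *v (x - y) = 0"
    using assms(2) by (simp add: matrix_vector_mult_diff_distrib)
  then show ?thesis
    using pos_def_pos[OF pos_def_inv_sqrt_mat[OF assms(1)], of "x - y"] by auto
qed

text \<open>Equal \<open>S\<close> confines the difference \<open>v\<close> to the range of
  \<open>kron_vec (a_vec 0)\<close>; equal \<open>T\<close> makes its score there vanish, so its
  quadratic form is zero.\<close>

lemma S_T_inject:
  assumes \<Sigma>: "pos_def \<Sigma>" and S: "S_stat \<Sigma> R = S_stat \<Sigma> R'" and T: "T_stat \<Sigma> R = T_stat \<Sigma> R'"
  shows "R = R'"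
proof -
  let ?W = "matrix_inv \<Sigma>"
  define v where "v = vec_mat R - vec_mat R'"
  have W: "pos_def ?W" by (rule pos_def_matrix_inv[OF \<Sigma>])
  have i: "pos_def (info \<Sigma> (b_vec 0))" "pos_def (info ?W (a_vec 0))"
    by (simp_all add: pos_def_info W \<Sigma>)
  have "transpose (emb (b_vec 0)) *v v = 0"
    using inv_sqrt_mat_cancel[OF i(1) S[unfolded S_stat_eq]]
    by (simp add: v_def matrix_vector_mult_diff_distrib del: transpose_matrix_vector)
  then have v: "v = kron_vec (a_vec 0) (transpose (emb (a_vec 0)) *v v)"
    using emb_decomposition[of v] by (simp add: kron_vec_eq_0_iff[THEN iffD2] del: transpose_matrix_vector)
  have "score ?W (a_vec 0) v = 0"
    using inv_sqrt_mat_cancel[OF i(2) T[unfolded T_stat_eq]]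
    by (simp add: v_def linear_diff[OF score_linear])
  then have "v \<bullet> (?W *v v) = 0"
    by (subst v) (simp add: inner_score[symmetric] del: transpose_matrix_vector)
  then have "v = 0" using pos_def_pos[OF W, of v] by auto
  then have "vec_mat R = vec_mat R'" by (simp add: v_def)
  then have "unvec (vec_mat R) = unvec (vec_mat R')" by (rule arg_cong)
  then show ?thesis by simp
qed

lemma data_of_eq:
  assumes \<Sigma>: "pos_def \<Sigma>"
  shows "data_of \<Sigma> s t = unvec (recon \<Sigma> s t)"
  unfolding data_of_def
  by (rule inv_f_eq) (auto intro!: injI S_T_inject[OF \<Sigma>] simp: S_stat_recon[OF \<Sigma>] T_stat_recon[OF \<Sigma>])

lemma
  assumes "pos_def \<Sigma>"
  shows S_stat_data_of: "S_stat \<Sigma> (data_of \<Sigma> s t) = s"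
    and T_stat_data_of: "T_stat \<Sigma> (data_of \<Sigma> s t) = t"
    and data_of_stats: "data_of \<Sigma> (S_stat \<Sigma> R) (T_stat \<Sigma> R) = R"
  using assms by (auto simp: data_of_eq S_stat_recon T_stat_recon intro!: S_T_inject)

text \<open>Pythagoras for the orthogonal summands of \<open>recon\<close>: the mixed terms vanish
  because \<open>a_vec 0\<close> and \<open>b_vec 0\<close> are orthogonal.\<close>

lemma inner_recon:
  assumes \<Sigma>: "pos_def \<Sigma>"
  shows "recon \<Sigma> s t \<bullet> (matrix_inv \<Sigma> *v recon \<Sigma> s t) = s \<bullet> s + t \<bullet> t"
proof -
  let ?W = "matrix_inv \<Sigma>"
  define H1 H2 where "H1 = inv_sqrt_mat (info \<Sigma> (b_vec 0))" and "H2 = inv_sqrt_mat (info ?W (a_vec 0))"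
  have i: "pos_def (info \<Sigma> (b_vec 0))" "pos_def (info ?W (a_vec 0))"
    by (simp_all add: pos_def_info pos_def_matrix_inv \<Sigma>)
  have H: "pos_def H1" "pos_def H2"
    by (simp_all add: H1_def H2_def pos_def_inv_sqrt_mat i)
  define x1 x2 where "x1 = kron_vec (b_vec 0) (H1 *v s)" and "x2 = kron_vec (a_vec 0) (H2 *v t)"
  have r: "recon \<Sigma> s t = x2 + \<Sigma> *v x1" by (simp add: recon_def x1_def x2_def H1_def H2_def)
  have Wr: "?W *v recon \<Sigma> s t = ?W *v x2 + x1"
    by (simp add: r matrix_vector_right_distrib matrix_vector_mul_assoc matrix_inv_left pos_def_invertible[OF \<Sigma>])
  have 1: "x2 \<bullet> x1 = 0"
    by (simp add: x1_def x2_def kron_vec_inner)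
  have 2: "(\<Sigma> *v x1) \<bullet> (?W *v x2) = 0"
    using 1 by (simp add: pos_def_inner[OF \<Sigma>, symmetric] matrix_vector_mul_assoc matrix_inv_right pos_def_invertible[OF \<Sigma>] inner_commute)
  have 3: "x2 \<bullet> (?W *v x2) = t \<bullet> t"
  proof -
    have "x2 \<bullet> (?W *v x2) = (H2 *v t) \<bullet> (info ?W (a_vec 0) *v (H2 *v t))"
      by (simp add: x2_def inner_info)
    also have "\<dots> = t \<bullet> ((H2 ** (info ?W (a_vec 0) ** H2)) *v t)"
      by (simp add: pos_def_inner[OF H(2), symmetric] matrix_vector_mul_assoc[symmetric])
    finally show ?thesis by (simp add: H2_def inv_sqrt_mat_conj[OF i(2)])
  qed
  have 4: "x1 \<bullet> (\<Sigma> *v x1) = s \<bullet> s"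
  proof -
    have "x1 \<bullet> (\<Sigma> *v x1) = (H1 *v s) \<bullet> (info \<Sigma> (b_vec 0) *v (H1 *v s))"
      by (simp add: x1_def inner_info)
    also have "\<dots> = s \<bullet> ((H1 ** (info \<Sigma> (b_vec 0) ** H1)) *v s)"
      by (simp add: pos_def_inner[OF H(1), symmetric] matrix_vector_mul_assoc[symmetric])
    finally show ?thesis by (simp add: H1_def inv_sqrt_mat_conj[OF i(1)])
  qed
  show ?thesis
    unfolding Wr by (simp add: r inner_add_left inner_add_right 1 2 3 4 inner_commute[of "\<Sigma> *v x1" x1])
qed

lemma inner_S_T:
  assumes "pos_def \<Sigma>"
  shows "vec_mat R \<bullet> (matrix_inv \<Sigma> *v vec_mat R) = S_stat \<Sigma> R \<bullet> S_stat \<Sigma> R + T_stat \<Sigma> R \<bullet> T_stat \<Sigma> R"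
  using inner_recon[OF assms, of "S_stat \<Sigma> R" "T_stat \<Sigma> R"]
  by (metis assms data_of_eq data_of_stats vec_mat_unvec)

section \<open>Kronecker products and the group action\<close>

lemma kron_mult: "kron A B ** kron C D = kron (A ** C) (B ** D)"
  by (simp add: matrix_matrix_mult_def kron_def vec_eq_iff UNIV_Times_UNIV[symmetric]
      sum.cartesian_product' sum_product mult_ac del: UNIV_Times_UNIV)

lemma kron_mat_1: "kron (mat 1) (mat 1) = mat 1"
  by (auto simp: kron_def mat_def vec_eq_iff prod_eq_iff)

lemma transpose_kron: "transpose (kron A B) = kron (transpose A) (transpose B)"
  by (simp add: kron_def transpose_def vec_eq_iff)

lemma kron_mult_kron_vec: "kron A B *v kron_vec a x = kron_vec (A *v a) (B *v x)"
  by (simp add: matrix_vector_mult_def kron_def kron_vec_def vec_eq_iff UNIV_Times_UNIV[symmetric]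
      sum.cartesian_product' sum_product mult_ac del: UNIV_Times_UNIV)

lemma kron_emb: "kron A B ** emb a = emb (A *v a) ** B"
  by (simp add: matrix_eq matrix_vector_mul_assoc[symmetric] emb_mult_vec kron_mult_kron_vec)

lemma vec_mat_transform: "vec_mat (A ** R ** transpose B) = kron B A *v vec_mat R"
  for A :: "real^'n^'m" and B :: "real^'q^'p"
  by (simp add: matrix_vector_mult_def matrix_matrix_mult_def transpose_def kron_def vec_mat_def vec_eq_iff UNIV_Times_UNIV[symmetric]
      sum.cartesian_product' sum_distrib_left sum_distrib_right mult_ac del: UNIV_Times_UNIV)

lemma invertible_kron:
  assumes "invertible (A :: real^'m^'m)" "invertible (B :: real^'n^'n)"
  shows "invertible (kron A B)"
  unfolding invertible_def
  by (rule exI[of _ "kron (matrix_inv A) (matrix_inv B)"])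
    (simp add: kron_mult matrix_inv_left matrix_inv_right assms kron_mat_1)

text \<open>\<open>kron g2 g1\<close> carries the mean with direction \<open>a\<close> and vector
  \<mu> to the one with direction \<open>g2 *v a\<close> and vector \<open>g1 *v \<mu>\<close>.
  Information and score therefore change as under the reparametrisation of \<mu> by
  \<open>g1\<close>, and the explained sum of squares does not change.\<close>

lemma
  fixes W W' :: "real^(2 \<times> 'k::finite)^(2 \<times> 'k)" and g1 :: "real^'k^'k"
  assumes W: "transpose (kron g2 g1) ** W' ** kron g2 g1 = W" and g1: "invertible g1"
  shows info_transform: "info W' (g2 *v a) = transpose (matrix_inv g1) ** info W a ** matrix_inv g1"
    and score_transform: "score W' (g2 *v a) (kron g2 g1 *v v) = transpose (matrix_inv g1) *v score W a v"
    and quad_transform: "pos_def W \<Longrightarrow> a \<noteq> 0 \<Longrightarrow> quad W' (g2 *v a) (kron g2 g1 *v v) = quad W a v"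
proof -
  let ?K = "kron g2 g1" and ?h = "matrix_inv g1"
  have gh: "g1 ** ?h = mat 1" and hg: "?h ** g1 = mat 1"
    using g1 by (simp_all add: matrix_inv_left matrix_inv_right)
  have e: "emb (g2 *v a) = ?K ** emb a ** ?h"
    by (simp add: kron_emb matrix_mul_assoc[symmetric] gh)
  show i: "info W' (g2 *v a) = transpose ?h ** info W a ** ?h"
    unfolding info_def e W[symmetric] by (simp add: matrix_transpose_mul matrix_mul_assoc)
  have "transpose (emb (g2 *v a)) ** W' ** ?K = transpose ?h ** transpose (emb a) ** W"
    unfolding e W[symmetric] by (simp add: matrix_transpose_mul matrix_mul_assoc)
  then show s: "score W' (g2 *v a) (?K *v v) = transpose ?h *v score W a v"
    by (simp add: score_def matrix_vector_mul_assoc matrix_mul_assoc del: transpose_matrix_vector)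
  assume "pos_def W" "a \<noteq> 0"
  then have D: "invertible (info W a)" by (intro pos_def_invertible pos_def_info)
  have hg': "transpose ?h ** transpose g1 = mat 1" "transpose g1 ** transpose ?h = mat 1"
    by (simp_all add: matrix_transpose_mul[symmetric] gh hg transpose_mat)
  have "matrix_inv (info W' (g2 *v a)) = g1 ** matrix_inv (info W a) ** transpose g1"
  proof (rule matrix_inv_eqI)
    have "info W' (g2 *v a) ** (g1 ** matrix_inv (info W a) ** transpose g1) =
        transpose ?h ** (info W a ** ((?h ** g1) ** matrix_inv (info W a))) ** transpose g1"
      by (simp add: i matrix_mul_assoc)
    then show "info W' (g2 *v a) ** (g1 ** matrix_inv (info W a) ** transpose g1) = mat 1"
      by (simp add: hg matrix_inv_right D hg')
  qed
  then have "matrix_inv (info W' (g2 *v a)) *v (transpose ?h *v score W a v) =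
      g1 *v (matrix_inv (info W a) *v ((transpose g1 ** transpose ?h) *v score W a v))"
    by (simp only: matrix_vector_mul_assoc matrix_mul_assoc)
  then have *: "matrix_inv (info W' (g2 *v a)) *v (transpose ?h *v score W a v) =
      g1 *v (matrix_inv (info W a) *v score W a v)"
    by (simp only: hg' matrix_vector_mul_lid)
  show "quad W' (g2 *v a) (?K *v v) = quad W a v"
    unfolding quad_def s * inner_matrix_vector[symmetric]
    by (simp only: matrix_vector_mul_assoc hg matrix_mul_assoc matrix_mul_lid)
qed

text \<open>\<open>C ** sqrt_mat M\<close> is a factor of the transformed matrix, as is its
  symmetric root, and two such factors differ by a rotation. Hence standardised statistics are
  equivariant only up to rotation.\<close>

lemma inv_sqrt_mat_congruence:
  fixes M C :: "real^'n^'n"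
  assumes M: "pos_def M" and C: "invertible C"
  obtains Q where "orthogonal_matrix Q"
    "inv_sqrt_mat (C ** M ** transpose C) ** C = Q ** inv_sqrt_mat M"
proof
  let ?M = "C ** M ** transpose C" and ?B = "sqrt_mat M"
  let ?Q = "inv_sqrt_mat ?M ** C ** ?B"
  have B: "pos_def ?B" by (rule pos_def_sqrt_mat[OF M])
  have "pos_def (transpose (transpose C) ** M ** transpose C)"
  proof (rule pos_def_congruence[OF M])
    fix x assume "transpose C *v x = 0"
    then have "transpose (matrix_inv C) *v (transpose C *v x) = 0" by simp
    then show "x = 0"
      using C by (simp add: matrix_vector_mul_assoc matrix_transpose_mul[symmetric] matrix_inv_right transpose_mat
          del: transpose_matrix_vector)
  qed
  then have M': "pos_def ?M" by (simp add: transpose_transpose)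
  have "?Q ** transpose ?Q = inv_sqrt_mat ?M ** C ** (?B ** ?B) ** transpose C ** inv_sqrt_mat ?M"
    by (simp only: matrix_transpose_mul pos_def_sym[OF B] pos_def_sym[OF pos_def_inv_sqrt_mat[OF M']]
        matrix_mul_assoc)
  also have "\<dots> = inv_sqrt_mat ?M ** (?M ** inv_sqrt_mat ?M)"
    by (simp only: sqrt_mat_square[OF M] matrix_mul_assoc)
  finally have "?Q ** transpose ?Q = mat 1"
    by (simp add: inv_sqrt_mat_conj[OF M'])
  then show "orthogonal_matrix ?Q"
    by (simp add: orthogonal_matrix_def matrix_left_right_inverse)
  show "inv_sqrt_mat ?M ** C = ?Q ** inv_sqrt_mat M"
    by (simp add: inv_sqrt_mat_def[of M] matrix_mul_assoc[symmetric] matrix_inv_right pos_def_invertible[OF B])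
qed

section \<open>The integrated likelihood statistic\<close>

lemma b_vec_affine: "b_vec u = b_vec 0 + u *\<^sub>R a_vec 0"
  by (simp add: b_vec_def a_vec_def vec_eq_iff forall_2 vector_2)

lemma kron_vec_b_vec: "kron_vec (b_vec u) x = kron_vec (b_vec 0) x + u *\<^sub>R kron_vec (a_vec 0) x"
  by (subst b_vec_affine) (simp add: kron_vec_def vec_eq_iff algebra_simps)

lemma continuous_on_linear:
  fixes T :: "'b::euclidean_space \<Rightarrow> 'c::real_normed_vector"
  assumes "linear T" "continuous_on S g"
  shows "continuous_on S (\<lambda>z. T (g z))"
  using bounded_linear.continuous_on[of T S g] assms by (simp add: linear_linear)

lemma continuous_on_kron_vec_b_vec [continuous_intros]:
  fixes g :: "'a::topological_space \<Rightarrow> real^'k"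
  assumes "continuous_on S f" "continuous_on S g"
  shows "continuous_on S (\<lambda>z. kron_vec (b_vec (f z)) (g z))"
proof -
  have "(\<lambda>z. kron_vec (b_vec (f z)) (g z)) =
      (\<lambda>z. kron_vec (b_vec 0) (g z) + f z *\<^sub>R kron_vec (a_vec 0) (g z))"
    by (rule ext) (rule kron_vec_b_vec)
  then show ?thesis
    by (simp only:) (intro continuous_intros assms continuous_on_linear[OF kron_vec_linear])
qed

lemma continuous_on_matrix_vector_mult [continuous_intros]:
  fixes A :: "real^'n^'m"
  shows "continuous_on S g \<Longrightarrow> continuous_on S (\<lambda>z. A *v g z)"
  using continuous_on_linear[of "(*v) A" S g] by simp

section \<open>The substitution u = 1 / \<Delta>\<close>

lemma integrable_inverse_1_plus_square_lborel: "integrable lborel (\<lambda>u::real. inverse (1 + u\<^sup>2))"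
  using integrable_inverse_1_plus_square by (simp add: set_integrable_def)

text \<open>Inversion is an injective self-map of the punctured line. The substitution theorem
  concerns absolute integrability under \<open>lebesgue\<close>, hence the passage to the completion
  and back.\<close>

lemma integral_inverse_substitution:
  fixes f :: "real \<Rightarrow> real"
  assumes f: "integrable lborel f"
  shows "(\<integral>x. f (1 / x) / x\<^sup>2 \<partial>lborel) = (\<integral>u. f u \<partial>lborel)"
proof -
  let ?S = "- {0::real}"
  have [measurable]: "f \<in> borel_measurable borel" using f by auto
  have fS: "(\<lambda>u. indicator ?S u *\<^sub>R f u) \<in> borel_measurable lborel" by measurable
  have AE: "AE u in lborel. indicator ?S u *\<^sub>R f u = f u"
    using AE_lborel_singleton[of "0::real"] by eventually_elim simp
  have "integrable lborel (\<lambda>u. indicator ?S u *\<^sub>R f u)"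
    using f by (subst integrable_cong_AE[OF fS _ AE]) auto
  then have int: "set_integrable lebesgue ?S f"
    unfolding set_integrable_def by (subst integrable_completion[OF fS])
  have "(\<integral>u. f u \<partial>lborel) = (LINT u:?S|lebesgue. f u)"
    unfolding set_lebesgue_integral_def
    by (subst integral_completion[OF fS], intro integral_cong_AE) (use AE in auto)
  also have "\<dots> = integral ?S f"
    by (rule set_lebesgue_integral_eq_integral(2)[OF int])
  finally have i: "integral ?S f = (\<integral>u. f u \<partial>lborel)" ..
  have img: "(\<lambda>x. 1 / x) ` ?S = ?S"
  proof (intro equalityI subsetI)
    fix x :: real assume "x \<in> ?S"
    then show "x \<in> (\<lambda>x. 1 / x) ` ?S" by (intro image_eqI[of _ _ "1 / x"]) auto
  qed auto
  have der: "((\<lambda>x. 1 / x) has_real_derivative - 1 / x\<^sup>2) (at x within ?S)" if "x \<in> ?S" for x :: real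
    using that by (auto intro!: derivative_eq_intros simp: power2_eq_square)
  have inj: "inj_on (\<lambda>x::real. 1 / x) ?S" by (auto simp: inj_on_def)
  have "?S \<in> sets lebesgue" by simp
  from has_absolute_integral_change_of_variables_1'[OF this der inj, of f "\<integral>u. f u \<partial>lborel"]
  have "(\<lambda>x. \<bar>- 1 / x\<^sup>2\<bar> * f (1 / x)) absolutely_integrable_on ?S \<and>
      integral ?S (\<lambda>x. \<bar>- 1 / x\<^sup>2\<bar> * f (1 / x)) = (\<integral>u. f u \<partial>lborel)"
    using int i by (simp add: img)
  then have g: "set_integrable lebesgue ?S (\<lambda>x. \<bar>- 1 / x\<^sup>2\<bar> * f (1 / x))"
      "integral ?S (\<lambda>x. \<bar>- 1 / x\<^sup>2\<bar> * f (1 / x)) = (\<integral>u. f u \<partial>lborel)"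
    by auto
  have gm: "(\<lambda>x. f (1 / x) / x\<^sup>2) \<in> borel_measurable lborel" by measurable
  have "(\<integral>x. f (1 / x) / x\<^sup>2 \<partial>lborel) = (\<integral>x. f (1 / x) / x\<^sup>2 \<partial>lebesgue)"
    by (rule integral_completion[OF gm, symmetric])
  \<comment> \<open>At 0 the division by zero makes the integrand 0, so restricting to
    \<open>?S\<close> changes it at no point.\<close>
  also have "\<dots> = (LINT x:?S|lebesgue. \<bar>- 1 / x\<^sup>2\<bar> * f (1 / x))"
    unfolding set_lebesgue_integral_def
    by (intro Bochner_Integration.integral_cong refl) (auto simp: indicator_def)
  also have "\<dots> = (\<integral>u. f u \<partial>lborel)"
    using set_lebesgue_integral_eq_integral(2)[OF g(1)] g(2) by simp
  finally show ?thesis .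
qed

section \<open>Bounds, integrability and continuity\<close>

lemma pos_def_lower_bound:
  fixes W :: "real^'n^'n"
  assumes W: "pos_def W"
  obtains l where "0 < l" "\<And>x. l * (x \<bullet> x) \<le> x \<bullet> (W *v x)"
proof -
  let ?K = "sphere 0 1 :: (real^'n) set"
  have ne: "?K \<noteq> {}" by simp
  have "continuous_on ?K (\<lambda>x. x \<bullet> (W *v x))"
    by (intro continuous_intros)
  from continuous_attains_inf[OF compact_sphere ne this]
  obtain e where e: "e \<in> ?K" "\<And>x. x \<in> ?K \<Longrightarrow> e \<bullet> (W *v e) \<le> x \<bullet> (W *v x)" by blast
  show ?thesis
  proof
    show "0 < e \<bullet> (W *v e)" using e(1) by (intro pos_def_pos[OF W]) auto
    fix x :: "real^'n"
    show "e \<bullet> (W *v e) * (x \<bullet> x) \<le> x \<bullet> (W *v x)"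
    proof (cases "x = 0")
      case False
      then have "e \<bullet> (W *v e) \<le> (x /\<^sub>R norm x) \<bullet> (W *v (x /\<^sub>R norm x))"
        by (intro e(2)) simp
      also have "\<dots> = (x \<bullet> (W *v x)) / (x \<bullet> x)"
        by (simp add: linear_scale[OF matrix_vector_mul_linear] dot_square_norm power2_eq_square divide_simps)
      finally show ?thesis using False by (simp add: pos_le_divide_eq)
    qed simp
  qed
qed

lemma pos_def_scaled_mat_1: "0 < c \<Longrightarrow> pos_def (c *\<^sub>R mat 1)"
  by (simp add: pos_def_def transpose_scaleR transpose_mat scaleR_matrix_vector_assoc[symmetric])

lemma il_kernel_nonneg: "0 \<le> il_kernel W v a"
  by (simp add: il_kernel_def)

text \<open>A flat weight on \<mu>: after completing the square, a Gaussian integral with precision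
  \<open>info W a\<close> remains. Adding \<open>quad W (a_vec 0) v\<close> to the exponent in front
  keeps that factor free of the direction.\<close>

lemma nn_integral_likelihood:
  fixes W :: "real^(2 \<times> 'k::finite)^(2 \<times> 'k)"
  assumes W: "pos_def W" and a: "a \<noteq> 0"
  shows "(\<integral>\<^sup>+x. ennreal (exp (- ((v - kron_vec a x) \<bullet> (W *v (v - kron_vec a x))) / 2)) \<partial>lborel) =
    ennreal ((2 * pi) powr (real CARD('k) / 2) * exp ((quad W (a_vec 0) v - v \<bullet> (W *v v)) / 2) *
      il_kernel W v a)"
proof -
  let ?c = "matrix_inv (info W a) *v score W a v"
  have D: "pos_def (info W a)" by (rule pos_def_info[OF W a])
  have "(\<integral>\<^sup>+x. ennreal (exp (- ((v - kron_vec a x) \<bullet> (W *v (v - kron_vec a x))) / 2)) \<partial>lborel) =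
      (\<integral>\<^sup>+x. ennreal (exp ((quad W a v - v \<bullet> (W *v v)) / 2)) *
        ennreal (exp (- ((x - ?c) \<bullet> (info W a *v (x - ?c))) / 2)) \<partial>lborel)"
    by (intro nn_integral_cong, subst complete_square[OF W a])
      (simp add: field_simps flip: exp_add ennreal_mult)
  also have "\<dots> = ennreal (exp ((quad W a v - v \<bullet> (W *v v)) / 2)) *
      (\<integral>\<^sup>+x. ennreal (exp (- ((x - ?c) \<bullet> (info W a *v (x - ?c))) / 2)) \<partial>lborel)"
    by (intro nn_integral_cmult measurable_compose[OF _ measurable_ennreal])
      (auto intro!: borel_measurable_continuous_onI continuous_intros)
  also have "\<dots> = ennreal (exp ((quad W a v - v \<bullet> (W *v v)) / 2) *
      ((2 * pi) powr (real CARD('k) / 2) * det (info W a) powr (- 1 / 2)))"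
    by (simp only: nn_integral_gaussian[OF D] ennreal_mult'[OF exp_ge_zero])
  also have "exp ((quad W a v - v \<bullet> (W *v v)) / 2) * ((2 * pi) powr (real CARD('k) / 2) * det (info W a) powr (- 1 / 2)) =
      (2 * pi) powr (real CARD('k) / 2) * exp ((quad W (a_vec 0) v - v \<bullet> (W *v v)) / 2) * il_kernel W v a"
    unfolding il_kernel_def by (simp add: field_simps flip: exp_add)
  finally show ?thesis .
qed

lemma measurable_likelihood:
  fixes W :: "real^(2 \<times> 'k::finite)^(2 \<times> 'k)"
  shows "(\<lambda>(u, x). exp (- ((v - kron_vec (b_vec u) x) \<bullet> (W *v (v - kron_vec (b_vec u) x))) / 2))
    \<in> borel_measurable (borel \<Otimes>\<^sub>M borel)"
  unfolding borel_prod split_beta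
  by (intro borel_measurable_continuous_onI continuous_intros) simp

text \<open>Rather than through inverses and determinants depending on \<open>u\<close>,
  measurability comes from the Gaussian representation: up to a positive constant the kernel is a
  parameter integral of a jointly continuous function.\<close>

lemma borel_measurable_il_kernel:
  fixes W :: "real^(2 \<times> 'k::finite)^(2 \<times> 'k)"
  assumes W: "pos_def W"
  shows "(\<lambda>u. il_kernel W v (b_vec u)) \<in> borel_measurable borel"
proof -
  define h where "h u x = exp (- ((v - kron_vec (b_vec u) x) \<bullet> (W *v (v - kron_vec (b_vec u) x))) / 2)" for u x
  define c where "c = (2 * pi) powr (real CARD('k) / 2) * exp ((quad W (a_vec 0) v - v \<bullet> (W *v v)) / 2)"
  have c: "0 < c" by (simp add: c_def)
  have [measurable]: "(\<lambda>(u, x). h u x) \<in> borel_measurable (borel \<Otimes>\<^sub>M borel)"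
    unfolding h_def by (rule measurable_likelihood)
  have "(\<integral>\<^sup>+x. ennreal (h u x) \<partial>lborel) = ennreal (c * il_kernel W v (b_vec u))" for u
    using nn_integral_likelihood[OF W, of "b_vec u" v] by (simp add: h_def c_def)
  then have "il_kernel W v (b_vec u) = enn2real (\<integral>\<^sup>+x. ennreal (h u x) \<partial>lborel) / c" for u
    using c by (simp add: il_kernel_nonneg)
  moreover have "(\<lambda>u. enn2real (\<integral>\<^sup>+x. ennreal (h u x) \<partial>lborel) / c) \<in> borel_measurable borel"
    by measurable
  ultimately show ?thesis by simp
qed

text \<open>The form of \<open>info W a\<close> dominates \<open>l * (a \<bullet> a)\<close> times
  the identity. Comparing the two Gaussian integrals pointwise turns this into a comparison of
  determinants.\<close>

lemma info_det_bound:
  fixes W :: "real^(2 \<times> 'k::finite)^(2 \<times> 'k)"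
  assumes W: "pos_def W"
  obtains l where "0 < l"
    "\<And>a. a \<noteq> 0 \<Longrightarrow> det (info W a) powr (- 1 / 2) \<le> (l * (a \<bullet> a)) powr (- (real CARD('k) / 2))"
proof -
  obtain l where l: "0 < l" "\<And>x. l * (x \<bullet> x) \<le> x \<bullet> (W *v x)"
    using pos_def_lower_bound[OF W] by blast
  have "det (info W a) powr (- 1 / 2) \<le> (l * (a \<bullet> a)) powr (- (real CARD('k) / 2))" if a: "a \<noteq> 0" for a
  proof -
    let ?c = "l * (a \<bullet> a)"
    have c: "0 < ?c" using l(1) a by simp
    let ?C = "?c *\<^sub>R mat 1 :: real^'k^'k"
    have le: "x \<bullet> (?C *v x) \<le> x \<bullet> (info W a *v x)" for x
      using l(2)[of "kron_vec a x"]
      by (simp add: inner_info kron_vec_inner scaleR_matrix_vector_assoc[symmetric] mult.assoc)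
    have "ennreal ((2 * pi) powr (real CARD('k) / 2) * det (info W a) powr (- 1 / 2)) \<le>
        ennreal ((2 * pi) powr (real CARD('k) / 2) * det ?C powr (- 1 / 2))"
      unfolding nn_integral_gaussian[OF pos_def_info[OF W a], of 0, symmetric]
        nn_integral_gaussian[OF pos_def_scaled_mat_1[OF c], of 0, symmetric]
      using le by (intro nn_integral_mono ennreal_leI) simp
    then have "det (info W a) powr (- 1 / 2) \<le> det ?C powr (- 1 / 2)"
      by simp
    also have "det ?C = ?c powr real CARD('k)"
      using c by (simp add: det_scaleR powr_realpow)
    finally show ?thesis by (simp add: powr_powr)
  qed
  with l(1) show ?thesis by (rule that)
qed

text \<open>From \<open>b_vec u \<bullet> b_vec u = 1 + u\<^sup>2\<close>, the determinant factor
  decays with exponent -k/2, and k >= 2 allows the integrable exponent -1. \<open>C\<close> is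
  uniform in \<open>v\<close>, as dominated convergence requires.\<close>

lemma il_kernel_bound:
  fixes W :: "real^(2 \<times> 'k::finite)^(2 \<times> 'k)"
  assumes k: "2 \<le> CARD('k)" and W: "pos_def W"
  obtains C where "0 < C"
    "\<And>v u. il_kernel W v (b_vec u) \<le> C * exp ((v \<bullet> (W *v v)) / 2) * inverse (1 + u\<^sup>2)"
proof -
  obtain l where l: "0 < l"
    "\<And>a. a \<noteq> 0 \<Longrightarrow> det (info W a) powr (- 1 / 2) \<le> (l * (a \<bullet> a)) powr (- (real CARD('k) / 2))"
    using info_det_bound[OF W] by blast
  define C where "C = l powr (- (real CARD('k) / 2))"
  have "il_kernel W v (b_vec u) \<le> C * exp ((v \<bullet> (W *v v)) / 2) * inverse (1 + u\<^sup>2)" for u v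
  proof -
    have bb: "b_vec u \<bullet> b_vec u = 1 + u\<^sup>2"
      by (simp add: b_vec_def inner_vec_def sum_2 vector_2 power2_eq_square)
    have u: "1 \<le> 1 + u\<^sup>2" by simp
    have "det (info W (b_vec u)) powr (- 1 / 2) \<le> (l * (1 + u\<^sup>2)) powr (- (real CARD('k) / 2))"
      using l(2)[OF b_vec_nz, of u] by (simp only: bb)
    also have "\<dots> = C * (1 + u\<^sup>2) powr (- (real CARD('k) / 2))"
      using l(1) u by (simp add: C_def powr_mult)
    also have "\<dots> \<le> C * (1 + u\<^sup>2) powr (- 1)"
      using k u l(1) by (intro mult_left_mono powr_mono) (auto simp: C_def)
    also have "(1 + u\<^sup>2) powr (- 1) = inverse (1 + u\<^sup>2)"
      using u by (simp add: powr_minus)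
    finally have d: "det (info W (b_vec u)) powr (- 1 / 2) \<le> C * inverse (1 + u\<^sup>2)" .
    have "exp ((quad W (b_vec u) v - quad W (a_vec 0) v) / 2) \<le> exp ((v \<bullet> (W *v v)) / 2)"
      using quad_le[OF W b_vec_nz, of u v] quad_nonneg[OF W a_vec_nz, of 0 v] by simp
    with d have "il_kernel W v (b_vec u) \<le> exp ((v \<bullet> (W *v v)) / 2) * (C * inverse (1 + u\<^sup>2))"
      unfolding il_kernel_def by (intro mult_mono) auto
    then show ?thesis by (simp add: mult_ac)
  qed
  moreover have "0 < C" using l(1) by (simp add: C_def)
  ultimately show ?thesis by (rule that[rotated])
qed

lemma integrable_il_kernel:
  fixes W :: "real^(2 \<times> 'k::finite)^(2 \<times> 'k)"
  assumes k: "2 \<le> CARD('k)" and W: "pos_def W"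
  shows "integrable lborel (\<lambda>u. il_kernel W v (b_vec u))"
proof -
  obtain C where C: "0 < C"
    "\<And>v u. il_kernel W v (b_vec u) \<le> C * exp ((v \<bullet> (W *v v)) / 2) * inverse (1 + u\<^sup>2)"
    using il_kernel_bound[OF k W] by blast
  have "integrable lborel (\<lambda>u. C * exp ((v \<bullet> (W *v v)) / 2) * inverse (1 + u\<^sup>2))"
    by (intro integrable_mult_right integrable_inverse_1_plus_square_lborel)
  then show ?thesis
    by (rule Bochner_Integration.integrable_bound)
      (use borel_measurable_il_kernel[OF W] C in \<open>auto simp: il_kernel_nonneg intro!: AE_I2 order_trans[OF _ abs_ge_self]\<close>)
qed

definition il_integral :: "real^(2 \<times> 'k::finite)^(2 \<times> 'k) \<Rightarrow> real^(2 \<times> 'k) \<Rightarrow> real" where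
  "il_integral W v = (\<integral>u. il_kernel W v (b_vec u) \<partial>lborel)"

text \<open>Degree -k of the kernel and the weight of degree k - 2 combine to
  \<open>1 / \<Delta>\<^sup>2\<close>, the Jacobian of inversion.\<close>

lemma IL_eq_il_integral:
  fixes R :: "real^2^'k::finite"
  assumes k: "2 \<le> CARD('k)" and \<Sigma>: "pos_def \<Sigma>"
  shows "IL R \<Sigma> = il_integral (matrix_inv \<Sigma>) (vec_mat R)"
proof -
  let ?W = "matrix_inv \<Sigma>" and ?v = "vec_mat R"
  let ?f = "\<lambda>u. il_kernel ?W ?v (b_vec u)"
  let ?h = "\<lambda>\<Delta>. il_kernel ?W ?v (a_vec \<Delta>) * \<bar>\<Delta>\<bar> ^ (CARD('k) - 2)"
  have W: "pos_def ?W" by (rule pos_def_matrix_inv[OF \<Sigma>])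
  have [measurable]: "?f \<in> borel_measurable borel" by (rule borel_measurable_il_kernel[OF W])
  have h: "?h \<Delta> = ?f (1 / \<Delta>) / \<Delta>\<^sup>2" if "\<Delta> \<noteq> 0" for \<Delta>
  proof -
    have "a_vec \<Delta> = \<Delta> *\<^sub>R b_vec (1 / \<Delta>)"
      using that by (simp add: a_vec_def b_vec_def vec_eq_iff forall_2 vector_2)
    then have "?h \<Delta> = \<bar>\<Delta>\<bar> powr (- real CARD('k)) * \<bar>\<Delta>\<bar> powr (real (CARD('k) - 2)) * ?f (1 / \<Delta>)"
      using that by (simp add: il_kernel_scaleR[OF W] powr_realpow)
    also have "\<bar>\<Delta>\<bar> powr (- real CARD('k)) * \<bar>\<Delta>\<bar> powr (real (CARD('k) - 2)) = \<bar>\<Delta>\<bar> powr (- 2)"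
      using k by (simp add: powr_add[symmetric] of_nat_diff)
    also have "\<bar>\<Delta>\<bar> powr (- 2) = 1 / \<Delta>\<^sup>2"
      using that by (simp add: powr_minus_divide)
    finally show ?thesis by simp
  qed
  \<comment> \<open>The point 0 is kept apart: for k = 2 the weight there is
    \<open>0 ^ 0 = 1\<close>, while the right side is 0 by division by zero.\<close>
  have "?h = (\<lambda>\<Delta>. if \<Delta> = 0 then ?h 0 else ?f (1 / \<Delta>) / \<Delta>\<^sup>2)"
    using h by auto
  moreover have "(\<lambda>\<Delta>. if \<Delta> = 0 then ?h 0 else ?f (1 / \<Delta>) / \<Delta>\<^sup>2) \<in> borel_measurable lborel"
    by measurable
  ultimately have [measurable]: "?h \<in> borel_measurable lborel" by simp
  have "IL R \<Sigma> = (\<integral>\<Delta>. ?f (1 / \<Delta>) / \<Delta>\<^sup>2 \<partial>lborel)"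
    unfolding IL_eq_kernel[OF \<Sigma>]
  proof (rule integral_cong_AE)
    show "AE \<Delta> in lborel. ?h \<Delta> = ?f (1 / \<Delta>) / \<Delta>\<^sup>2"
      using AE_lborel_singleton[of "0::real"] by eventually_elim (rule h)
  qed measurable
  then show ?thesis
    by (simp add: integral_inverse_substitution[OF integrable_il_kernel[OF k W]] il_integral_def)
qed

lemma continuous_on_quad [continuous_intros]:
  assumes "continuous_on S g"
  shows "continuous_on S (\<lambda>z. quad W a (g z))"
  unfolding quad_def
  by (intro continuous_intros continuous_on_linear[OF score_linear] assms)

text \<open>The majorant of \<open>il_kernel_bound\<close> varies with \<open>v\<close> only through
  an exponential, which is bounded along a convergent sequence.\<close>

lemma continuous_il_integral:
  fixes W :: "real^(2 \<times> 'k::finite)^(2 \<times> 'k)"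
  assumes k: "2 \<le> CARD('k)" and W: "pos_def W"
  shows "continuous_on UNIV (il_integral W)"
proof (rule continuous_on_sequentiallyI)
  fix x and v :: "real^(2 \<times> 'k)" assume x: "x \<longlonglongrightarrow> v"
  obtain C where C: "0 < C"
    "\<And>v u. il_kernel W v (b_vec u) \<le> C * exp ((v \<bullet> (W *v v)) / 2) * inverse (1 + u\<^sup>2)"
    using il_kernel_bound[OF k W] by blast
  have lim: "(\<lambda>n. g (x n)) \<longlonglongrightarrow> g v" if "continuous_on UNIV g" for g :: "_ \<Rightarrow> real"
    using continuous_on_tendsto_compose[OF that x] by simp
  have "(\<lambda>n. exp ((x n \<bullet> (W *v x n)) / 2)) \<longlonglongrightarrow> exp ((v \<bullet> (W *v v)) / 2)"
    by (intro lim[of "\<lambda>v. exp ((v \<bullet> (W *v v)) / 2)"] continuous_intros) auto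
  then have "Bseq (\<lambda>n. exp ((x n \<bullet> (W *v x n)) / 2))"
    by (auto intro: convergent_imp_Bseq convergentI)
  then obtain B where B: "\<And>n. exp ((x n \<bullet> (W *v x n)) / 2) \<le> B"
    by (auto simp: Bseq_def)
  show "(\<lambda>n. il_integral W (x n)) \<longlonglongrightarrow> il_integral W v"
    unfolding il_integral_def
  proof (rule integral_dominated_convergence[where w="\<lambda>u. C * B * inverse (1 + u\<^sup>2)"])
    show "integrable lborel (\<lambda>u::real. C * B * inverse (1 + u\<^sup>2))"
      by (intro integrable_mult_right integrable_inverse_1_plus_square_lborel)
    show "AE u in lborel. (\<lambda>n. il_kernel W (x n) (b_vec u)) \<longlonglongrightarrow> il_kernel W v (b_vec u)"
    proof (rule AE_I2)
      fix u
      show "(\<lambda>n. il_kernel W (x n) (b_vec u)) \<longlonglongrightarrow> il_kernel W v (b_vec u)"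
        unfolding il_kernel_def
        by (intro lim[of "\<lambda>v. exp ((quad W (b_vec u) v - quad W (a_vec 0) v) / 2) * det (info W (b_vec u)) powr (- 1 / 2)"]
            continuous_intros) simp
    qed
    fix n
    have "il_kernel W (x n) (b_vec u) \<le> C * B * inverse (1 + u\<^sup>2)" for u
      using C(2)[of "x n" u] B[of n] C(1)
      by (elim order_trans) (intro mult_right_mono mult_left_mono, auto)
    then show "AE u in lborel. norm (il_kernel W (x n) (b_vec u)) \<le> C * B * inverse (1 + u\<^sup>2)"
      by (auto simp: il_kernel_nonneg)
  qed (use borel_measurable_il_kernel[OF W] in auto)
qed

section \<open>Critical values\<close>

text \<open>A point of value \<open>c\<close> is not interior to the sublevel set: it would be the
  midpoint of a segment with both end values at most \<open>c\<close>, and strict convexity would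
  put its own value below \<open>c\<close>.\<close>

lemma negligible_level_set_strictly_convex:
  fixes f :: "'a::euclidean_space \<Rightarrow> real"
  assumes f: "\<And>x y t. x \<noteq> y \<Longrightarrow> 0 < t \<Longrightarrow> t < 1 \<Longrightarrow>
      f (t *\<^sub>R x + (1 - t) *\<^sub>R y) < t * f x + (1 - t) * f y"
  shows "negligible {x. f x = c}"
proof (rule negligible_subset)
  let ?C = "{x. f x \<le> c}"
  have "convex ?C"
    unfolding convex_alt
  proof (intro ballI allI impI)
    fix x y u assume x: "x \<in> ?C" and y: "y \<in> ?C" and u: "0 \<le> u \<and> u \<le> (1::real)"
    consider "x = y" | "u = 0" | "u = 1" | "x \<noteq> y" "0 < 1 - u" "1 - u < 1" using u by force
    then show "(1 - u) *\<^sub>R x + u *\<^sub>R y \<in> ?C"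
    proof cases
      case 1
      then show ?thesis using x by (simp flip: scaleR_left_distrib)
    next
      case 4
      from f[OF this] have "f ((1 - u) *\<^sub>R x + u *\<^sub>R y) < (1 - u) * f x + u * f y" by simp
      also have "\<dots> \<le> (1 - u) * c + u * c"
        using x y u by (intro add_mono mult_left_mono) auto
      finally show ?thesis by (simp add: algebra_simps)
    qed (use x y in auto)
  qed
  then show "negligible (frontier ?C)" by (rule negligible_convex_frontier)
  show "{x. f x = c} \<subseteq> frontier ?C"
  proof
    fix x assume x: "x \<in> {x. f x = c}"
    have "x \<notin> interior ?C"
    proof
      assume "x \<in> interior ?C"
      then obtain e where e: "0 < e" "ball x e \<subseteq> ?C" by (auto simp: mem_interior)
      obtain b :: 'a where b: "b \<in> Basis" using nonempty_Basis by blast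
      define d where "d = (e / 2) *\<^sub>R b"
      have d: "norm d < e" "d \<noteq> 0" using e(1) b by (auto simp: d_def)
      have "x + d \<in> ball x e" "x - d \<in> ball x e"
        using d by (auto simp: dist_norm)
      then have le: "f (x + d) \<le> c" "f (x - d) \<le> c" using e(2) by blast+
      have "x + d \<noteq> x - d"
      proof
        assume "x + d = x - d"
        then have "2 *\<^sub>R d = 0" by (simp add: scaleR_2 algebra_simps)
        with d(2) show False by simp
      qed
      from f[OF this, of "1 / 2"] have "f x < 1 / 2 * f (x + d) + 1 / 2 * f (x - d)"
        by (simp add: algebra_simps flip: scaleR_left_distrib)
      with le x show False by simp
    qed
    moreover have "x \<in> closure ?C" using x closure_subset[of ?C] by auto
    ultimately show "x \<in> frontier ?C" by (simp add: frontier_def)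
  qed
qed

lemma pos_def_strictly_convex:
  assumes M: "pos_def M" and "x \<noteq> y" and t: "0 < t" "t < 1"
  shows "(t *\<^sub>R x + (1 - t) *\<^sub>R y) \<bullet> (M *v (t *\<^sub>R x + (1 - t) *\<^sub>R y)) <
    t * (x \<bullet> (M *v x)) + (1 - t) * (y \<bullet> (M *v y))"
proof -
  have c: "y \<bullet> (M *v x) = x \<bullet> (M *v y)"
    by (subst pos_def_inner[OF M]) (rule inner_commute)
  have "(t *\<^sub>R x + (1 - t) *\<^sub>R y) \<bullet> (M *v (t *\<^sub>R x + (1 - t) *\<^sub>R y)) =
      t * (x \<bullet> (M *v x)) + (1 - t) * (y \<bullet> (M *v y)) - t * (1 - t) * ((x - y) \<bullet> (M *v (x - y)))"
    by (simp add: matrix_vector_right_distrib matrix_vector_mult_diff_distrib linear_scale[OF matrix_vector_mul_linear]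
        inner_add_left inner_add_right inner_diff_left inner_diff_right c)
      (simp add: algebra_simps)
  moreover have "0 < t * (1 - t) * ((x - y) \<bullet> (M *v (x - y)))"
    using assms pos_def_pos[OF M, of "x - y"] by simp
  ultimately show ?thesis by simp
qed

text \<open>The score \<open>p\<close> is affine in \<open>s\<close> with an injective linear part,
  and a positive definite form of such a map is strictly convex.\<close>

lemma quad_recon_strictly_convex:
  assumes \<Sigma>: "pos_def \<Sigma>" and xy: "x \<noteq> y" and r: "0 < r" "r < 1"
  shows "quad (matrix_inv \<Sigma>) (b_vec u) (recon \<Sigma> (r *\<^sub>R x + (1 - r) *\<^sub>R y) t) <
    r * quad (matrix_inv \<Sigma>) (b_vec u) (recon \<Sigma> x t) + (1 - r) * quad (matrix_inv \<Sigma>) (b_vec u) (recon \<Sigma> y t)"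
proof -
  let ?W = "matrix_inv \<Sigma>"
  define p where "p s = score ?W (b_vec u) (recon \<Sigma> s t)" for s
  define H where "H = inv_sqrt_mat (info \<Sigma> (b_vec 0))"
  define p0 where "p0 = score ?W (b_vec u) (kron_vec (a_vec 0) (inv_sqrt_mat (info ?W (a_vec 0)) *v t))"
  have p: "p s = p0 + H *v s" for s
    by (simp add: p_def p0_def H_def score_recon[OF \<Sigma>])
  have "p x \<noteq> p y"
    using xy inv_sqrt_mat_cancel[of "info \<Sigma> (b_vec 0)" x y] \<Sigma> by (auto simp: p H_def pos_def_info)
  moreover have "p (r *\<^sub>R x + (1 - r) *\<^sub>R y) = r *\<^sub>R p x + (1 - r) *\<^sub>R p y"
    by (simp add: p matrix_vector_right_distrib linear_scale[OF matrix_vector_mul_linear] algebra_simps)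
  ultimately show ?thesis
    using pos_def_strictly_convex[of "matrix_inv (info ?W (b_vec u))" "p x" "p y" r] r \<Sigma>
    by (simp add: quad_def p_def pos_def_matrix_inv pos_def_info)
qed

lemma quad_a_recon:
  assumes \<Sigma>: "pos_def \<Sigma>"
  shows "quad (matrix_inv \<Sigma>) (a_vec 0) (recon \<Sigma> s t) = t \<bullet> t"
  using T_stat_inner[OF \<Sigma>, of "unvec (recon \<Sigma> s t)"] by (simp add: T_stat_recon[OF \<Sigma>])

text \<open>The subtracted term \<open>quad W (a_vec 0)\<close> is the constant
  \<open>t \<bullet> t\<close> here, so the exponent is strictly convex and \<open>exp\<close>
  preserves this.\<close>

lemma il_kernel_recon_strictly_convex:
  assumes \<Sigma>: "pos_def \<Sigma>" and xy: "x \<noteq> y" and r: "0 < r" "r < 1"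
  shows "il_kernel (matrix_inv \<Sigma>) (recon \<Sigma> (r *\<^sub>R x + (1 - r) *\<^sub>R y) t) (b_vec u) <
    r * il_kernel (matrix_inv \<Sigma>) (recon \<Sigma> x t) (b_vec u) + (1 - r) * il_kernel (matrix_inv \<Sigma>) (recon \<Sigma> y t) (b_vec u)"
proof -
  let ?W = "matrix_inv \<Sigma>"
  define e where "e s = (quad ?W (b_vec u) (recon \<Sigma> s t) - t \<bullet> t) / 2" for s
  define d where "d = det (info ?W (b_vec u)) powr (- 1 / 2)"
  have d: "0 < d"
    unfolding d_def using pos_def_det[OF pos_def_info[OF pos_def_matrix_inv[OF \<Sigma>] b_vec_nz[of u]]] by simp
  have k: "il_kernel ?W (recon \<Sigma> s t) (b_vec u) = exp (e s) * d" for s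
    by (simp add: il_kernel_def quad_a_recon[OF \<Sigma>] e_def d_def)
  have "e (r *\<^sub>R x + (1 - r) *\<^sub>R y) < r * e x + (1 - r) * e y"
    using quad_recon_strictly_convex[OF assms, of u t] by (simp add: e_def field_simps)
  then have "exp (e (r *\<^sub>R x + (1 - r) *\<^sub>R y)) < exp (r * e x + (1 - r) * e y)" by simp
  also have "\<dots> \<le> r * exp (e x) + (1 - r) * exp (e y)"
    using convex_onD[OF exp_convex, of "1 - r" "e x" "e y"] r by simp
  finally have "exp (e (r *\<^sub>R x + (1 - r) *\<^sub>R y)) * d < (r * exp (e x) + (1 - r) * exp (e y)) * d"
    using d by simp
  then show ?thesis by (simp add: k algebra_simps)
qed

text \<open>Strictness survives integration since the gap \<open>?g\<close> is positive at every
  \<open>u\<close>.\<close>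

lemma il_integral_recon_strictly_convex:
  fixes \<Sigma> :: "real^(2 \<times> 'k::finite)^(2 \<times> 'k)"
  assumes k: "2 \<le> CARD('k)" and \<Sigma>: "pos_def \<Sigma>" and xy: "x \<noteq> y" and r: "0 < r" "r < 1"
  shows "il_integral (matrix_inv \<Sigma>) (recon \<Sigma> (r *\<^sub>R x + (1 - r) *\<^sub>R y) t) <
    r * il_integral (matrix_inv \<Sigma>) (recon \<Sigma> x t) + (1 - r) * il_integral (matrix_inv \<Sigma>) (recon \<Sigma> y t)"
proof -
  let ?f = "\<lambda>s u. il_kernel (matrix_inv \<Sigma>) (recon \<Sigma> s t) (b_vec u)"
  let ?z = "r *\<^sub>R x + (1 - r) *\<^sub>R y"
  let ?g = "\<lambda>u. r * ?f x u + (1 - r) * ?f y u - ?f ?z u"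
  have int: "integrable lborel (?f s)" for s
    by (rule integrable_il_kernel[OF k pos_def_matrix_inv[OF \<Sigma>]])
  have g: "0 < ?g u" for u
    using il_kernel_recon_strictly_convex[OF \<Sigma> xy r, of t u] by simp
  have ig: "integrable lborel ?g"
    by (intro Bochner_Integration.integrable_diff Bochner_Integration.integrable_add
        integrable_mult_right int)
  have "(\<integral>u. ?g u \<partial>lborel) \<noteq> 0"
  proof
    assume "(\<integral>u. ?g u \<partial>lborel) = 0"
    then have "AE u in lborel. ?g u = 0"
      using integral_nonneg_eq_0_iff_AE[OF ig] g by (simp add: less_imp_le)
    then have "AE u::real in lborel. False"
      by eventually_elim (use g in \<open>simp add: less_le\<close>)
    then show False by (simp add: AE_iff_measurable[of UNIV])
  qed
  moreover have "0 \<le> (\<integral>u. ?g u \<partial>lborel)"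
    using g by (intro integral_nonneg_AE AE_I2 less_imp_le)
  moreover have "(\<integral>u. ?g u \<partial>lborel) = r * (\<integral>u. ?f x u \<partial>lborel) + (1 - r) * (\<integral>u. ?f y u \<partial>lborel) - (\<integral>u. ?f ?z u \<partial>lborel)"
    by (subst Bochner_Integration.integral_diff, intro Bochner_Integration.integrable_add integrable_mult_right int,
        rule int, subst Bochner_Integration.integral_add, (intro integrable_mult_right int)+)
      (simp only: Bochner_Integration.integral_mult_right_zero)
  ultimately show ?thesis by (simp add: il_integral_def)
qed

lemma continuous_on_recon [continuous_intros]:
  fixes f g :: "'a::topological_space \<Rightarrow> real^'k::finite"
  assumes "continuous_on S f" "continuous_on S g"
  shows "continuous_on S (\<lambda>z. recon \<Sigma> (f z) (g z))"
  unfolding recon_def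
  by (intro continuous_intros continuous_on_linear[OF kron_vec_linear] assms)

context
  fixes \<Sigma> :: "real^(2 \<times> 'k::finite)^(2 \<times> 'k)" and \<alpha> :: real
  assumes k: "2 \<le> CARD('k)" and \<Sigma>: "pos_def \<Sigma>" and \<alpha>: "0 < \<alpha>" "\<alpha> < 1"
begin

lemma IL_data_of: "IL (data_of \<Sigma> s t) \<Sigma> = il_integral (matrix_inv \<Sigma>) (recon \<Sigma> s t)"
  by (simp add: IL_eq_il_integral[OF k \<Sigma>] data_of_eq[OF \<Sigma>])

lemma continuous_IL_data_of:
  "continuous_on S f \<Longrightarrow> continuous_on S g \<Longrightarrow> continuous_on S (\<lambda>z. IL (data_of \<Sigma> (f z) (g z)) \<Sigma>)"
  unfolding IL_data_of
  by (rule continuous_on_compose2[OF continuous_il_integral[OF k pos_def_matrix_inv[OF \<Sigma>]]])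
    (auto intro!: continuous_intros)

lemma AE_IL_neq: "AE s in lborel. IL (data_of \<Sigma> s t) \<Sigma> \<noteq> x"
proof -
  have "negligible {s. IL (data_of \<Sigma> s t) \<Sigma> = x}"
    unfolding IL_data_of
    by (intro negligible_level_set_strictly_convex il_integral_recon_strictly_convex k \<Sigma>)
  \<comment> \<open>\<open>negligible\<close> refers to the completed measure; closedness makes the
    level set Borel, hence null for \<open>lborel\<close>.\<close>
  moreover have "closed {s. IL (data_of \<Sigma> s t) \<Sigma> = x}"
    by (intro closed_Collect_eq continuous_IL_data_of continuous_intros)
  ultimately have "{s. IL (data_of \<Sigma> s t) \<Sigma> = x} \<in> null_sets lborel"
    by (auto simp: negligible_iff_null_sets null_sets_completion_iff)
  then show ?thesis by (rule AE_I'[where P="\<lambda>s. _ s \<noteq> x"]) auto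
qed

text \<open>\<open>X\<close> is left general to cover both uses: \<open>IL\<close> itself along
  converging \<open>t\<close>, and rescaled WAP statistics for fixed \<open>t\<close>.\<close>

lemma critical_value_IL_tendsto:
  assumes [measurable]: "\<And>n. X n \<in> borel_measurable borel"
    and "\<And>s. (\<lambda>n. X n s) \<longlonglongrightarrow> IL (data_of \<Sigma> s t) \<Sigma>"
  shows "(\<lambda>n. quantile (1 - \<alpha>) null_S (X n)) \<longlonglongrightarrow> critical_value \<alpha> IL t \<Sigma>"
  unfolding critical_value_def
proof (rule quantile_tendsto)
  have c: "continuous_on UNIV (\<lambda>s. IL (data_of \<Sigma> s t) \<Sigma>)"
    by (intro continuous_IL_data_of continuous_intros)
  show "(\<lambda>s. IL (data_of \<Sigma> s t) \<Sigma>) \<in> borel_measurable null_S"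
    using borel_measurable_continuous_onI[OF c] by simp
  show "AE s in null_S. IL (data_of \<Sigma> s t) \<Sigma> \<noteq> x" for x
    unfolding AE_null_S_iff by (rule AE_IL_neq)
  show "1 - \<alpha> < measure null_S {s \<in> space null_S. IL (data_of \<Sigma> s t) \<Sigma> \<le> x}"
    if "quantile (1 - \<alpha>) null_S (\<lambda>s. IL (data_of \<Sigma> s t) \<Sigma>) < x" for x
    using c _ _ that by (rule quantile_null_S_less) (use \<alpha> in auto)
qed (use assms \<alpha> in \<open>auto simp: prob_space_null_S\<close>)

lemma continuous_critical_value_IL: "continuous_on UNIV (\<lambda>t. critical_value \<alpha> IL t \<Sigma>)"
proof (rule continuous_on_sequentiallyI)
  fix x and t :: "real^'k" assume x: "x \<longlonglongrightarrow> t"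
  show "(\<lambda>n. critical_value \<alpha> IL (x n) \<Sigma>) \<longlonglongrightarrow> critical_value \<alpha> IL t \<Sigma>"
    unfolding critical_value_def[of _ _ "x _"]
  proof (rule critical_value_IL_tendsto)
    show "(\<lambda>s. IL (data_of \<Sigma> s (x n)) \<Sigma>) \<in> borel_measurable borel" for n
      by (intro borel_measurable_continuous_onI continuous_IL_data_of continuous_intros)
    show "(\<lambda>n. IL (data_of \<Sigma> s (x n)) \<Sigma>) \<longlonglongrightarrow> IL (data_of \<Sigma> s t) \<Sigma>" for s
      using continuous_on_tendsto_compose[OF continuous_IL_data_of[of UNIV "\<lambda>_. s" "\<lambda>t. t"] x]
      by (auto intro: continuous_intros)
  qed
qed

lemma AE_IL_neq_critical_value: "AE R in lborel. IL R \<Sigma> \<noteq> critical_value \<alpha> IL (T_stat \<Sigma> R) \<Sigma>"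
proof -
  \<comment> \<open>Pairs are ordered (t, s), so that the sections \<open>Pair t\<close> hold
    \<open>t\<close>, and with it the critical value, fixed.\<close>
  let ?N = "{z. IL (data_of \<Sigma> (snd z) (fst z)) \<Sigma> = critical_value \<alpha> IL (fst z) \<Sigma>}"
  have cl: "closed ?N"
    by (intro closed_Collect_eq continuous_IL_data_of continuous_intros
        continuous_on_compose2[OF continuous_critical_value_IL]) auto
  then have m: "?N \<in> sets (lborel \<Otimes>\<^sub>M lborel)"
    by (simp only: lborel_prod) (simp add: borel_closed)
  have "emeasure lborel (Pair t -` ?N) = 0" for t
  proof -
    have "AE s in lborel. s \<notin> Pair t -` ?N"
      using AE_IL_neq[of t "critical_value \<alpha> IL t \<Sigma>"] by simp
    moreover have "Pair t -` ?N \<in> sets lborel"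
      using sets_Pair1[OF m] by simp
    ultimately show ?thesis
      by (simp add: AE_iff_null_sets null_setsD1)
  qed
  then have "emeasure (lborel \<Otimes>\<^sub>M lborel) ?N = 0"
    by (subst lborel.emeasure_pair_measure_alt[OF m]) simp
  then have "?N \<in> null_sets lborel"
    using cl by (simp add: null_sets_def lborel_prod borel_closed)
  then have "negligible ?N"
    by (simp add: negligible_iff_null_sets null_sets_completionI)
  then have "negligible ((\<lambda>z. data_of \<Sigma> (snd z) (fst z)) ` ?N)"
  \<comment> \<open>The null set is carried to the data by the linear map \<open>data_of\<close>;
    the rotated premise, that the dimension does not drop from source to target, holds with equality
    2k.\<close>
  proof (rule negligible_differentiable_image_negligible[rotated])
    have lin: "linear (\<lambda>z. data_of \<Sigma> (snd z) (fst z))"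
    proof (rule linearI)
      show "data_of \<Sigma> (snd (z + z')) (fst (z + z')) = data_of \<Sigma> (snd z) (fst z) + data_of \<Sigma> (snd z') (fst z')" for z z'
        by (simp add: data_of_eq[OF \<Sigma>] recon_def matrix_vector_right_distrib linear_add[OF kron_vec_linear]
            linear_add[OF linear_unvec])
      show "data_of \<Sigma> (snd (c *\<^sub>R z)) (fst (c *\<^sub>R z)) = c *\<^sub>R data_of \<Sigma> (snd z) (fst z)" for c z
        by (simp add: data_of_eq[OF \<Sigma>] recon_def matrix_vector_right_distrib linear_scale[OF kron_vec_linear]
            linear_add[OF linear_unvec] linear_scale[OF linear_unvec] linear_scale[OF matrix_vector_mul_linear] scaleR_right_distrib)
    qed
    then show "(\<lambda>z. data_of \<Sigma> (snd z) (fst z)) differentiable_on ?N"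
      by (rule linear_imp_differentiable_on)
  qed simp
  moreover have "{R. IL R \<Sigma> = critical_value \<alpha> IL (T_stat \<Sigma> R) \<Sigma>} \<subseteq> (\<lambda>z. data_of \<Sigma> (snd z) (fst z)) ` ?N"
    by (auto intro!: image_eqI[of _ _ "(T_stat \<Sigma> R, S_stat \<Sigma> R)" for R] simp: data_of_stats[OF \<Sigma>])
  ultimately have n: "negligible {R. IL R \<Sigma> = critical_value \<alpha> IL (T_stat \<Sigma> R) \<Sigma>}"
    by (rule negligible_subset)
  have "continuous_on UNIV (T_stat \<Sigma>)"
    unfolding T_stat_eq
    by (intro continuous_intros continuous_on_linear[OF score_linear] continuous_on_linear[OF linear_vec_mat])
  moreover have "continuous_on UNIV (\<lambda>R. IL R \<Sigma>)"
    unfolding IL_eq_il_integral[OF k \<Sigma>]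
    by (rule continuous_on_compose2[OF continuous_il_integral[OF k pos_def_matrix_inv[OF \<Sigma>]]])
      (auto intro!: continuous_on_linear[OF linear_vec_mat] continuous_intros)
  ultimately have "closed {R. IL R \<Sigma> = critical_value \<alpha> IL (T_stat \<Sigma> R) \<Sigma>}"
    by (intro closed_Collect_eq continuous_on_compose2[OF continuous_critical_value_IL]) auto
  with n have "{R. IL R \<Sigma> = critical_value \<alpha> IL (T_stat \<Sigma> R) \<Sigma>} \<in> null_sets lborel"
    by (auto simp: negligible_iff_null_sets null_sets_completion_iff)
  then show ?thesis by (rule AE_I') auto
qed

end

section \<open>Invariance\<close>

lemma invertible_scaleR: "invertible A \<Longrightarrow> c \<noteq> 0 \<Longrightarrow> invertible (c *\<^sub>R A)" for A :: "real^'n^'n"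
  by (simp add: invertible_det_nz det_scaleR)

lemma quantile_distr:
  assumes T: "T \<in> M \<rightarrow>\<^sub>M N" and X: "X \<in> borel_measurable N"
  shows "quantile p (distr M N T) X = quantile p M (\<lambda>\<omega>. X (T \<omega>))"
proof -
  have "measure (distr M N T) {\<omega> \<in> space (distr M N T). X \<omega> \<le> x} = measure M {\<omega> \<in> space M. X (T \<omega>) \<le> x}" for x
  proof -
    have "{\<omega> \<in> space N. X \<omega> \<le> x} \<in> sets N" using X by measurable
    moreover have "T -` {\<omega> \<in> space N. X \<omega> \<le> x} \<inter> space M = {\<omega> \<in> space M. X (T \<omega>) \<le> x}"
      using measurable_space[OF T] by auto
    ultimately show ?thesis by (simp add: measure_distr[OF T])
  qed
  then show ?thesis by (simp add: quantile_def)
qed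

abbreviation transformed_var :: "real^'k^'k \<Rightarrow> real^2^2 \<Rightarrow> real^(2 \<times> 'k::finite)^(2 \<times> 'k) \<Rightarrow> _" where
  "transformed_var g1 g2 \<Sigma> \<equiv> kron g2 g1 ** \<Sigma> ** kron (transpose g2) (transpose g1)"

context
  fixes \<Sigma> :: "real^(2 \<times> 'k::finite)^(2 \<times> 'k)" and g1 :: "real^'k^'k" and g2 :: "real^2^2"
  assumes \<Sigma>: "pos_def \<Sigma>" and g1: "invertible g1" and g2: "invertible g2" and g12: "g2 $ 1 $ 2 = 0"
begin

lemma diagonal_nz: "g2 $ 1 $ 1 \<noteq> 0" "g2 $ 2 $ 2 \<noteq> 0"
  using g2 g12 by (auto simp: invertible_det_nz det_2)

text \<open>Triangularity enters here: \<open>g2\<close> preserves the line of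
  \<open>a_vec 0\<close>, which is the null hypothesis, its transpose preserves that of
  \<open>b_vec 0\<close>, and on the chart it acts by an affine map.\<close>

lemma g2_mult: "g2 *v a_vec 0 = g2 $ 2 $ 2 *\<^sub>R a_vec 0" "transpose g2 *v b_vec 0 = g2 $ 1 $ 1 *\<^sub>R b_vec 0"
    "g2 *v b_vec u = g2 $ 1 $ 1 *\<^sub>R b_vec (g2 $ 2 $ 1 / g2 $ 1 $ 1 + g2 $ 2 $ 2 / g2 $ 1 $ 1 * u)"
  using g12 diagonal_nz
  by (simp_all add: matrix_vector_mult_def transpose_def a_vec_def b_vec_def vec_eq_iff forall_2 sum_2 vector_2
      distrib_left del: transpose_matrix_vector)

lemma invertible_K: "invertible (kron g2 g1)"
  by (rule invertible_kron[OF g2 g1])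

lemma pos_def_transformed: "pos_def (transformed_var g1 g2 \<Sigma>)"
proof -
  have "pos_def (transpose (transpose (kron g2 g1)) ** \<Sigma> ** transpose (kron g2 g1))"
  proof (rule pos_def_congruence[OF \<Sigma>])
    fix x assume "transpose (kron g2 g1) *v x = 0"
    then have "transpose (matrix_inv (kron g2 g1)) *v (transpose (kron g2 g1) *v x) = 0" by simp
    then show "x = 0"
      by (simp add: matrix_vector_mul_assoc matrix_transpose_mul[symmetric] matrix_inv_right[OF invertible_K] transpose_mat
          del: transpose_matrix_vector)
  qed
  then show ?thesis by (simp add: transpose_transpose transpose_kron)
qed

lemma inverse_transformed: "transpose (kron g2 g1) ** matrix_inv (transformed_var g1 g2 \<Sigma>) ** kron g2 g1 = matrix_inv \<Sigma>"
proof -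
  let ?h = "matrix_inv (kron g2 g1)"
  have h: "kron g2 g1 ** ?h = mat 1" "?h ** kron g2 g1 = mat 1"
    by (simp_all add: matrix_inv_left matrix_inv_right invertible_K)
  have h': "transpose ?h ** transpose (kron g2 g1) = mat 1" "transpose (kron g2 g1) ** transpose ?h = mat 1"
    by (simp_all add: matrix_transpose_mul[symmetric] h transpose_mat)
  have "matrix_inv (transformed_var g1 g2 \<Sigma>) = transpose ?h ** matrix_inv \<Sigma> ** ?h"
  proof (rule matrix_inv_eqI)
    have "(transformed_var g1 g2 \<Sigma>) ** (transpose ?h ** matrix_inv \<Sigma> ** ?h) =
        kron g2 g1 ** (\<Sigma> ** ((transpose (kron g2 g1) ** transpose ?h) ** matrix_inv \<Sigma>)) ** ?h"
      by (simp only: transpose_kron matrix_mul_assoc)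
    then show "(transformed_var g1 g2 \<Sigma>) ** (transpose ?h ** matrix_inv \<Sigma> ** ?h) = mat 1"
      by (simp add: h h' matrix_inv_right pos_def_invertible[OF \<Sigma>])
  qed
  then have "transpose (kron g2 g1) ** matrix_inv (transformed_var g1 g2 \<Sigma>) ** kron g2 g1 = (transpose (kron g2 g1) ** transpose ?h) ** matrix_inv \<Sigma> ** (?h ** kron g2 g1)"
    by (simp only: matrix_mul_assoc)
  then show ?thesis by (simp add: h h')
qed

lemmas W_transforms =
  info_transform[OF inverse_transformed g1] score_transform[OF inverse_transformed g1]
  quad_transform[OF inverse_transformed g1 pos_def_matrix_inv[OF \<Sigma>]]

text \<open>The factor collects the slope of the affine substitution in \<open>u\<close>, the
  homogeneity of the kernel in the scalar \<open>1 / g2 $ 1 $ 1\<close>, and the determinant of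
  \<open>g1\<close> from the transformed information.\<close>

lemma il_integral_transform:
  obtains c where "0 < c" "\<And>v. il_integral (matrix_inv (transformed_var g1 g2 \<Sigma>)) (kron g2 g1 *v v) = c * il_integral (matrix_inv \<Sigma>) v"
proof
  let ?W = "matrix_inv \<Sigma>" and ?W' = "matrix_inv (transformed_var g1 g2 \<Sigma>)"
  have W: "pos_def ?W" and W': "pos_def ?W'"
    by (simp_all add: pos_def_matrix_inv \<Sigma> pos_def_transformed)
  define d where "d = det (matrix_inv g1)"
  have d: "d \<noteq> 0"
    using arg_cong[OF matrix_inv_left[OF g1], of det] by (auto simp: d_def det_mul)
  define c where "c = \<bar>1 / g2 $ 1 $ 1\<bar> powr (- real CARD('k)) * (1 / \<bar>d\<bar>)"
  show "0 < \<bar>g2 $ 2 $ 2 / g2 $ 1 $ 1\<bar> * c" using d diagonal_nz by (simp add: c_def)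
  fix v
  have q0: "quad ?W' (a_vec 0) (kron g2 g1 *v v) = quad ?W (a_vec 0) v"
    using W_transforms(3)[of "a_vec 0" v] quad_scaleR[OF W' a_vec_nz diagonal_nz(2), of 0 "kron g2 g1 *v v"]
    by (simp add: g2_mult)
  have k1: "il_kernel ?W' (kron g2 g1 *v v) (g2 *v b_vec u) = 1 / \<bar>d\<bar> * il_kernel ?W v (b_vec u)" for u
  proof -
    have "0 < det (info ?W (b_vec u))" by (intro pos_def_det pos_def_info W b_vec_nz)
    moreover have "det (info ?W' (g2 *v b_vec u)) = d\<^sup>2 * det (info ?W (b_vec u))"
      by (simp add: W_transforms(1) det_mul det_transpose d_def power2_eq_square)
    moreover have "d\<^sup>2 powr (- 1 / 2) = 1 / \<bar>d\<bar>"
      using d by (simp add: powr_minus_divide powr_half_sqrt)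
    ultimately have "det (info ?W' (g2 *v b_vec u)) powr (- 1 / 2) = 1 / \<bar>d\<bar> * det (info ?W (b_vec u)) powr (- 1 / 2)"
      by (simp only: powr_mult)
    then show ?thesis
      by (simp only: il_kernel_def q0 W_transforms(3)[OF b_vec_nz] mult_ac)
  qed
  have k2: "il_kernel ?W' (kron g2 g1 *v v) (b_vec (g2 $ 2 $ 1 / g2 $ 1 $ 1 + g2 $ 2 $ 2 / g2 $ 1 $ 1 * u)) = c * il_kernel ?W v (b_vec u)" for u
  proof -
    have "b_vec (g2 $ 2 $ 1 / g2 $ 1 $ 1 + g2 $ 2 $ 2 / g2 $ 1 $ 1 * u) = (1 / g2 $ 1 $ 1) *\<^sub>R (g2 *v b_vec u)"
      using diagonal_nz by (simp add: g2_mult)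
    moreover have "g2 *v b_vec u \<noteq> 0"
      using diagonal_nz by (simp add: g2_mult)
    ultimately show ?thesis
      using diagonal_nz by (simp only: il_kernel_scaleR[OF W'] k1 c_def mult.assoc divide_eq_0_iff zero_neq_one simp_thms)
  qed
  have "il_integral ?W' (kron g2 g1 *v v) = \<bar>g2 $ 2 $ 2 / g2 $ 1 $ 1\<bar> * (\<integral>u. il_kernel ?W' (kron g2 g1 *v v) (b_vec (g2 $ 2 $ 1 / g2 $ 1 $ 1 + g2 $ 2 $ 2 / g2 $ 1 $ 1 * u)) \<partial>lborel)"
    unfolding il_integral_def
    using lborel_integral_real_affine[of "g2 $ 2 $ 2 / g2 $ 1 $ 1" "\<lambda>u. il_kernel ?W' (kron g2 g1 *v v) (b_vec u)" "g2 $ 2 $ 1 / g2 $ 1 $ 1"] diagonal_nz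
    by simp
  then show "il_integral ?W' (kron g2 g1 *v v) = \<bar>g2 $ 2 $ 2 / g2 $ 1 $ 1\<bar> * c * il_integral ?W v"
    by (simp only: k2 il_integral_def Bochner_Integration.integral_mult_right_zero mult.assoc)
qed

text \<open>As \<open>g2 $ 1 $ 2 = 0\<close>, the new first column is \<open>?C\<close> times the
  old one, and its variance changes by congruence with \<open>?C\<close>.\<close>

lemma S_stat_transform:
  obtains Q where "orthogonal_matrix Q"
    "\<And>R. S_stat (transformed_var g1 g2 \<Sigma>) (g1 ** R ** transpose g2) = Q *v S_stat \<Sigma> R"
proof -
  let ?C = "g2 $ 1 $ 1 *\<^sub>R g1"
  have e: "transpose (kron g2 g1) ** emb (b_vec 0) = emb (b_vec 0) ** transpose ?C"
    by (simp add: transpose_kron kron_emb g2_mult emb_scaleR transpose_scaleR scaleR_matrix_mul matrix_mul_scaleR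
        del: transpose_matrix_vector)
  have e': "transpose (emb (b_vec 0)) ** kron g2 g1 = ?C ** transpose (emb (b_vec 0))"
    using arg_cong[OF e, of transpose] by (simp only: matrix_transpose_mul transpose_transpose)
  have i: "info (transformed_var g1 g2 \<Sigma>) (b_vec 0) = ?C ** info \<Sigma> (b_vec 0) ** transpose ?C"
  proof -
    have "info (transformed_var g1 g2 \<Sigma>) (b_vec 0) = (transpose (emb (b_vec 0)) ** kron g2 g1) ** \<Sigma> ** (transpose (kron g2 g1) ** emb (b_vec 0))"
      by (simp only: info_def transpose_kron matrix_mul_assoc)
    then show ?thesis by (simp only: e e' info_def matrix_mul_assoc)
  qed
  obtain Q where Q: "orthogonal_matrix Q"
      "inv_sqrt_mat (?C ** info \<Sigma> (b_vec 0) ** transpose ?C) ** ?C = Q ** inv_sqrt_mat (info \<Sigma> (b_vec 0))"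
    using inv_sqrt_mat_congruence[OF pos_def_info[OF \<Sigma> b_vec_nz] invertible_scaleR[OF g1 diagonal_nz(1)]] by blast
  have "S_stat (transformed_var g1 g2 \<Sigma>) (g1 ** R ** transpose g2) = Q *v S_stat \<Sigma> R" for R
    by (simp only: S_stat_eq vec_mat_transform i matrix_vector_mul_assoc e' matrix_mul_assoc Q(2))
  with Q(1) show ?thesis by (rule that)
qed

text \<open>The same congruence argument for the score at \<open>a_vec 0\<close>, whose line
  \<open>g2\<close> preserves; scores transform by the inverse transpose of
  \<open>g1\<close>.\<close>

lemma T_stat_transform:
  obtains P where "orthogonal_matrix P"
    "\<And>R. T_stat (transformed_var g1 g2 \<Sigma>) (g1 ** R ** transpose g2) = P *v T_stat \<Sigma> R"
proof -
  let ?W = "matrix_inv \<Sigma>" and ?W' = "matrix_inv (transformed_var g1 g2 \<Sigma>)"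
  let ?C = "(1 / g2 $ 2 $ 2) *\<^sub>R transpose (matrix_inv g1)"
  have C: "invertible ?C"
  proof (rule invertible_scaleR)
    have "transpose (matrix_inv g1) ** transpose g1 = mat 1" "transpose g1 ** transpose (matrix_inv g1) = mat 1"
      by (simp_all add: matrix_transpose_mul[symmetric] matrix_inv_right[OF g1] matrix_inv_left[OF g1] transpose_mat)
    then show "invertible (transpose (matrix_inv g1))" unfolding invertible_def by blast
  qed (use diagonal_nz in simp)
  have a: "a_vec 0 = (1 / g2 $ 2 $ 2) *\<^sub>R (g2 *v a_vec 0)"
    using diagonal_nz by (simp add: g2_mult)
  have i: "info ?W' (a_vec 0) = ?C ** info ?W (a_vec 0) ** transpose ?C"
    by (subst a) (simp add: info_scaleR W_transforms(1) transpose_scaleR transpose_transpose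
        scaleR_matrix_mul matrix_mul_scaleR power2_eq_square)
  have s: "score ?W' (a_vec 0) (kron g2 g1 *v v) = ?C *v score ?W (a_vec 0) v" for v
    by (subst a) (simp add: score_scaleR W_transforms(2) scaleR_matrix_vector_assoc[symmetric] del: transpose_matrix_vector)
  obtain P where P: "orthogonal_matrix P"
      "inv_sqrt_mat (?C ** info ?W (a_vec 0) ** transpose ?C) ** ?C = P ** inv_sqrt_mat (info ?W (a_vec 0))"
    using inv_sqrt_mat_congruence[OF pos_def_info[OF pos_def_matrix_inv[OF \<Sigma>] a_vec_nz] C] by blast
  have "T_stat (transformed_var g1 g2 \<Sigma>) (g1 ** R ** transpose g2) = P *v T_stat \<Sigma> R" for R
    by (simp only: T_stat_eq vec_mat_transform i s matrix_vector_mul_assoc P(2))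
  with P(1) show ?thesis by (rule that)
qed

lemma conditional_test_IL_transform:
  assumes k: "2 \<le> CARD('k)" and \<alpha>: "0 < \<alpha>" "\<alpha> < 1"
  shows "conditional_test \<alpha> IL (g1 ** R ** transpose g2) (transformed_var g1 g2 \<Sigma>) = conditional_test \<alpha> IL R \<Sigma>"
proof -
  note \<Sigma>' = pos_def_transformed
  let ?g = "\<lambda>R. g1 ** R ** transpose g2"
  obtain c where c: "0 < c" "\<And>v. il_integral (matrix_inv (transformed_var g1 g2 \<Sigma>)) (kron g2 g1 *v v) = c * il_integral (matrix_inv \<Sigma>) v"
    using il_integral_transform by blast
  have IL: "IL (?g R) (transformed_var g1 g2 \<Sigma>) = c * IL R \<Sigma>" for R
    by (simp only: IL_eq_il_integral[OF k \<Sigma>] IL_eq_il_integral[OF k \<Sigma>'] vec_mat_transform c(2))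
  obtain Q where Q: "orthogonal_matrix Q" "\<And>R. S_stat (transformed_var g1 g2 \<Sigma>) (?g R) = Q *v S_stat \<Sigma> R"
    using S_stat_transform by blast
  obtain P where P: "orthogonal_matrix P" "\<And>R. T_stat (transformed_var g1 g2 \<Sigma>) (?g R) = P *v T_stat \<Sigma> R"
    using T_stat_transform by blast
  have data: "data_of (transformed_var g1 g2 \<Sigma>) (Q *v s) (P *v t) = ?g (data_of \<Sigma> s t)" for s t
  proof -
    have "data_of (transformed_var g1 g2 \<Sigma>) (S_stat (transformed_var g1 g2 \<Sigma>) (?g (data_of \<Sigma> s t))) (T_stat (transformed_var g1 g2 \<Sigma>) (?g (data_of \<Sigma> s t))) = ?g (data_of \<Sigma> s t)"
      by (rule data_of_stats[OF \<Sigma>'])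
    then show ?thesis
      by (simp only: Q(2) P(2) S_stat_data_of[OF \<Sigma>] T_stat_data_of[OF \<Sigma>])
  qed
  have "critical_value \<alpha> IL (P *v t) (transformed_var g1 g2 \<Sigma>) = c * critical_value \<alpha> IL t \<Sigma>" for t
  proof -
    let ?X = "\<lambda>s. IL (data_of (transformed_var g1 g2 \<Sigma>) s (P *v t)) (transformed_var g1 g2 \<Sigma>)"
    have X: "?X \<in> borel_measurable borel"
      by (intro borel_measurable_continuous_onI continuous_IL_data_of[OF k \<Sigma>' \<alpha>] continuous_intros)
    have Y: "(\<lambda>s. IL (data_of \<Sigma> s t) \<Sigma>) \<in> borel_measurable null_S"
      using borel_measurable_continuous_onI[OF continuous_IL_data_of[OF k \<Sigma> \<alpha>, of UNIV "\<lambda>s. s" "\<lambda>_. t"]]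
      by (simp add: continuous_on_id)
    have Qm: "(*v) Q \<in> null_S \<rightarrow>\<^sub>M borel"
      using borel_measurable_linear[of "(*v) Q"] by simp
    \<comment> \<open>Replacing \<open>null_S\<close> by its image under \<open>Q\<close> puts
      \<open>Q *v s\<close> in place of \<open>s\<close>, so that the argument becomes the
      transformed data of \<open>(s, t)\<close>.\<close>
    have "critical_value \<alpha> IL (P *v t) (transformed_var g1 g2 \<Sigma>) = quantile (1 - \<alpha>) (distr null_S borel ((*v) Q)) ?X"
      unfolding critical_value_def distr_null_S_orthogonal[OF Q(1)] ..
    also have "\<dots> = quantile (1 - \<alpha>) null_S (\<lambda>s. c * IL (data_of \<Sigma> s t) \<Sigma>)"
      unfolding quantile_distr[OF Qm X] by (simp only: data IL)
    also have "\<dots> = c * critical_value \<alpha> IL t \<Sigma>"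
      unfolding critical_value_def
      by (rule quantile_scale[OF prob_space_null_S Y]) (use \<alpha> c in auto)
    finally show ?thesis .
  qed
  then show ?thesis
    unfolding conditional_test_def IL P(2) using c(1) by simp
qed

end

section \<open>Weighted average power\<close>

lemma kron_vec_a_vec: "kron_vec (a_vec D) x = D *\<^sub>R kron_vec (b_vec 0) x + kron_vec (a_vec 0) x"
proof -
  have "a_vec D = D *\<^sub>R b_vec 0 + a_vec 0"
    by (simp add: a_vec_def b_vec_def vec_eq_iff forall_2 vector_2)
  then show ?thesis by (simp add: kron_vec_def vec_eq_iff algebra_simps)
qed

lemma kron_vec_inverse: "u \<noteq> 0 \<Longrightarrow> kron_vec (a_vec (1 / u)) (u *\<^sub>R x) = kron_vec (b_vec u) x"
  by (simp add: kron_vec_a_vec[of "1 / u"] kron_vec_b_vec[of u] linear_scale[OF kron_vec_linear] scaleR_right_distrib)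

lemma continuous_on_kron_vec_a_vec [continuous_intros]:
  fixes g :: "'a::topological_space \<Rightarrow> real^'k"
  assumes "continuous_on S f" "continuous_on S g"
  shows "continuous_on S (\<lambda>z. kron_vec (a_vec (f z)) (g z))"
proof -
  have "(\<lambda>z. kron_vec (a_vec (f z)) (g z)) =
      (\<lambda>z. f z *\<^sub>R kron_vec (b_vec 0) (g z) + kron_vec (a_vec 0) (g z))"
    by (rule ext) (rule kron_vec_a_vec)
  then show ?thesis
    by (simp only:) (intro continuous_intros assms continuous_on_linear[OF kron_vec_linear])
qed

text \<open>As \<open>a_vec (1 / u) \<otimes> u \<mu> = b_vec u \<otimes> \<mu>\<close>, the uniform distribution of \<open>(u, \<mu>)\<close> on a ball has likelihood
  ratios that approach \<open>IL\<close> up to a factor that depends only on \<open>n\<close> and \<open>\<Sigma>\<close>. The junk value \<open>1 / 0 = 0\<close>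
  concerns a null set of \<open>u\<close>.\<close>

definition reciprocal_param :: "real \<times> (real^'k) \<Rightarrow> real \<times> (real^'k)" where
  "reciprocal_param z = (1 / fst z, fst z *\<^sub>R snd z)"

definition wap_weight :: "nat \<Rightarrow> (real \<times> (real^('k::finite))) measure" where
  "wap_weight n = distr (uniform_measure lborel (cball 0 (real (Suc n)))) borel reciprocal_param"

definition likelihood :: "real^(2 \<times> 'k)^(2 \<times> 'k) \<Rightarrow> real^(2 \<times> 'k) \<Rightarrow> real \<times> (real^('k::finite)) \<Rightarrow> real" where
  "likelihood W v z = exp (- ((v - kron_vec (b_vec (fst z)) (snd z)) \<bullet> (W *v (v - kron_vec (b_vec (fst z)) (snd z)))) / 2)"

lemma measurable_reciprocal_param [measurable]: "reciprocal_param \<in> borel \<rightarrow>\<^sub>M borel"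
  unfolding reciprocal_param_def borel_prod[symmetric] by measurable

lemma weight_wap_weight: "weight (wap_weight n :: (real \<times> (real^'k::finite)) measure)"
proof -
  let ?B = "cball 0 (real (Suc n)) :: (real \<times> (real^'k)) set"
  have "0 < emeasure lborel ?B"
    using content_cball_pos[of "real (Suc n)" "0 :: real \<times> (real^'k)"] by (simp add: measure_def enn2real_positive_iff)
  then have "prob_space (uniform_measure lborel ?B)"
    by (intro prob_space_uniform_measure) (use emeasure_lborel_cball_finite[of "0 :: real \<times> (real^'k)" "real (Suc n)"] in auto)
  then have "prob_space (wap_weight n :: (real \<times> (real^'k)) measure)"
    unfolding wap_weight_def by (rule prob_space.prob_space_distr) simp
  then show ?thesis by (simp add: weight_def wap_weight_def)
qed

lemma f_R_reciprocal_param: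
  fixes \<Sigma> :: "real^(2 \<times> 'k::finite)^(2 \<times> 'k)"
  assumes "fst z \<noteq> 0"
  shows "f_R R (fst (reciprocal_param z)) (snd (reciprocal_param z)) \<Sigma> =
    (2 * pi) powr - real CARD('k) * det \<Sigma> powr (- 1 / 2) * likelihood (matrix_inv \<Sigma>) (vec_mat R) z"
  using assms by (simp add: f_R_def Let_def reciprocal_param_def kron_vec_inverse likelihood_def)

lemma measurable_f_R:
  fixes \<Sigma> :: "real^(2 \<times> 'k::finite)^(2 \<times> 'k)"
  shows "(\<lambda>(D, m). f_R R D m \<Sigma>) \<in> borel_measurable borel"
  unfolding f_R_def Let_def split_beta
  by (intro borel_measurable_continuous_onI continuous_intros) auto

lemma continuous_on_likelihood [continuous_intros]:
  fixes W :: "real^(2 \<times> 'k::finite)^(2 \<times> 'k)"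
  assumes "continuous_on S f" "continuous_on S g"
  shows "continuous_on S (\<lambda>z. likelihood W (f z) (g z))"
  unfolding likelihood_def by (intro continuous_intros assms) auto

definition likelihood_on :: "(real \<times> (real^'k)) set \<Rightarrow> real^(2 \<times> 'k)^(2 \<times> 'k) \<Rightarrow> real^(2 \<times> 'k::finite) \<Rightarrow> real" where
  "likelihood_on B W v = (\<integral>z. indicator B z * likelihood W v z \<partial>lborel)"

lemma f_w_wap_weight:
  fixes \<Sigma> :: "real^(2 \<times> 'k::finite)^(2 \<times> 'k)"
  shows "f_w (wap_weight n) R \<Sigma> = (2 * pi) powr - real CARD('k) * det \<Sigma> powr (- 1 / 2) /
    measure lborel (cball 0 (real (Suc n)) :: (real \<times> (real^'k)) set) *
    likelihood_on (cball 0 (real (Suc n))) (matrix_inv \<Sigma>) (vec_mat R)"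
proof -
  define B where "B = (cball 0 (real (Suc n)) :: (real \<times> (real^'k)) set)"
  have [measurable]: "B \<in> sets borel" by (simp add: B_def)
  let ?L = "likelihood (matrix_inv \<Sigma>) (vec_mat R)"
  let ?F = "\<lambda>(D, m). f_R R D m \<Sigma>"
  define Z where "Z = measure lborel B"
  define c where "c = (2 * pi) powr - real CARD('k) * det \<Sigma> powr (- 1 / 2)"
  have Z: "emeasure lborel B = ennreal Z" "0 < Z"
    using emeasure_lborel_cball_finite[of "0 :: real \<times> (real^'k)" "real (Suc n)"]
    by (auto simp: Z_def B_def content_cball_pos intro!: emeasure_eq_ennreal_measure)
  note [measurable] = measurable_f_R[of R \<Sigma>]
  have [measurable]: "?L \<in> borel_measurable borel"
    by (intro borel_measurable_continuous_onI continuous_intros)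
  have u: "uniform_measure lborel B = density lborel (\<lambda>z. ennreal (indicator B z / Z))"
    unfolding uniform_measure_def Z(1) using Z(2)
    by (intro arg_cong[where f="density lborel"] ext)
      (simp add: ennreal_indicator[symmetric] divide_ennreal)
  have "f_w (wap_weight n) R \<Sigma> = (\<integral>z. ?F (reciprocal_param z) \<partial>uniform_measure lborel B)"
    unfolding f_w_def wap_weight_def B_def[symmetric] by (subst integral_distr) auto
  also have "\<dots> = (\<integral>z. (indicator B z / Z) *\<^sub>R ?F (reciprocal_param z) \<partial>lborel)"
    unfolding u using Z(2) by (subst integral_density) auto
  also have "\<dots> = (\<integral>z. c / Z * (indicator B z * ?L z) \<partial>lborel)"
  proof (rule integral_cong_AE)
    have "(1, 0) \<in> (Basis :: (real \<times> (real^'k)) set)" by (simp add: Basis_prod_def)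
    from AE_lborel_inner_neq[OF this, of 0]
    have "AE z in (lborel :: (real \<times> (real^'k)) measure). fst z \<noteq> 0"
      by (simp add: inner_prod_def)
    then show "AE z in lborel. (indicator B z / Z) *\<^sub>R ?F (reciprocal_param z) = c / Z * (indicator B z * ?L z)"
      by eventually_elim (simp add: split_beta f_R_reciprocal_param c_def)
  qed measurable
  also have "\<dots> = c / Z * likelihood_on B (matrix_inv \<Sigma>) (vec_mat R)"
    unfolding likelihood_on_def by (rule Bochner_Integration.integral_mult_right_zero)
  finally show ?thesis by (simp only: c_def Z_def B_def)
qed

text \<open>Tonelli with \<mu> integrated first. Although the flat weight is improper, its
  likelihood is finite, so truncations to balls can converge to it.\<close>

lemma has_bochner_integral_likelihood:
  fixes W :: "real^(2 \<times> 'k::finite)^(2 \<times> 'k)"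
  assumes k: "2 \<le> CARD('k)" and W: "pos_def W"
  shows "has_bochner_integral lborel (likelihood W v)
    ((2 * pi) powr (real CARD('k) / 2) * exp ((quad W (a_vec 0) v - v \<bullet> (W *v v)) / 2) * il_integral W v)"
proof (rule has_bochner_integral_nn_integral)
  define c where "c = (2 * pi) powr (real CARD('k) / 2) * exp ((quad W (a_vec 0) v - v \<bullet> (W *v v)) / 2)"
  show m: "likelihood W v \<in> borel_measurable lborel"
    by (simp, intro borel_measurable_continuous_onI continuous_intros)
  have m': "(\<lambda>z. ennreal (likelihood W v z)) \<in> borel_measurable (lborel \<Otimes>\<^sub>M lborel)"
    unfolding lborel_prod using m by measurable
  have c: "0 \<le> c" by (simp add: c_def)
  have "(\<integral>\<^sup>+z. ennreal (likelihood W v z) \<partial>lborel) =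
      (\<integral>\<^sup>+u. (\<integral>\<^sup>+x. ennreal (likelihood W v (u, x)) \<partial>lborel) \<partial>lborel)"
    unfolding lborel.nn_integral_fst[OF m'] lborel_prod ..
  also have "\<dots> = (\<integral>\<^sup>+u. ennreal c * ennreal (il_kernel W v (b_vec u)) \<partial>lborel)"
    by (simp add: likelihood_def nn_integral_likelihood[OF W b_vec_nz, simplified] c_def ennreal_mult il_kernel_nonneg)
  also have "\<dots> = ennreal c * (\<integral>\<^sup>+u. ennreal (il_kernel W v (b_vec u)) \<partial>lborel)"
    using borel_measurable_il_kernel[OF W] by (intro nn_integral_cmult) auto
  also have "(\<integral>\<^sup>+u. ennreal (il_kernel W v (b_vec u)) \<partial>lborel) = ennreal (il_integral W v)"
    unfolding il_integral_def
    by (intro nn_integral_eq_integral integrable_il_kernel k W AE_I2 il_kernel_nonneg)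
  finally show "(\<integral>\<^sup>+z. ennreal (likelihood W v z) \<partial>lborel) = ennreal (c * il_integral W v)"
    using c by (simp add: ennreal_mult')
  show "0 \<le> c * il_integral W v"
    using c by (simp add: il_integral_def il_kernel_nonneg)
qed (simp add: likelihood_def)

lemma likelihood_on_ball_tendsto:
  fixes W :: "real^(2 \<times> 'k::finite)^(2 \<times> 'k)"
  assumes k: "2 \<le> CARD('k)" and W: "pos_def W"
  shows "(\<lambda>n. likelihood_on (cball 0 (real (Suc n))) W v) \<longlonglongrightarrow>
    (2 * pi) powr (real CARD('k) / 2) * exp ((quad W (a_vec 0) v - v \<bullet> (W *v v)) / 2) * il_integral W v"
proof -
  note h = has_bochner_integral_likelihood[OF k W, of v]
  have i: "integrable lborel (likelihood W v)" using h by (rule integrable.intros)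
  then have m: "likelihood W v \<in> borel_measurable lborel" by (rule borel_measurable_integrable)
  have "(\<lambda>n. likelihood_on (cball 0 (real (Suc n))) W v) \<longlonglongrightarrow> (\<integral>z. likelihood W v z \<partial>lborel)"
    unfolding likelihood_on_def
  proof (rule integral_dominated_convergence[OF m _ i])
    show "AE z in lborel. (\<lambda>n. indicator (cball 0 (real (Suc n))) z * likelihood W v z) \<longlonglongrightarrow> likelihood W v z"
    proof (rule AE_I2)
      fix z :: "real \<times> (real^'k)"
      obtain N where N: "norm z \<le> real N" using real_arch_simple by blast
      have "eventually (\<lambda>n. indicator (cball 0 (real (Suc n))) z * likelihood W v z = likelihood W v z) sequentially"
        using eventually_ge_at_top[of N] by eventually_elim (use N in \<open>auto simp: indicator_def\<close>)
      then show "(\<lambda>n. indicator (cball 0 (real (Suc n))) z * likelihood W v z) \<longlonglongrightarrow> likelihood W v z"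
        by (rule tendsto_eventually)
    qed
    show "(\<lambda>z. indicator (cball 0 (real (Suc n))) z * likelihood W v z) \<in> borel_measurable lborel" for n
      using m by (intro borel_measurable_times borel_measurable_indicator) auto
    show "AE z in lborel. norm (indicator (cball 0 (real (Suc n))) z * likelihood W v z) \<le> likelihood W v z" for n
      by (auto simp: indicator_def likelihood_def)
  qed
  then show ?thesis by (simp only: has_bochner_integral_integral_eq[OF h])
qed

text \<open>Test values are 0 or 1, so convergence means eventual equality. Statistic minus critical
  value, times \<open>c n\<close>, converges to its counterpart for \<open>IL\<close>; by
  \<open>neq\<close> the limit is nonzero and its sign is eventually attained.\<close>

lemma WAP_test_tendsto:
  fixes \<Sigma> :: "real^(2 \<times> 'k::finite)^(2 \<times> 'k)"
  assumes k: "2 \<le> CARD('k)" and \<Sigma>: "pos_def \<Sigma>" and \<alpha>: "0 < \<alpha>" "\<alpha> < 1"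
    and neq: "IL R \<Sigma> \<noteq> critical_value \<alpha> IL (T_stat \<Sigma> R) \<Sigma>"
  shows "(\<lambda>n. WAP_test \<alpha> (wap_weight n) R \<Sigma>) \<longlonglongrightarrow> conditional_test \<alpha> IL R \<Sigma>"
proof -
  let ?W = "matrix_inv \<Sigma>"
  let ?Z = "\<lambda>n. measure lborel (cball 0 (real (Suc n)) :: (real \<times> (real^'k)) set)"
  \<comment> \<open>Undoes the ball volume and the determinant of \<Sigma>; being positive and free
    of \<open>R\<close>, it leaves the rejection rule unchanged.\<close>
  define c where "c n = ?Z n / det \<Sigma> powr (- 1 / 2)" for n
  define \<psi> :: "nat \<Rightarrow> 'k statistic" where "\<psi> n = (\<lambda>R \<Sigma>. f_w (wap_weight n) R \<Sigma> / f_S (S_stat \<Sigma> R))" for n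
  have W: "pos_def ?W" by (rule pos_def_matrix_inv[OF \<Sigma>])
  have Z: "0 < ?Z n" for n by (simp add: content_cball_pos)
  have dpos: "0 < det \<Sigma> powr (- 1 / 2)" using pos_def_det[OF \<Sigma>] by simp
  have c: "0 < c n" for n using Z[of n] dpos by (simp add: c_def)
  have \<psi>: "c n * \<psi> n R \<Sigma> = (2 * pi) powr - real CARD('k) / f_S (S_stat \<Sigma> R) * likelihood_on (cball 0 (real (Suc n))) ?W (vec_mat R)" for n R
    using Z[of n] dpos by (simp add: c_def \<psi>_def f_w_wap_weight)
  have lim: "(\<lambda>n. c n * \<psi> n R \<Sigma>) \<longlonglongrightarrow> IL R \<Sigma>" for R
  proof -
    let ?s = "S_stat \<Sigma> R"
    have "quad ?W (a_vec 0) (vec_mat R) - vec_mat R \<bullet> (?W *v vec_mat R) = - (?s \<bullet> ?s)"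
      by (simp add: inner_S_T[OF \<Sigma>] T_stat_inner[OF \<Sigma>])
    then have "(\<lambda>n. likelihood_on (cball 0 (real (Suc n))) ?W (vec_mat R)) \<longlonglongrightarrow>
        (2 * pi) powr (real CARD('k) / 2) * exp (- (?s \<bullet> ?s) / 2) * IL R \<Sigma>"
      using likelihood_on_ball_tendsto[OF k W, of "vec_mat R"] by (simp only: IL_eq_il_integral[OF k \<Sigma>])
    then have "(\<lambda>n. c n * \<psi> n R \<Sigma>) \<longlonglongrightarrow> (2 * pi) powr - real CARD('k) / f_S ?s *
        ((2 * pi) powr (real CARD('k) / 2) * exp (- (?s \<bullet> ?s) / 2) * IL R \<Sigma>)"
      unfolding \<psi> by (rule tendsto_mult_left)
    also have "(2 * pi) powr - real CARD('k) / f_S ?s * ((2 * pi) powr (real CARD('k) / 2) * exp (- (?s \<bullet> ?s) / 2) * IL R \<Sigma>) =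
        ((2 * pi) powr - real CARD('k) * (2 * pi) powr (real CARD('k) / 2) / (2 * pi) powr (- real CARD('k) / 2)) * IL R \<Sigma>"
      by (simp add: f_S_def)
    \<comment> \<open>The exponents balance: -k from the 2k-dimensional density, k/2 from
      integrating \<mu>, k/2 from dividing by \<open>f_S\<close>.\<close>
    also have "(2 * pi) powr - real CARD('k) * (2 * pi) powr (real CARD('k) / 2) / (2 * pi) powr (- real CARD('k) / 2) = 1"
      by (simp flip: powr_add powr_diff)
    finally show ?thesis by simp
  qed
  let ?t = "T_stat \<Sigma> R"
  have meas: "(\<lambda>s. \<psi> n (data_of \<Sigma> s ?t) \<Sigma>) \<in> borel_measurable borel" for n
  proof -
    have "(\<lambda>(s, z). likelihood ?W (recon \<Sigma> s ?t) z) \<in> borel_measurable borel"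
      unfolding split_beta by (intro borel_measurable_continuous_onI continuous_intros) 
    then have [measurable]: "(\<lambda>(s, z). likelihood ?W (recon \<Sigma> s ?t) z) \<in> borel_measurable (borel \<Otimes>\<^sub>M borel)"
      by (simp only: borel_prod)
    have [measurable]: "(\<lambda>s. likelihood_on B ?W (recon \<Sigma> s ?t)) \<in> borel_measurable borel"
      if [measurable]: "B \<in> sets borel" for B
      unfolding likelihood_on_def by measurable
    have [measurable]: "(\<lambda>s. likelihood_on (cball 0 (real (Suc n))) ?W (recon \<Sigma> s ?t)) \<in> borel_measurable borel"
      by measurable
    then show ?thesis
      unfolding \<psi>_def f_w_wap_weight S_stat_data_of[OF \<Sigma>] data_of_eq[OF \<Sigma>] vec_mat_unvec
        S_stat_recon[OF \<Sigma>]
      by measurable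
  qed
  have "(\<lambda>n. quantile (1 - \<alpha>) null_S (\<lambda>s. c n * \<psi> n (data_of \<Sigma> s ?t) \<Sigma>)) \<longlonglongrightarrow> critical_value \<alpha> IL ?t \<Sigma>"
    by (rule critical_value_IL_tendsto[OF k \<Sigma> \<alpha>]) (use meas lim in auto)
  also have "(\<lambda>n. quantile (1 - \<alpha>) null_S (\<lambda>s. c n * \<psi> n (data_of \<Sigma> s ?t) \<Sigma>)) =
      (\<lambda>n. c n * critical_value \<alpha> (\<psi> n) ?t \<Sigma>)"
    unfolding critical_value_def
    by (intro ext quantile_scale prob_space_null_S) (use meas \<alpha> c in auto)
  finally have "(\<lambda>n. c n * \<psi> n R \<Sigma> - c n * critical_value \<alpha> (\<psi> n) ?t \<Sigma>) \<longlonglongrightarrow> IL R \<Sigma> - critical_value \<alpha> IL ?t \<Sigma>"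
    by (intro tendsto_diff lim)
  then have d: "(\<lambda>n. c n * (\<psi> n R \<Sigma> - critical_value \<alpha> (\<psi> n) ?t \<Sigma>)) \<longlonglongrightarrow> IL R \<Sigma> - critical_value \<alpha> IL ?t \<Sigma>"
    by (simp only: right_diff_distrib)
  have "eventually (\<lambda>n. \<psi> n R \<Sigma> > critical_value \<alpha> (\<psi> n) ?t \<Sigma> \<longleftrightarrow> IL R \<Sigma> > critical_value \<alpha> IL ?t \<Sigma>) sequentially"
  proof (cases "IL R \<Sigma> > critical_value \<alpha> IL ?t \<Sigma>")
    case True
    then show ?thesis
      using order_tendstoD(1)[OF d, of 0] c by (auto elim!: eventually_mono simp: zero_less_mult_iff dest: less_asym)
  next
    case False
    with neq show ?thesis
      using order_tendstoD(2)[OF d, of 0] c by (auto elim!: eventually_mono simp: mult_less_0_iff dest: less_asym)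
  qed
  then show ?thesis
    unfolding WAP_test_def conditional_test_def \<psi>_def[symmetric]
    by (intro tendsto_eventually) (auto elim!: eventually_mono)
qed

text \<open>The limit of tests is taken pointwise for almost every \<open>R\<close>, with one
  sequence of weights for all levels and variances. Null sets of \<open>lborel\<close> are those of
  every distribution in the model, as normal densities are positive.\<close>

theorem theorem3:
  assumes "2 \<le> CARD('k::finite)"
  shows "(\<forall>\<alpha>. 0 < \<alpha> \<and> \<alpha> < 1 \<longrightarrow>
           invariant_test (conditional_test \<alpha> (IL :: 'k statistic))) \<and>
         (\<exists>w :: nat \<Rightarrow> (real \<times> (real ^ 'k)) measure.
           (\<forall>n. weight (w n)) \<and>
           (\<forall>\<alpha>. 0 < \<alpha> \<and> \<alpha> < 1 \<longrightarrow>
             (\<forall>\<Sigma> :: real ^ (2 \<times> 'k) ^ (2 \<times> 'k). pos_def \<Sigma> \<longrightarrow>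
               (AE R in lborel.
                 (\<lambda>n. WAP_test \<alpha> (w n) R \<Sigma>) \<longlonglongrightarrow> conditional_test \<alpha> IL R \<Sigma>))))"
proof (intro conjI allI impI)
  fix \<alpha> :: real assume "0 < \<alpha> \<and> \<alpha> < 1"
  then show "invariant_test (conditional_test \<alpha> (IL :: 'k statistic))"
    unfolding invariant_test_def using conditional_test_IL_transform assms by blast
next
  show "\<exists>w :: nat \<Rightarrow> (real \<times> (real ^ 'k)) measure.
           (\<forall>n. weight (w n)) \<and>
           (\<forall>\<alpha>. 0 < \<alpha> \<and> \<alpha> < 1 \<longrightarrow>
             (\<forall>\<Sigma> :: real ^ (2 \<times> 'k) ^ (2 \<times> 'k). pos_def \<Sigma> \<longrightarrow>
               (AE R in lborel.
                 (\<lambda>n. WAP_test \<alpha> (w n) R \<Sigma>) \<longlonglongrightarrow> conditional_test \<alpha> IL R \<Sigma>)))"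
  proof (intro exI[of _ wap_weight] conjI allI impI weight_wap_weight)
    fix \<alpha> :: real and \<Sigma> :: "real ^ (2 \<times> 'k) ^ (2 \<times> 'k)"
    assume \<alpha>: "0 < \<alpha> \<and> \<alpha> < 1" and \<Sigma>: "pos_def \<Sigma>"
    from \<alpha> have "AE R in lborel. IL R \<Sigma> \<noteq> critical_value \<alpha> IL (T_stat \<Sigma> R) \<Sigma>"
      by (intro AE_IL_neq_critical_value assms \<Sigma>) auto
    then show "AE R in lborel. (\<lambda>n. WAP_test \<alpha> (wap_weight n) R \<Sigma>) \<longlonglongrightarrow> conditional_test \<alpha> IL R \<Sigma>"
      by eventually_elim (use WAP_test_tendsto assms \<Sigma> \<alpha> in blast)
  qed
qed

end
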